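(* Let $(M^{2n+s}, \phi,\xi_i, \eta_j, g)$ be an $\mathcal{S}$-manifold. Then the Ricci tensor $\mathrm{Ric}^{\nabla}$ induced by the characteristic connection $\nabla=\nabla^g+\frac{1}{2}T$ satisfies the following relations: $$\mathrm{Ric}^{\nabla}(X, Y)=\mathrm{Ric}^{g}(X, Y)-2s\,g(X, Y)\quad \forall\, X, Y\in\mathcal{D},$$ $$\mathrm{Ric}^{\nabla}(X, \xi_i)=0\quad \forall\, X\in\mathcal{D},\ i\in\{1, \ldots, s\},$$ $$\mathrm{Ric}^{\nabla}(\xi_i, \xi_j)=0\quad\forall\, i, j\in\{1, \ldots, s\}.$$ In particular, for the Ricci endomorphism $\mathrm{Ric}^{\nabla} : TM\to TM$ corresponding to $\nabla$ one has $$\mathrm{Ric}^{\nabla}|_{\mathcal{D}}=\mathrm{Ric}^{g}|_{\mathcal{D}}-2s\,\mathrm{Id}|_{\mathcal{D}},\qquad \mathrm{Ric}^{\nabla}|_{\mathcal{D}^{\perp}}=0,$$ where $\mathrm{Ric}^{g}|_{\mathcal{D}}$ denotes the restriction of the Riemannian Ricci endomorphism to the horizontal distribution $\mathcal{D}$.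
   Context: A metric $f$-manifold $(M^{2n+s},\phi,\xi_i,\eta_j,g)$ is a smooth connected manifold of dimension $2n+s$ with an endomorphism $\phi$ of $TM$ of constant rank $2n$, global vector fields $\xi_1,\dots,\xi_s$, 1-forms $\eta_1,\dots,\eta_s$ and a Riemannian metric $g$ such that $\mathrm{Ker}(\phi)=\langle\xi_1,\dots,\xi_s\rangle$, $\eta_i(\xi_j)=\delta_{ij}$, $\eta_i\circ\phi=0$, $\phi^2=-\mathrm{Id}+\sum_{i=1}^s\eta_i\otimes\xi_i$, and $g(\phi X,\phi Y)=g(X,Y)-\sum_{i=1}^s\eta_i(X)\eta_i(Y)$. Set $F(X,Y)=g(X,\phi Y)$ and $N^{(1)}=N_\phi+\sum_i d\eta_i\otimes\xi_i$, where $N_\phi(X,Y)=[\phi X,\phi Y]+\phi^2[X,Y]-\phi[X,\phi Y]-\phi[\phi X,Y]$ and $d\eta(X,Y)=X\eta(Y)-Y\eta(X)-\eta([X,Y])$. It is an $\mathcal{S}$-manifold if $s\ge1$, $2F=d\eta_j$ for all $j$, and $N^{(1)}=0$. Put $\mathcal{D}=\mathrm{Im}(\phi)=\bigcap_i\mathrm{Ker}(\eta_i)$ (horizontal) and $\mathcal{D}^\perp=\mathrm{Ker}(\phi)$ (vertical), so $TM=\mathcal{D}\oplus\mathcal{D}^\perp$. The characteristic connection of an $\mathcal{S}$-manifold is the metric connection $\nabla=\nabla^g+\frac12T$, i.e. $\nabla_XY=\nabla^g_XY+\frac12T(X,Y)$ with $\nabla^g$ the Levi-Civita connection, with totally skew-symmetric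 torsion $T=\sum_{i}\eta_i\wedge d\eta_i$, equivalently $T(X,Y)=2\sum_{i}\{F(X,Y)\xi_i-\eta_i(X)\phi(Y)+\eta_i(Y)\phi(X)\}$. It is the unique metric connection with skew-torsion satisfying $\nabla\phi=0$, $\nabla\xi_i=0$, $\nabla\eta_j=0$, and it satisfies $\nabla T=0$. Curvature convention for any connection: $R(X,Y)Z=\nabla_X\nabla_YZ-\nabla_Y\nabla_XZ-\nabla_{[X,Y]}Z$; the Ricci tensor is $\mathrm{Ric}(U,V)=\sum_{a=1}^{2n+s}g(R(U,e_a)e_a,V)$ for a local $g$-orthonormal frame ($\mathrm{Ric}^\nabla$ for $\nabla$, which is symmetric, and $\mathrm{Ric}^g$ for $\nabla^g$); the Ricci endomorphisms are obtained by raising an index with $g$. *)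

theory Defs
  imports "HOL-Analysis.Analysis" "HOL-Library.Function_Algebras"
begin

text \<open>
  Tangent vectors will be real-valued functionals on functions. They are added with the pointwise
  operations of \<^theory>\<open>HOL-Library.Function_Algebras\<close>, which lacks scalar multiplication.
\<close>

instantiation "fun" :: (type, real_vector) real_vector
begin

definition scaleR_fun :: "real \<Rightarrow> ('a \<Rightarrow> 'b) \<Rightarrow> 'a \<Rightarrow> 'b"
  where "scaleR_fun r f = (\<lambda>x. r *\<^sub>R f x)"

instance
  by standard (auto simp: scaleR_fun_def fun_eq_iff scaleR_add_left scaleR_add_right)

end

lemma scaleR_fun_apply [simp]: "(r *\<^sub>R f) x = r *\<^sub>R f x" for f :: "'a \<Rightarrow> 'b::real_vector"
  by (simp add: scaleR_fun_def)


section \<open>Smooth manifolds\<close>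

text \<open>Both notions below are meant for open \<open>S\<close>.\<close>

primrec Ck_on :: "nat \<Rightarrow> 'e set \<Rightarrow> ('e::euclidean_space \<Rightarrow> 'b::real_normed_vector) \<Rightarrow> bool"
  where
    "Ck_on 0 S f \<longleftrightarrow> continuous_on S f"
  | "Ck_on (Suc k) S f \<longleftrightarrow>
       (\<forall>x\<in>S. f differentiable (at x)) \<and> (\<forall>v. Ck_on k S (\<lambda>x. frechet_derivative f (at x) v))"

definition smooth_on :: "'e set \<Rightarrow> ('e::euclidean_space \<Rightarrow> 'b::real_normed_vector) \<Rightarrow> bool"
  where "smooth_on S f \<longleftrightarrow> (\<forall>k. Ck_on k S f)"

text \<open>
  The underlying space of a manifold is the whole type \<open>'a\<close>, and the model space is the Euclidean
  space \<open>'e\<close>, so the dimension is \<open>DIM('e)\<close>. A chart is a domain \<open>U\<close> together with a coordinate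
  map \<open>c\<close>, whose values outside \<open>U\<close> are irrelevant. The atlas is not required to be maximal.
\<close>

type_synonym ('a, 'e) chart = "'a set \<times> ('a \<Rightarrow> 'e)"

locale smooth_manifold =
  fixes A :: "('a::{t2_space,second_countable_topology}, 'e::euclidean_space) chart set"
  assumes chart_homeomorphism: "\<And>U c. (U, c) \<in> A \<Longrightarrow>
      open U \<and> open (c ` U) \<and> homeomorphism U (c ` U) c (inv_into U c)"
    and charts_cover: "(\<Union>(U, c)\<in>A. U) = UNIV"
    and charts_compatible: "\<And>U c V d. (U, c) \<in> A \<Longrightarrow> (V, d) \<in> A \<Longrightarrow>
      smooth_on (c ` (U \<inter> V)) (d \<circ> inv_into U c)"

definition smooth_fun :: "('a::topological_space, 'e::euclidean_space) chart set \<Rightarrow>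
    'a set \<Rightarrow> ('a \<Rightarrow> real) \<Rightarrow> bool"
  where "smooth_fun A W f \<longleftrightarrow> (\<forall>(U, c)\<in>A. smooth_on (c ` (U \<inter> W)) (f \<circ> inv_into U c))"

definition smooth_near :: "('a::topological_space, 'e::euclidean_space) chart set \<Rightarrow>
    'a \<Rightarrow> ('a \<Rightarrow> real) \<Rightarrow> bool"
  where "smooth_near A p f \<longleftrightarrow> (\<exists>W. open W \<and> p \<in> W \<and> smooth_fun A W f)"

text \<open>
  A tangent vector at \<open>p\<close> is a directional derivative \<open>f \<mapsto> \<Sum>\<^sub>i w\<^sup>i \<partial>f/\<partial>x\<^sup>i (p)\<close> in some chart
  around \<open>p\<close>, acting on functions that are smooth near \<open>p\<close>. It is set to 0 on all other
  functions, so that equal derivations are equal as functionals.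
\<close>

type_synonym 'a tvec = "('a \<Rightarrow> real) \<Rightarrow> real"

definition dir_deriv :: "('a::topological_space, 'e::euclidean_space) chart set \<Rightarrow>
    ('a, 'e) chart \<Rightarrow> 'a \<Rightarrow> 'e \<Rightarrow> 'a tvec"
  where "dir_deriv A ch p w f =
    (if smooth_near A p f
     then frechet_derivative (f \<circ> inv_into (fst ch) (snd ch)) (at (snd ch p)) w else 0)"

definition tangent_space :: "('a::topological_space, 'e::euclidean_space) chart set \<Rightarrow>
    'a \<Rightarrow> 'a tvec set"
  where "tangent_space A p = {dir_deriv A (U, c) p w | U c w. (U, c) \<in> A \<and> p \<in> U}"

text \<open>
  Smooth vector fields over an open set \<open>U\<close>. They are total functions, but their values outside
  \<open>U\<close> are irrelevant. All geometric operators below act on such local sections.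
\<close>

type_synonym 'a vfield = "'a \<Rightarrow> 'a tvec"

definition vector_fields :: "('a::topological_space, 'e::euclidean_space) chart set \<Rightarrow>
    'a set \<Rightarrow> 'a vfield set"
  where "vector_fields A U = {X. (\<forall>p\<in>U. X p \<in> tangent_space A p) \<and>
    (\<forall>W f. open W \<and> W \<subseteq> U \<and> smooth_fun A W f \<longrightarrow> smooth_fun A W (\<lambda>p. X p f))}"

definition lie_bracket :: "('a::topological_space, 'e::euclidean_space) chart set \<Rightarrow>
    'a vfield \<Rightarrow> 'a vfield \<Rightarrow> 'a vfield"
  where "lie_bracket A X Y p f =
    (if smooth_near A p f then X p (\<lambda>q. Y q f) - Y p (\<lambda>q. X q f) else 0)"


section \<open>Tensor fields\<close>

definition one_form :: "('a::topological_space, 'e::euclidean_space) chart set \<Rightarrow>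
    ('a \<Rightarrow> 'a tvec \<Rightarrow> real) \<Rightarrow> bool"
  where "one_form A \<eta> \<longleftrightarrow>
    (\<forall>p. \<forall>u\<in>tangent_space A p. \<forall>v\<in>tangent_space A p. \<forall>a b.
       \<eta> p (a *\<^sub>R u + b *\<^sub>R v) = a * \<eta> p u + b * \<eta> p v) \<and>
    (\<forall>U X. open U \<and> X \<in> vector_fields A U \<longrightarrow> smooth_fun A U (\<lambda>p. \<eta> p (X p)))"

definition tangent_endomorphism :: "('a::topological_space, 'e::euclidean_space) chart set \<Rightarrow>
    ('a \<Rightarrow> 'a tvec \<Rightarrow> 'a tvec) \<Rightarrow> bool"
  where "tangent_endomorphism A \<phi> \<longleftrightarrow>
    (\<forall>p. \<forall>u\<in>tangent_space A p. \<phi> p u \<in> tangent_space A p) \<and>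
    (\<forall>p. \<forall>u\<in>tangent_space A p. \<forall>v\<in>tangent_space A p. \<forall>a b.
       \<phi> p (a *\<^sub>R u + b *\<^sub>R v) = a *\<^sub>R \<phi> p u + b *\<^sub>R \<phi> p v) \<and>
    (\<forall>U X. open U \<and> X \<in> vector_fields A U \<longrightarrow> (\<lambda>p. \<phi> p (X p)) \<in> vector_fields A U)"

definition riemannian_metric :: "('a::topological_space, 'e::euclidean_space) chart set \<Rightarrow>
    ('a \<Rightarrow> 'a tvec \<Rightarrow> 'a tvec \<Rightarrow> real) \<Rightarrow> bool"
  where "riemannian_metric A g \<longleftrightarrow>
    (\<forall>p. \<forall>u\<in>tangent_space A p. \<forall>v\<in>tangent_space A p. \<forall>w\<in>tangent_space A p. \<forall>a b.
       g p (a *\<^sub>R u + b *\<^sub>R v) w = a * g p u w + b * g p v w) \<and>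
    (\<forall>p. \<forall>u\<in>tangent_space A p. \<forall>v\<in>tangent_space A p. g p u v = g p v u) \<and>
    (\<forall>p. \<forall>u\<in>tangent_space A p. u \<noteq> 0 \<longrightarrow> g p u u > 0) \<and>
    (\<forall>U X Y. open U \<and> X \<in> vector_fields A U \<and> Y \<in> vector_fields A U \<longrightarrow>
       smooth_fun A U (\<lambda>p. g p (X p) (Y p)))"

definition exterior_deriv :: "('a::topological_space, 'e::euclidean_space) chart set \<Rightarrow>
    ('a \<Rightarrow> 'a tvec \<Rightarrow> real) \<Rightarrow> 'a vfield \<Rightarrow> 'a vfield \<Rightarrow> 'a \<Rightarrow> real"
  where "exterior_deriv A \<eta> X Y p =
    X p (\<lambda>q. \<eta> q (Y q)) - Y p (\<lambda>q. \<eta> q (X q)) - \<eta> p (lie_bracket A X Y p)"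

definition nijenhuis :: "('a::topological_space, 'e::euclidean_space) chart set \<Rightarrow>
    ('a \<Rightarrow> 'a tvec \<Rightarrow> 'a tvec) \<Rightarrow> 'a vfield \<Rightarrow> 'a vfield \<Rightarrow> 'a vfield"
  where "nijenhuis A \<phi> X Y p =
    lie_bracket A (\<lambda>q. \<phi> q (X q)) (\<lambda>q. \<phi> q (Y q)) p + \<phi> p (\<phi> p (lie_bracket A X Y p))
    - \<phi> p (lie_bracket A X (\<lambda>q. \<phi> q (Y q)) p) - \<phi> p (lie_bracket A (\<lambda>q. \<phi> q (X q)) Y p)"


section \<open>Connections and curvature\<close>

text \<open>
  A connection is given by its action on local sections over every open set; each connection on the
  tangent bundle induces such an operator, and conversely. Locality need not be postulated: since
  values outside \<open>U\<close> are irrelevant, it follows from the Leibniz rule with indicator functions.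
\<close>

definition affine_connection :: "('a::topological_space, 'e::euclidean_space) chart set \<Rightarrow>
    ('a vfield \<Rightarrow> 'a vfield \<Rightarrow> 'a vfield) \<Rightarrow> bool"
  where "affine_connection A D \<longleftrightarrow> (\<forall>U. open U \<longrightarrow>
    (\<forall>X\<in>vector_fields A U. \<forall>Y\<in>vector_fields A U. D X Y \<in> vector_fields A U) \<and>
    (\<forall>X\<in>vector_fields A U. \<forall>X'\<in>vector_fields A U. \<forall>Y\<in>vector_fields A U. \<forall>p\<in>U.
       D (X + X') Y p = D X Y p + D X' Y p \<and> D Y (X + X') p = D Y X p + D Y X' p) \<and>
    (\<forall>f X Y. smooth_fun A U f \<and> X \<in> vector_fields A U \<and> Y \<in> vector_fields A U \<longrightarrow>
       (\<forall>p\<in>U. D (\<lambda>q. f q *\<^sub>R X q) Y p = f p *\<^sub>R D X Y p \<and>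
              D X (\<lambda>q. f q *\<^sub>R Y q) p = X p f *\<^sub>R Y p + f p *\<^sub>R D X Y p)))"

definition levi_civita_connection :: "('a::topological_space, 'e::euclidean_space) chart set \<Rightarrow>
    ('a \<Rightarrow> 'a tvec \<Rightarrow> 'a tvec \<Rightarrow> real) \<Rightarrow> ('a vfield \<Rightarrow> 'a vfield \<Rightarrow> 'a vfield) \<Rightarrow> bool"
  where "levi_civita_connection A g D \<longleftrightarrow> affine_connection A D \<and>
    (\<forall>U. open U \<longrightarrow>
      (\<forall>X\<in>vector_fields A U. \<forall>Y\<in>vector_fields A U. \<forall>p\<in>U.
         D X Y p - D Y X p = lie_bracket A X Y p) \<and>
      (\<forall>X\<in>vector_fields A U. \<forall>Y\<in>vector_fields A U. \<forall>Z\<in>vector_fields A U. \<forall>p\<in>U.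
         X p (\<lambda>q. g q (Y q) (Z q)) = g p (D X Y p) (Z p) + g p (Y p) (D X Z p)))"

definition curvature :: "('a::topological_space, 'e::euclidean_space) chart set \<Rightarrow>
    ('a vfield \<Rightarrow> 'a vfield \<Rightarrow> 'a vfield) \<Rightarrow> 'a vfield \<Rightarrow> 'a vfield \<Rightarrow> 'a vfield \<Rightarrow> 'a vfield"
  where "curvature A D X Y Z p = D X (D Y Z) p - D Y (D X Z) p - D (lie_bracket A X Y) Z p"

definition orthonormal_frame :: "('a::topological_space, 'e::euclidean_space) chart set \<Rightarrow>
    ('a \<Rightarrow> 'a tvec \<Rightarrow> 'a tvec \<Rightarrow> real) \<Rightarrow> 'a set \<Rightarrow> (nat \<Rightarrow> 'a vfield) \<Rightarrow> bool"
  where "orthonormal_frame A g U e \<longleftrightarrow>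
    (\<forall>a\<in>{1..DIM('e)}. e a \<in> vector_fields A U) \<and>
    (\<forall>p\<in>U. \<forall>a\<in>{1..DIM('e)}. \<forall>b\<in>{1..DIM('e)}. g p (e a p) (e b p) = (if a = b then 1 else 0))"

text \<open>
  The Ricci tensor at \<open>p\<close>, for \<open>u\<close> and \<open>v\<close> tangent at \<open>p\<close>: the common value of
  \<open>\<Sum>\<^sub>a g(R(X, e\<^sub>a)e\<^sub>a, v)\<close> over all local orthonormal frames \<open>e\<close> near \<open>p\<close> and all local extensions
  \<open>X\<close> of \<open>u\<close>. That it exists is the tensoriality of the curvature.
\<close>

definition ricci :: "('a::topological_space, 'e::euclidean_space) chart set \<Rightarrow>
    ('a \<Rightarrow> 'a tvec \<Rightarrow> 'a tvec \<Rightarrow> real) \<Rightarrow> ('a vfield \<Rightarrow> 'a vfield \<Rightarrow> 'a vfield) \<Rightarrow>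
    'a \<Rightarrow> 'a tvec \<Rightarrow> 'a tvec \<Rightarrow> real"
  where "ricci A g D p u v = (THE r. \<forall>U e X.
    open U \<and> p \<in> U \<and> orthonormal_frame A g U e \<and> X \<in> vector_fields A U \<and> X p = u \<longrightarrow>
    r = (\<Sum>a = 1..DIM('e). g p (curvature A D X (e a) (e a) p) v))"

definition ricci_endomorphism :: "('a::topological_space, 'e::euclidean_space) chart set \<Rightarrow>
    ('a \<Rightarrow> 'a tvec \<Rightarrow> 'a tvec \<Rightarrow> real) \<Rightarrow> ('a vfield \<Rightarrow> 'a vfield \<Rightarrow> 'a vfield) \<Rightarrow>
    'a \<Rightarrow> 'a tvec \<Rightarrow> 'a tvec"
  where "ricci_endomorphism A g D p u =
    (THE w. w \<in> tangent_space A p \<and> (\<forall>v\<in>tangent_space A p. g p w v = ricci A g D p u v))"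


section \<open>Metric \<open>f\<close>-manifolds and \<open>\<S>\<close>-manifolds\<close>

locale metric_f_manifold = smooth_manifold A
  for A :: "('a::{t2_space,second_countable_topology}, 'e::euclidean_space) chart set" +
  fixes n s :: nat
    and \<phi> :: "'a \<Rightarrow> 'a tvec \<Rightarrow> 'a tvec"
    and \<xi> :: "nat \<Rightarrow> 'a vfield"
    and \<eta> :: "nat \<Rightarrow> 'a \<Rightarrow> 'a tvec \<Rightarrow> real"
    and g :: "'a \<Rightarrow> 'a tvec \<Rightarrow> 'a tvec \<Rightarrow> real"
  assumes connected: "connected (UNIV :: 'a set)"
    and dimension: "DIM('e) = 2 * n + s"
    and phi_endomorphism: "tangent_endomorphism A \<phi>"
    and phi_rank: "\<And>p. dim (\<phi> p ` tangent_space A p) = 2 * n"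
    and xi_vector_field: "\<And>i. i \<in> {1..s} \<Longrightarrow> \<xi> i \<in> vector_fields A UNIV"
    and eta_one_form: "\<And>i. i \<in> {1..s} \<Longrightarrow> one_form A (\<eta> i)"
    and metric: "riemannian_metric A g"
    and phi_kernel: "\<And>p. {u \<in> tangent_space A p. \<phi> p u = 0} = span ((\<lambda>i. \<xi> i p) ` {1..s})"
    and eta_xi: "\<And>i j p. i \<in> {1..s} \<Longrightarrow> j \<in> {1..s} \<Longrightarrow> \<eta> i p (\<xi> j p) = (if i = j then 1 else 0)"
    and eta_phi: "\<And>i p u. i \<in> {1..s} \<Longrightarrow> u \<in> tangent_space A p \<Longrightarrow> \<eta> i p (\<phi> p u) = 0"
    and phi_phi: "\<And>p u. u \<in> tangent_space A p \<Longrightarrow>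
      \<phi> p (\<phi> p u) = - u + (\<Sum>i = 1..s. \<eta> i p u *\<^sub>R \<xi> i p)"
    and metric_phi: "\<And>p u v. u \<in> tangent_space A p \<Longrightarrow> v \<in> tangent_space A p \<Longrightarrow>
      g p (\<phi> p u) (\<phi> p v) = g p u v - (\<Sum>i = 1..s. \<eta> i p u * \<eta> i p v)"

definition fundamental_form :: "('a \<Rightarrow> 'a tvec \<Rightarrow> 'a tvec) \<Rightarrow>
    ('a \<Rightarrow> 'a tvec \<Rightarrow> 'a tvec \<Rightarrow> real) \<Rightarrow> 'a \<Rightarrow> 'a tvec \<Rightarrow> 'a tvec \<Rightarrow> real"
  where "fundamental_form \<phi> g p u v = g p u (\<phi> p v)"

locale S_manifold = metric_f_manifold A n s \<phi> \<xi> \<eta> g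
  for A :: "('a::{t2_space,second_countable_topology}, 'e::euclidean_space) chart set"
    and n s \<phi> \<xi> \<eta> g +
  assumes s_pos: "s \<ge> 1"
    and fundamental_form_eq: "\<And>U X Y j p. open U \<Longrightarrow> X \<in> vector_fields A U \<Longrightarrow>
      Y \<in> vector_fields A U \<Longrightarrow> j \<in> {1..s} \<Longrightarrow> p \<in> U \<Longrightarrow>
      2 * fundamental_form \<phi> g p (X p) (Y p) = exterior_deriv A (\<eta> j) X Y p"
    and normality: "\<And>U X Y p. open U \<Longrightarrow> X \<in> vector_fields A U \<Longrightarrow>
      Y \<in> vector_fields A U \<Longrightarrow> p \<in> U \<Longrightarrow>
      nijenhuis A \<phi> X Y p + (\<Sum>i = 1..s. exterior_deriv A (\<eta> i) X Y p *\<^sub>R \<xi> i p) = 0"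

definition horizontal :: "('a::topological_space, 'e::euclidean_space) chart set \<Rightarrow>
    ('a \<Rightarrow> 'a tvec \<Rightarrow> 'a tvec) \<Rightarrow> 'a \<Rightarrow> 'a tvec set"
  where "horizontal A \<phi> p = \<phi> p ` tangent_space A p"

definition vertical :: "('a::topological_space, 'e::euclidean_space) chart set \<Rightarrow>
    ('a \<Rightarrow> 'a tvec \<Rightarrow> 'a tvec) \<Rightarrow> 'a \<Rightarrow> 'a tvec set"
  where "vertical A \<phi> p = {u \<in> tangent_space A p. \<phi> p u = 0}"

text \<open>
  The torsion \<open>T = \<Sum>\<^sub>i \<eta>\<^sub>i \<and> d\<eta>\<^sub>i\<close> as a vector-valued 2-form; the lemma
  \<open>characteristic_torsion_eq_wedge\<close> below relates it to this 3-form.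
\<close>

definition characteristic_torsion :: "nat \<Rightarrow> ('a \<Rightarrow> 'a tvec \<Rightarrow> 'a tvec) \<Rightarrow> (nat \<Rightarrow> 'a vfield) \<Rightarrow>
    (nat \<Rightarrow> 'a \<Rightarrow> 'a tvec \<Rightarrow> real) \<Rightarrow> ('a \<Rightarrow> 'a tvec \<Rightarrow> 'a tvec \<Rightarrow> real) \<Rightarrow>
    'a \<Rightarrow> 'a tvec \<Rightarrow> 'a tvec \<Rightarrow> 'a tvec"
  where "characteristic_torsion s \<phi> \<xi> \<eta> g p u v = 2 *\<^sub>R (\<Sum>i = 1..s.
    fundamental_form \<phi> g p u v *\<^sub>R \<xi> i p - \<eta> i p u *\<^sub>R \<phi> p v + \<eta> i p v *\<^sub>R \<phi> p u)"

definition characteristic_connection :: "nat \<Rightarrow> ('a \<Rightarrow> 'a tvec \<Rightarrow> 'a tvec) \<Rightarrow>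
    (nat \<Rightarrow> 'a vfield) \<Rightarrow> (nat \<Rightarrow> 'a \<Rightarrow> 'a tvec \<Rightarrow> real) \<Rightarrow>
    ('a \<Rightarrow> 'a tvec \<Rightarrow> 'a tvec \<Rightarrow> real) \<Rightarrow> ('a vfield \<Rightarrow> 'a vfield \<Rightarrow> 'a vfield) \<Rightarrow>
    'a vfield \<Rightarrow> 'a vfield \<Rightarrow> 'a vfield"
  where "characteristic_connection s \<phi> \<xi> \<eta> g D X Y p =
    D X Y p + (1/2) *\<^sub>R characteristic_torsion s \<phi> \<xi> \<eta> g p (X p) (Y p)"

lemma smooth_near_differentiable:
  assumes "smooth_manifold A" "(U, c) \<in> A" "p \<in> U" "smooth_near A p f"
  shows "(f \<circ> inv_into U c) differentiable (at (c p))"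
proof -
  obtain W where W: "p \<in> W" "smooth_fun A W f"
    using assms(4) by (auto simp: smooth_near_def)
  have "Ck_on (Suc 0) (c ` (U \<inter> W)) (f \<circ> inv_into U c)"
    using W assms(2) unfolding smooth_fun_def smooth_on_def by blast
  then show ?thesis
    using W assms(3) by auto
qed

text \<open>All charts around \<open>p\<close> yield the same tangent space.\<close>

lemma dir_deriv_change_chart:
  assumes M: "smooth_manifold A" and c: "(U, c) \<in> A" "p \<in> U" and d: "(V, d) \<in> A" "p \<in> V"
  shows "dir_deriv A (U, c) p w =
    dir_deriv A (V, d) p (frechet_derivative (d \<circ> inv_into U c) (at (c p)) w)"
proof
  fix f
  interpret smooth_manifold A by fact
  let ?\<tau> = "d \<circ> inv_into U c"
  show "dir_deriv A (U, c) p w f =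
    dir_deriv A (V, d) p (frechet_derivative ?\<tau> (at (c p)) w) f"
  proof (cases "smooth_near A p f")
    case True
    have hU: "open U" "open (c ` U)" "homeomorphism U (c ` U) c (inv_into U c)"
      and hV: "open V" "open (d ` V)" "homeomorphism V (d ` V) d (inv_into V d)"
      using chart_homeomorphism c(1) d(1) by blast+
    have ic: "inv_into U c (c q) = q" if "q \<in> U" for q
      using hU(3) that by (auto simp: homeomorphism_def)
    have id: "inv_into V d (d q) = q" if "q \<in> V" for q
      using hV(3) that by (auto simp: homeomorphism_def)
    have "Ck_on (Suc 0) (c ` (U \<inter> V)) ?\<tau>"
      using charts_compatible[OF c(1) d(1)] unfolding smooth_on_def by blast
    then have \<tau>: "?\<tau> differentiable (at (c p))"
      using c(2) d(2) by auto
    have fd: "(f \<circ> inv_into V d) differentiable (at (?\<tau> (c p)))"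
      using smooth_near_differentiable[OF M d True] ic[OF c(2)] by simp
    have der: "((f \<circ> inv_into V d) \<circ> ?\<tau> has_derivative
        frechet_derivative (f \<circ> inv_into V d) (at (?\<tau> (c p))) \<circ> frechet_derivative ?\<tau> (at (c p)))
        (at (c p))"
      using fd \<tau> by (intro diff_chain_at) (auto simp: frechet_derivative_works)
    have "openin (top_of_set (c ` U)) (c ` U \<inter> inv_into U c -` V)"
      using hU(3) hV(1) by (auto simp: homeomorphism_def intro: continuous_openin_preimage_gen)
    then have op: "open (c ` U \<inter> inv_into U c -` V)"
      using hU(2) openin_open_eq by blast
    have "((f \<circ> inv_into U c) has_derivative
        frechet_derivative (f \<circ> inv_into V d) (at (?\<tau> (c p))) \<circ> frechet_derivative ?\<tau> (at (c p)))
        (at (c p))"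
      using der op
    proof (rule has_derivative_transform_within_open)
      show "c p \<in> c ` U \<inter> inv_into U c -` V"
        using c(2) d(2) ic by auto
      show "((f \<circ> inv_into V d) \<circ> ?\<tau>) x = (f \<circ> inv_into U c) x"
        if "x \<in> c ` U \<inter> inv_into U c -` V" for x
        using that id by auto
    qed
    then have "frechet_derivative (f \<circ> inv_into U c) (at (c p)) =
        frechet_derivative (f \<circ> inv_into V d) (at (?\<tau> (c p))) \<circ> frechet_derivative ?\<tau> (at (c p))"
      by (rule frechet_derivative_at[symmetric])
    then show ?thesis
      using True ic[OF c(2)] by (simp add: dir_deriv_def)
  qed (simp add: dir_deriv_def)
qed

lemma tangent_space_eq_range:
  assumes "smooth_manifold A" "(U, c) \<in> A" "p \<in> U"
  shows "tangent_space A p = range (dir_deriv A (U, c) p)"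
proof
  show "tangent_space A p \<subseteq> range (dir_deriv A (U, c) p)"
  proof
    fix v
    assume "v \<in> tangent_space A p"
    then obtain V d w where "(V, d) \<in> A" "p \<in> V" "v = dir_deriv A (V, d) p w"
      unfolding tangent_space_def by blast
    then show "v \<in> range (dir_deriv A (U, c) p)"
      using dir_deriv_change_chart[OF assms(1) _ _ assms(2,3)] by auto
  qed
  show "range (dir_deriv A (U, c) p) \<subseteq> tangent_space A p"
    using assms(2,3) unfolding tangent_space_def by blast
qed

lemma linear_dir_deriv:
  assumes "smooth_manifold A" "(U, c) \<in> A" "p \<in> U"
  shows "linear (dir_deriv A (U, c) p)"
proof -
  have "linear (frechet_derivative (f \<circ> inv_into U c) (at (c p)))" if "smooth_near A p f" for f
    using smooth_near_differentiable[OF assms that] linear_frechet_derivative by blast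
  then show ?thesis
    by (intro linearI) (auto simp: fun_eq_iff dir_deriv_def linear_add linear_scale)
qed

lemma subspace_tangent_space:
  assumes "smooth_manifold A"
  shows "subspace (tangent_space A p)"
proof -
  have "p \<in> (\<Union>(U, c)\<in>A. U)"
    using smooth_manifold.charts_cover[OF assms] by simp
  then obtain U c where "(U, c) \<in> A" "p \<in> U"
    by auto
  then show ?thesis
    using linear_subspace_image[OF linear_dir_deriv[OF assms] subspace_UNIV]
    by (simp add: tangent_space_eq_range[OF assms])
qed

lemma torsion_pairing:
  fixes T :: "'v::real_vector set" and G :: "'v \<Rightarrow> 'v \<Rightarrow> real" and \<phi> :: "'v \<Rightarrow> 'v"
    and \<xi> :: "nat \<Rightarrow> 'v" and \<eta> :: "nat \<Rightarrow> 'v \<Rightarrow> real"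
  assumes sub: "subspace T"
    and G_lin: "\<And>a b u v w. u \<in> T \<Longrightarrow> v \<in> T \<Longrightarrow> w \<in> T \<Longrightarrow>
      G (a *\<^sub>R u + b *\<^sub>R v) w = a * G u w + b * G v w"
    and G_sym: "\<And>u v. u \<in> T \<Longrightarrow> v \<in> T \<Longrightarrow> G u v = G v u"
    and phi: "\<And>u. u \<in> T \<Longrightarrow> \<phi> u \<in> T"
    and xi: "\<And>i. i \<in> {1..s} \<Longrightarrow> \<xi> i \<in> T \<and> \<phi> (\<xi> i) = 0"
    and eta_xi: "\<And>i j. i \<in> {1..s} \<Longrightarrow> j \<in> {1..s} \<Longrightarrow> \<eta> i (\<xi> j) = (if i = j then 1 else 0)"
    and eta_phi: "\<And>i u. i \<in> {1..s} \<Longrightarrow> u \<in> T \<Longrightarrow> \<eta> i (\<phi> u) = 0"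
    and phi_phi: "\<And>u. u \<in> T \<Longrightarrow> \<phi> (\<phi> u) = - u + (\<Sum>i = 1..s. \<eta> i u *\<^sub>R \<xi> i)"
    and G_phi: "\<And>u v. u \<in> T \<Longrightarrow> v \<in> T \<Longrightarrow>
      G (\<phi> u) (\<phi> v) = G u v - (\<Sum>i = 1..s. \<eta> i u * \<eta> i v)"
    and x: "x \<in> T" and y: "y \<in> T" and z: "z \<in> T"
  shows "G (2 *\<^sub>R (\<Sum>i = 1..s. G x (\<phi> y) *\<^sub>R \<xi> i - \<eta> i x *\<^sub>R \<phi> y + \<eta> i y *\<^sub>R \<phi> x)) z =
    (\<Sum>i = 1..s. \<eta> i x * (2 * G y (\<phi> z)) + \<eta> i y * (2 * G z (\<phi> x)) + \<eta> i z * (2 * G x (\<phi> y)))"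
proof -
  have G_add: "G (u + v) w = G u w + G v w" if "u \<in> T" "v \<in> T" "w \<in> T" for u v w
    using G_lin[of u v w 1 1] that by simp
  have G_scale: "G (a *\<^sub>R u) w = a * G u w" if "u \<in> T" "w \<in> T" for a u w
    using G_lin[of u u w a 0] that by simp
  have G_neg: "G (- u) w = - G u w" if "u \<in> T" "w \<in> T" for u w
    using G_scale[of u w "-1"] that by simp
  have G_diff: "G (u - v) w = G u w - G v w" if "u \<in> T" "v \<in> T" "w \<in> T" for u v w
    using G_lin[of u v w 1 "-1"] that by simp
  have G_sum: "G (\<Sum>i\<in>I. u i) w = (\<Sum>i\<in>I. G (u i) w)"
    if "finite I" "\<And>i. i \<in> I \<Longrightarrow> u i \<in> T" "w \<in> T" for I :: "nat set" and u w
    using that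
  proof (induction I)
    case empty
    then show ?case
      using G_scale[of w w 0] by simp
  next
    case (insert i I)
    then show ?case
      by (simp add: G_add subspace_sum[OF sub])
  qed
  have xi_eta: "G (\<xi> i) u = \<eta> i u" if u: "u \<in> T" and i: "i \<in> {1..s}" for u i
  proof -
    have "G (\<phi> (\<xi> i)) (\<phi> u) = 0"
      using G_scale[of "\<phi> u" "\<phi> u" 0] phi u xi[OF i] by simp
    then have "G (\<xi> i) u = (\<Sum>k = 1..s. \<eta> k (\<xi> i) * \<eta> k u)"
      using G_phi[of "\<xi> i" u] xi[OF i] u by simp
    also have "\<dots> = (\<Sum>k = 1..s. if k = i then \<eta> k u else 0)"
      using i by (intro sum.cong) (auto simp: eta_xi)
    finally show ?thesis
      using i by simp
  qed
  have skew: "G (\<phi> u) v = - G u (\<phi> v)" if u: "u \<in> T" and v: "v \<in> T" for u v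
  proof -
    let ?w = "\<Sum>i = 1..s. \<eta> i v *\<^sub>R \<xi> i"
    have mem: "\<eta> i v *\<^sub>R \<xi> i \<in> T" if "i \<in> {1..s}" for i
      using that xi sub by (simp add: subspace_scale)
    have w: "?w \<in> T"
      using mem by (intro subspace_sum sub)
    have "G ?w (\<phi> u) = (\<Sum>i = 1..s. G (\<eta> i v *\<^sub>R \<xi> i) (\<phi> u))"
      using mem phi[OF u] by (intro G_sum) auto
    also have "\<dots> = 0"
      using xi phi[OF u] u by (intro sum.neutral) (auto simp: G_scale xi_eta eta_phi)
    finally have 0: "G ?w (\<phi> u) = 0" .
    have "G u (\<phi> v) = G (\<phi> u) (\<phi> (\<phi> v))"
      using G_phi[OF u phi[OF v]] v by (simp add: eta_phi)
    also have "\<dots> = G (- v + ?w) (\<phi> u)"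
      using G_sym[OF phi[OF u] phi[OF phi[OF v]]] phi_phi[OF v] by simp
    also have "\<dots> = - G v (\<phi> u)"
      using G_add[OF subspace_neg[OF sub v] w phi[OF u]] G_neg[OF v phi[OF u]] 0 by simp
    finally show ?thesis
      using G_sym[OF phi[OF u] v] by simp
  qed
  let ?S = "\<lambda>i. G x (\<phi> y) *\<^sub>R \<xi> i - \<eta> i x *\<^sub>R \<phi> y + \<eta> i y *\<^sub>R \<phi> x"
  have S: "?S i \<in> T" if "i \<in> {1..s}" for i
    using that x y xi phi by (intro subspace_add subspace_diff subspace_scale sub) auto
  have GS: "G (?S i) z = G x (\<phi> y) * \<eta> i z + \<eta> i x * G y (\<phi> z) + \<eta> i y * G z (\<phi> x)"
    if i: "i \<in> {1..s}" for i
    using x y z xi[OF i] phi sub i skew[OF y z] G_sym[OF phi[OF x] z]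
    by (simp add: G_add G_diff G_scale xi_eta subspace_scale subspace_diff)
  have "G (2 *\<^sub>R (\<Sum>i = 1..s. ?S i)) z = 2 * G (\<Sum>i = 1..s. ?S i) z"
    using S z by (intro G_scale subspace_sum sub)
  also have "G (\<Sum>i = 1..s. ?S i) z = (\<Sum>i = 1..s. G (?S i) z)"
    using S z by (intro G_sum) auto
  also have "2 * (\<Sum>i = 1..s. G (?S i) z) = (\<Sum>i = 1..s. \<eta> i x * (2 * G y (\<phi> z)) + \<eta> i y * (2 * G z (\<phi> x))
      + \<eta> i z * (2 * G x (\<phi> y)))"
    unfolding sum_distrib_left by (intro sum.cong refl) (simp only: GS, simp add: algebra_simps)
  finally show ?thesis .
qed

lemma (in S_manifold) characteristic_torsion_eq_wedge:
  assumes "open U" "p \<in> U"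
    and "X \<in> vector_fields A U" "Y \<in> vector_fields A U" "Z \<in> vector_fields A U"
  shows "g p (characteristic_torsion s \<phi> \<xi> \<eta> g p (X p) (Y p)) (Z p) =
    (\<Sum>i = 1..s. \<eta> i p (X p) * exterior_deriv A (\<eta> i) Y Z p
       + \<eta> i p (Y p) * exterior_deriv A (\<eta> i) Z X p + \<eta> i p (Z p) * exterior_deriv A (\<eta> i) X Y p)"
proof -
  have "g p (characteristic_torsion s \<phi> \<xi> \<eta> g p (X p) (Y p)) (Z p) =
    (\<Sum>i = 1..s. \<eta> i p (X p) * (2 * g p (Y p) (\<phi> p (Z p)))
       + \<eta> i p (Y p) * (2 * g p (Z p) (\<phi> p (X p))) + \<eta> i p (Z p) * (2 * g p (X p) (\<phi> p (Y p))))"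
    unfolding characteristic_torsion_def fundamental_form_def
  proof (rule torsion_pairing[where T = "tangent_space A p" and G = "g p" and \<phi> = "\<phi> p"
        and \<xi> = "\<lambda>i. \<xi> i p" and \<eta> = "\<lambda>i. \<eta> i p"])
    show "subspace (tangent_space A p)"
      by (rule subspace_tangent_space) (rule smooth_manifold_axioms)
    show "\<xi> i p \<in> tangent_space A p \<and> \<phi> p (\<xi> i p) = 0" if "i \<in> {1..s}" for i
    proof -
      have "\<xi> i p \<in> span ((\<lambda>i. \<xi> i p) ` {1..s})"
        using that by (intro span_base) simp
      then show ?thesis
        unfolding phi_kernel[symmetric] by simp
    qed
  qed (use metric phi_endomorphism eta_xi eta_phi phi_phi metric_phi assms in
      \<open>simp_all only: riemannian_metric_def tangent_endomorphism_def vector_fields_def mem_Collect_eq\<close>)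
  also have "\<dots> = (\<Sum>i = 1..s. \<eta> i p (X p) * exterior_deriv A (\<eta> i) Y Z p
       + \<eta> i p (Y p) * exterior_deriv A (\<eta> i) Z X p + \<eta> i p (Z p) * exterior_deriv A (\<eta> i) X Y p)"
    using assms by (intro sum.cong refl) (simp add: fundamental_form_eq[unfolded fundamental_form_def])
  finally show ?thesis .
qed

end

theory Submission
  imports Defs
begin

text \<open>
  Put \<open>F(X, Y) = g(X, \<phi>Y)\<close>. Normality and \<open>dF = 0\<close> make every \<open>\<xi>\<^sub>i\<close> a Killing field, whence
  \<open>\<nabla>\<^sup>g\<^sub>X \<xi>\<^sub>i = - \<phi>X\<close> and \<open>\<nabla>\<xi>\<^sub>i = 0\<close>. The torsion of \<open>\<nabla>\<close> drops out of both \<open>dF = 0\<close> and the normality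
  condition, so \<open>\<nabla>\<phi>\<close> satisfies the algebraic identities of Kaehler geometry, which force \<open>\<nabla>\<phi> = 0\<close>.
  Hence \<open>\<nabla>T = 0\<close>, and comparing curvatures gives
  \<open>Ric\<^sup>\<nabla>(X, Y) = Ric\<^sup>g(X, Y) - 1/4 \<Sum>\<^sub>a g(T(X, e\<^sub>a), T(Y, e\<^sub>a))\<close>, where the sum is \<open>8s g(X, Y)\<close> for
  horizontal \<open>X\<close>. The vertical part vanishes because \<open>\<nabla>\<close> is metric with \<open>\<nabla>\<xi>\<^sub>i = 0\<close> and \<open>Ric\<^sup>\<nabla>\<close> is
  symmetric. Brackets of smooth fields are smooth fields because \<open>[X, Y] = \<nabla>\<^sup>g\<^sub>X Y - \<nabla>\<^sup>g\<^sub>Y X\<close>.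
\<close>

section \<open>Functions of class $C^k$\<close>

text \<open>The value of \<open>ricci\<close> is a \<open>THE\<close> over all local frames and all
  extensions of a vector. It means something only once a frame exists near every point and the trace
  is known not to depend on the frame, the extension or the open set. The Riemannian part serves
  this purpose; a frame over a fixed open set supplies both the extensions and the pointwise
  dependence of tensors on their arguments. The Reeb fields enter the torsion only through their sum
  \<open>xb\<close>: half of \<open>T\<close> is
  \<open>F(X, Y) xb - g(xb, X) \<phi>Y + g(xb, Y) \<phi>X\<close>. The calculation is therefore that
  of a single Reeb field, except that \<open>g(xb, xb) = s\<close>. In the trace of the squared half
  torsion this \<open>s\<close> occurs twice, once from the \<open>xb\<close> component and once
  from the \<open>\<phi>X\<close> component; this is the constant \<open>2s\<close>.\<close>

lemma frechet_derivativeI: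
  assumes "(f has_derivative f') (at x)"
  shows "frechet_derivative f (at x) = f'"
  using frechet_derivative_at[OF assms] by simp

lemma differentiable_transform_open:
  assumes "f differentiable (at x)" "open S" "x \<in> S" "\<And>y. y \<in> S \<Longrightarrow> f y = h y"
  shows "h differentiable (at x)"
  using assms has_derivative_transform_within_open unfolding differentiable_def by blast

lemma Ck_on_cong_imp:
  assumes "open S" "\<And>x. x \<in> S \<Longrightarrow> f x = h x" "Ck_on k S f"
  shows "Ck_on k S h"
  using assms(2,3)
proof (induction k arbitrary: f h)
  case 0
  then show ?case
    using continuous_on_cong[of S S f h] by simp
next
  case (Suc k)
  have "frechet_derivative f (at x) = frechet_derivative h (at x)" if "x \<in> S" for x
    using frechet_derivative_transform_within_open[of f x S h] assms(1) Suc.prems that by simp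
  then have "Ck_on k S (\<lambda>x. frechet_derivative h (at x) v)" for v
    using Suc.IH[of "\<lambda>x. frechet_derivative f (at x) v" "\<lambda>x. frechet_derivative h (at x) v"]
      Suc.prems by simp
  moreover have "h differentiable (at x)" if "x \<in> S" for x
    using differentiable_transform_open[OF _ assms(1) that] Suc.prems that by auto
  ultimately show ?case
    by simp
qed

lemma Ck_on_cong:
  assumes "open S" "\<And>x. x \<in> S \<Longrightarrow> f x = h x"
  shows "Ck_on k S f \<longleftrightarrow> Ck_on k S h"
  using Ck_on_cong_imp[OF assms(1), of f h k] Ck_on_cong_imp[OF assms(1), of h f k] assms(2)
  by auto

lemma Ck_on_subset:
  assumes "Ck_on k S f" "T \<subseteq> S"
  shows "Ck_on k T f"
  using assms(1)
proof (induction k arbitrary: f)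
  case 0
  then show ?case
    using assms(2) continuous_on_subset by auto
qed (use assms(2) in auto)

lemma Ck_on_Suc_imp:
  assumes "Ck_on (Suc k) S f"
  shows "Ck_on k S f"
  using assms
proof (induction k arbitrary: f)
  case 0
  then show ?case
    by (auto intro!: continuous_at_imp_continuous_on differentiable_imp_continuous_within)
qed simp

lemma Ck_on_const: "Ck_on k S (\<lambda>x. c)"
proof (induction k arbitrary: c)
  case (Suc k)
  then show ?case by simp
qed simp

text \<open>\<open>Ck_on\<close> refers to the selected \<open>frechet_derivative\<close>.
  Derivatives are unique, so on an open set any explicit formula \<open>f'\<close> may take its
  place in the recursion.\<close>

lemma Ck_on_SucI:
  assumes "open S" "\<And>x. x \<in> S \<Longrightarrow> (f has_derivative f' x) (at x)"
    and "\<And>v. Ck_on k S (\<lambda>x. f' x v)"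
  shows "Ck_on (Suc k) S f"
proof -
  have "Ck_on k S (\<lambda>x. frechet_derivative f (at x) v)" for v
    using Ck_on_cong_imp[OF assms(1) _ assms(3)[of v]] frechet_derivativeI[OF assms(2)] by simp
  then show ?thesis
    using assms(2) by (auto simp: differentiable_def)
qed

lemma Ck_on_SucD:
  assumes "Ck_on (Suc k) S f" "x \<in> S"
  shows "(f has_derivative frechet_derivative f (at x)) (at x)"
  using assms by (simp add: frechet_derivative_works)

lemma Ck_on_add:
  assumes "open S" "Ck_on k S f" "Ck_on k S h"
  shows "Ck_on k S (\<lambda>x. f x + h x)"
  using assms(2,3)
proof (induction k arbitrary: f h)
  case 0
  then show ?case by (simp add: continuous_on_add)
next
  case (Suc k)
  have "Ck_on k S (\<lambda>x. frechet_derivative f (at x) v + frechet_derivative h (at x) v)" for v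
    using Suc by simp
  with has_derivative_add[OF Ck_on_SucD[OF Suc.prems(1)] Ck_on_SucD[OF Suc.prems(2)]] show ?case
    by (rule Ck_on_SucI[OF assms(1)])
qed

lemma Ck_on_bounded_linear:
  assumes "open S" "bounded_linear L" "Ck_on k S f"
  shows "Ck_on k S (\<lambda>x. L (f x))"
  using assms(3)
proof (induction k arbitrary: f)
  case 0
  then show ?case
    by (simp add: bounded_linear.continuous_on[OF assms(2)])
next
  case (Suc k)
  show ?case
    using Suc.prems
    by (intro Ck_on_SucI[OF assms(1), where f' = "\<lambda>x v. L (frechet_derivative f (at x) v)"]
        bounded_linear.has_derivative[OF assms(2)] Ck_on_SucD[of k S] Suc.IH) auto
qed

lemma Ck_on_mult:
  fixes f h :: "'e::euclidean_space \<Rightarrow> real"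
  assumes "open S" "Ck_on k S f" "Ck_on k S h"
  shows "Ck_on k S (\<lambda>x. f x * h x)"
  using assms(2,3)
proof (induction k arbitrary: f h)
  case 0
  then show ?case by (simp add: continuous_on_mult)
next
  case (Suc k)
  have "Ck_on k S (\<lambda>x. f x * frechet_derivative h (at x) v + frechet_derivative f (at x) v * h
      x)" for v
    using Suc.prems Ck_on_Suc_imp[OF Suc.prems(1)] Ck_on_Suc_imp[OF Suc.prems(2)]
    by (intro Ck_on_add[OF assms(1)] Suc.IH) auto
  with has_derivative_mult[OF Ck_on_SucD[OF Suc.prems(1)] Ck_on_SucD[OF Suc.prems(2)]] show ?case
    by (rule Ck_on_SucI[OF assms(1)])
qed

lemma Ck_on_sum:
  assumes "open S" "\<And>i. i \<in> I \<Longrightarrow> Ck_on k S (f i)"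
  shows "Ck_on k S (\<lambda>x. \<Sum>i\<in>I. f i x)"
  using assms(2)
  by (induction I rule: infinite_finite_induct) (auto simp: Ck_on_const Ck_on_add[OF assms(1)])

text \<open>The chain rule gives \<open>Df(h x)(Dh x v)\<close>, where the inner direction varies
  with \<open>x\<close>. Expanding that direction in \<open>Basis\<close> leaves products of real
  functions in which \<open>Df\<close> has a fixed direction \<open>b\<close>, and the induction
  hypothesis, general in \<open>f\<close>, applies to these.\<close>

lemma Ck_on_compose:
  fixes f :: "'e::euclidean_space \<Rightarrow> real" and h :: "'d::euclidean_space \<Rightarrow> 'e"
  assumes "open S" "h ` S \<subseteq> T" "Ck_on k T f" "Ck_on k S h"
  shows "Ck_on k S (\<lambda>x. f (h x))"
  using assms(3,4)
proof (induction k arbitrary: f)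
  case 0
  then show ?case
    using continuous_on_compose2[of T f S h] assms(2) by simp
next
  case (Suc k)
  have fT: "(f has_derivative frechet_derivative f (at (h x))) (at (h x))" if "x \<in> S" for x
    using Suc.prems(1) assms(2) that by (intro Ck_on_SucD[of k T]) auto
  let ?D = "\<lambda>x v. \<Sum>b\<in>Basis. (frechet_derivative h (at x) v \<bullet> b) * frechet_derivative f (at (h x)) b"
  have "((\<lambda>x. f (h x)) has_derivative ?D x) (at x)" if x: "x \<in> S" for x
  proof -
    have "((\<lambda>x. f (h x)) has_derivative
        (\<lambda>v. frechet_derivative f (at (h x)) (frechet_derivative h (at x) v))) (at x)"
      using has_derivative_compose[OF Ck_on_SucD[OF Suc.prems(2) x] fT[OF x]] .
    moreover have "frechet_derivative f (at (h x)) w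
        = (\<Sum>b\<in>Basis. (w \<bullet> b) * frechet_derivative f (at (h x)) b)" for w
    proof -
      interpret linear "frechet_derivative f (at (h x))"
        using fT[OF x] by (rule has_derivative_linear)
      have "frechet_derivative f (at (h x)) w
          = frechet_derivative f (at (h x)) (\<Sum>b\<in>Basis. (w \<bullet> b) *\<^sub>R b)"
        by (simp add: euclidean_representation)
      then show ?thesis
        by (simp add: sum scale)
    qed
    ultimately show ?thesis
      by (rule has_derivative_eq_rhs[OF _ ext])
  qed
  moreover have "Ck_on k S (\<lambda>x. ?D x v)" for v
  proof (intro Ck_on_sum[OF assms(1)] Ck_on_mult[OF assms(1)])
    fix b :: 'e
    show "Ck_on k S (\<lambda>x. frechet_derivative h (at x) v \<bullet> b)"
      using Suc.prems(2) by (intro Ck_on_bounded_linear[OF assms(1) bounded_linear_inner_left]) simp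
    show "Ck_on k S (\<lambda>x. frechet_derivative f (at (h x)) b)"
      using Suc.prems(1) Ck_on_Suc_imp[OF Suc.prems(2)]
      by (intro Suc.IH[of "\<lambda>y. frechet_derivative f (at y) b"]) auto
  qed
  ultimately show ?case
    by (rule Ck_on_SucI[OF assms(1)])
qed

text \<open>Differentiation stays within multiples of real powers, so the induction keeps the
  exponent free. The exponent \<open>-1/2\<close> will normalise vectors in
  \<open>gram_schmidt\<close>.\<close>

lemma Ck_on_powr: "Ck_on k {0<..} (\<lambda>x::real. x powr a)"
proof (induction k arbitrary: a)
  case 0
  then show ?case
    by (auto intro!: continuous_intros)
next
  case (Suc k)
  have "((\<lambda>x. x powr a) has_derivative (\<lambda>v. (a * v) * x powr (a - 1))) (at x)" if "x > 0" for x
    using has_real_derivative_powr[OF that, of a]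
    by (auto simp: has_field_derivative_def mult_ac elim!: has_derivative_eq_rhs)
  then show ?case
    using Suc.IH by (intro Ck_on_SucI[where f' = "\<lambda>x v. (a * v) * x powr (a - 1)"] Ck_on_mult
        Ck_on_const) auto
qed

lemma smooth_on_cong:
  assumes "open S" "\<And>x. x \<in> S \<Longrightarrow> f x = h x"
  shows "smooth_on S f \<longleftrightarrow> smooth_on S h"
  using Ck_on_cong[OF assms] by (auto simp: smooth_on_def)

lemma smooth_on_subset: "smooth_on S f \<Longrightarrow> T \<subseteq> S \<Longrightarrow> smooth_on T f"
  using Ck_on_subset unfolding smooth_on_def by blast

lemma smooth_on_compose:
  fixes f :: "'e::euclidean_space \<Rightarrow> real" and h :: "'d::euclidean_space \<Rightarrow> 'e"
  assumes "open S" "h ` S \<subseteq> T" "smooth_on T f" "smooth_on S h"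
  shows "smooth_on S (\<lambda>x. f (h x))"
  using assms Ck_on_compose unfolding smooth_on_def by blast

lemma smooth_on_directional_derivative:
  "smooth_on S f \<Longrightarrow> smooth_on S (\<lambda>x. frechet_derivative f (at x) v)"
  unfolding smooth_on_def using Ck_on.simps(2) by blast

section \<open>Smooth functions, tangent vectors and vector fields\<close>

context smooth_manifold
begin

lemma chart_open: "(U, c) \<in> A \<Longrightarrow> open U"
  using chart_homeomorphism by blast

lemma inv_into_chart [simp]: "(U, c) \<in> A \<Longrightarrow> q \<in> U \<Longrightarrow> inv_into U c (c q) = q"
  using chart_homeomorphism[of U c] by (auto simp: homeomorphism_def)

lemma chart_image_open:
  assumes "(U, c) \<in> A" "open W"
  shows "open (c ` (U \<inter> W))"
proof -
  have h: "open (c ` U)" "homeomorphism U (c ` U) c (inv_into U c)"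
    using chart_homeomorphism[OF assms(1)] by auto
  have "c ` (U \<inter> W) = c ` U \<inter> inv_into U c -` W"
    using assms(1) by auto
  moreover have "open \<dots>"
    using h assms(2) continuous_openin_preimage_gen[of "c ` U" "inv_into U c" W] openin_open_eq
    by (auto simp: homeomorphism_def)
  ultimately show ?thesis
    by simp
qed

lemma chart_around:
  obtains U c where "(U, c) \<in> A" "p \<in> U"
proof -
  have "p \<in> (\<Union>(U, c)\<in>A. U)"
    using charts_cover by simp
  then show ?thesis
    using that by auto
qed

lemma smooth_funI:
  assumes "\<And>U c. (U, c) \<in> A \<Longrightarrow> smooth_on (c ` (U \<inter> W)) (\<lambda>x. f (inv_into U c x))"
  shows "smooth_fun A W f"
  using assms unfolding smooth_fun_def comp_def by auto

lemma smooth_funD: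
  assumes "smooth_fun A W f" "(U, c) \<in> A"
  shows "smooth_on (c ` (U \<inter> W)) (\<lambda>x. f (inv_into U c x))"
  using assms unfolding smooth_fun_def comp_def by auto

lemma smooth_fun_subset:
  assumes "smooth_fun A W f" "W' \<subseteq> W"
  shows "smooth_fun A W' f"
proof (rule smooth_funI)
  fix U c
  assume "(U, c) \<in> A"
  then show "smooth_on (c ` (U \<inter> W')) (\<lambda>x. f (inv_into U c x))"
    using assms(2) by (intro smooth_on_subset[OF smooth_funD[OF assms(1)]]) auto
qed

lemma smooth_fun_cong:
  assumes "open W" "\<And>q. q \<in> W \<Longrightarrow> f q = h q"
  shows "smooth_fun A W f \<longleftrightarrow> smooth_fun A W h"
proof -
  have "smooth_on (c ` (U \<inter> W)) (f \<circ> inv_into U c) \<longleftrightarrow> smooth_on (c ` (U \<inter> W)) (h \<circ> inv_into U c)"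
    if "(U, c) \<in> A" for U c
    using assms that by (intro smooth_on_cong chart_image_open) auto
  then show ?thesis
    unfolding smooth_fun_def by blast
qed

lemma smooth_fun_const: "smooth_fun A W (\<lambda>q. r)"
  by (rule smooth_funI) (simp add: smooth_on_def Ck_on_const)

lemma smooth_fun_add:
  assumes "open W" "smooth_fun A W f" "smooth_fun A W h"
  shows "smooth_fun A W (\<lambda>q. f q + h q)"
  using assms smooth_funD[OF assms(2)] smooth_funD[OF assms(3)]
  by (intro smooth_funI) (simp add: smooth_on_def chart_image_open Ck_on_add)

lemma smooth_fun_mult:
  assumes "open W" "smooth_fun A W f" "smooth_fun A W h"
  shows "smooth_fun A W (\<lambda>q. f q * h q)"
  using assms smooth_funD[OF assms(2)] smooth_funD[OF assms(3)]
  by (intro smooth_funI) (simp add: smooth_on_def chart_image_open Ck_on_mult)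

lemma smooth_fun_sum:
  assumes "open W" "\<And>i. i \<in> I \<Longrightarrow> smooth_fun A W (f i)"
  shows "smooth_fun A W (\<lambda>q. \<Sum>i\<in>I. f i q)"
  using assms(2)
  by (induction I rule: infinite_finite_induct)
    (auto simp: smooth_fun_const smooth_fun_add[OF assms(1)])

lemma smooth_fun_powr:
  assumes "open W" "smooth_fun A W f" "\<And>q. q \<in> W \<Longrightarrow> 0 < f q"
  shows "smooth_fun A W (\<lambda>q. f q powr a)"
proof (rule smooth_funI)
  fix U c
  assume c: "(U, c) \<in> A"
  have "smooth_on {0<..} (\<lambda>x::real. x powr a)"
    by (simp add: smooth_on_def Ck_on_powr)
  then show "smooth_on (c ` (U \<inter> W)) (\<lambda>x. f (inv_into U c x) powr a)"
    using c assms(3) smooth_funD[OF assms(2) c] chart_image_open[OF c assms(1)]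
    by (intro smooth_on_compose[of _ "\<lambda>x. f (inv_into U c x)" "{0<..}" "\<lambda>x. x powr a"]) auto
qed

lemma smooth_fun_chart:
  assumes "(U, c) \<in> A" "smooth_on (c ` U) h" "W \<subseteq> U" "open W"
  shows "smooth_fun A W (\<lambda>q. h (c q))"
proof (rule smooth_funI)
  fix V d
  assume d: "(V, d) \<in> A"
  have "smooth_on (d ` (V \<inter> W)) (\<lambda>x. c (inv_into V d x))"
    using assms(3) by (intro smooth_on_subset[OF charts_compatible[OF d assms(1), unfolded
        comp_def]]) auto
  then show "smooth_on (d ` (V \<inter> W)) (\<lambda>x. h (c (inv_into V d x)))"
    using d assms
    by (intro smooth_on_compose[of _ "\<lambda>x. c (inv_into V d x)" "c ` U" h] chart_image_open) auto
qed

lemma smooth_nearI: "open W \<Longrightarrow> p \<in> W \<Longrightarrow> smooth_fun A W f \<Longrightarrow> smooth_near A p f"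
  unfolding smooth_near_def by blast

lemma smooth_near_cong_imp:
  assumes "open W" "p \<in> W" "\<And>q. q \<in> W \<Longrightarrow> f q = h q" "smooth_near A p f"
  shows "smooth_near A p h"
proof -
  obtain V where V: "open V" "p \<in> V" "smooth_fun A V f"
    using assms(4) unfolding smooth_near_def by blast
  have "smooth_fun A (V \<inter> W) f"
    using V(3) by (rule smooth_fun_subset) auto
  then have "smooth_fun A (V \<inter> W) h"
    using assms V(1) smooth_fun_cong[of "V \<inter> W" f h] by auto
  then show ?thesis
    using assms V by (intro smooth_nearI[of "V \<inter> W"]) auto
qed

lemma smooth_near_cong:
  assumes "open W" "p \<in> W" "\<And>q. q \<in> W \<Longrightarrow> f q = h q"
  shows "smooth_near A p f \<longleftrightarrow> smooth_near A p h"
  using smooth_near_cong_imp[OF assms(1,2), of f h] smooth_near_cong_imp[OF assms(1,2), of h f]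
    assms(3) by auto

lemma smooth_near_binary:
  assumes "smooth_near A p f" "smooth_near A p h"
  obtains W where "open W" "p \<in> W" "smooth_fun A W f" "smooth_fun A W h"
proof -
  obtain V W where "open V" "p \<in> V" "smooth_fun A V f" "open W" "p \<in> W" "smooth_fun A W h"
    using assms unfolding smooth_near_def by blast
  then show ?thesis
    using smooth_fun_subset[of V f "V \<inter> W"] smooth_fun_subset[of W h "V \<inter> W"]
    by (intro that[of "V \<inter> W"]) auto
qed

lemma smooth_near_add:
  assumes "smooth_near A p f" "smooth_near A p h"
  shows "smooth_near A p (\<lambda>q. f q + h q)"
proof -
  obtain W where "open W" "p \<in> W" "smooth_fun A W f" "smooth_fun A W h"
    using smooth_near_binary[OF assms] .
  then show ?thesis
    by (intro smooth_nearI[of W] smooth_fun_add)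
qed

lemma smooth_near_mult:
  assumes "smooth_near A p f" "smooth_near A p h"
  shows "smooth_near A p (\<lambda>q. f q * h q)"
proof -
  obtain W where "open W" "p \<in> W" "smooth_fun A W f" "smooth_fun A W h"
    using smooth_near_binary[OF assms] .
  then show ?thesis
    by (intro smooth_nearI[of W] smooth_fun_mult)
qed

lemma smooth_near_const: "smooth_near A p (\<lambda>q. r)"
  using smooth_nearI[OF open_UNIV UNIV_I smooth_fun_const] .

section \<open>Tangent vectors as derivations on germs\<close>

lemma tangent_vector_cases:
  assumes "u \<in> tangent_space A p"
  obtains U c w where "(U, c) \<in> A" "p \<in> U" "u = dir_deriv A (U, c) p w"
  using assms unfolding tangent_space_def by blast

lemma smooth_near_has_derivative:
  assumes "(U, c) \<in> A" "p \<in> U" "smooth_near A p f"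
  shows "((\<lambda>x. f (inv_into U c x)) has_derivative
    frechet_derivative (\<lambda>x. f (inv_into U c x)) (at (c p))) (at (c p))"
  using smooth_near_differentiable[OF smooth_manifold_axioms assms]
  by (simp add: frechet_derivative_works comp_def)

lemma dir_deriv_smooth:
  "smooth_near A p f \<Longrightarrow>
    dir_deriv A (U, c) p w f = frechet_derivative (\<lambda>x. f (inv_into U c x)) (at (c p)) w"
  by (simp add: dir_deriv_def comp_def)

lemma tangent_vector_not_smooth:
  assumes "u \<in> tangent_space A p" "\<not> smooth_near A p f"
  shows "u f = 0"
  using assms by (auto simp: tangent_space_def dir_deriv_def)

text \<open>Derivatives depend on the germ alone. So does smoothness near \<open>p\<close>, and if
  it fails both values are the default 0.\<close>

lemma tangent_vector_cong:
  assumes u: "u \<in> tangent_space A p" and W: "open W" "p \<in> W" "\<And>q. q \<in> W \<Longrightarrow> f q = h q"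
  shows "u f = u h"
proof (cases "smooth_near A p f")
  case True
  then have h: "smooth_near A p h"
    using smooth_near_cong[OF W] by simp
  obtain U c w where c: "(U, c) \<in> A" "p \<in> U" and uw: "u = dir_deriv A (U, c) p w"
    using u by (rule tangent_vector_cases)
  have "frechet_derivative (f \<circ> inv_into U c) (at (c p)) = frechet_derivative (h \<circ> inv_into U c)
      (at (c p))"
    using c W True
    by (intro frechet_derivative_transform_within_open[of _ _ "c ` (U \<inter> W)"] chart_image_open
        smooth_near_differentiable[OF smooth_manifold_axioms]) auto
  then show ?thesis
    using True h by (simp add: uw dir_deriv_def)
next
  case False
  then show ?thesis
    using smooth_near_cong[OF W] tangent_vector_not_smooth[OF u] by simp
qed

lemma tangent_vector_const:
  assumes "u \<in> tangent_space A p"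
  shows "u (\<lambda>q. r) = 0"
  using assms
proof (rule tangent_vector_cases)
  fix U c w
  assume "u = dir_deriv A (U, c) p w"
  then show ?thesis
    using smooth_near_const by (simp add: dir_deriv_smooth)
qed

lemma tangent_vector_add:
  assumes "u \<in> tangent_space A p" "smooth_near A p f" "smooth_near A p h"
  shows "u (\<lambda>q. f q + h q) = u f + u h"
  using assms(1)
proof (rule tangent_vector_cases)
  fix U c w
  assume c: "(U, c) \<in> A" "p \<in> U" and u: "u = dir_deriv A (U, c) p w"
  note has_derivative_add[OF smooth_near_has_derivative[OF c assms(2)]
      smooth_near_has_derivative[OF c assms(3)]]
  from frechet_derivativeI[OF this] show ?thesis
    using assms by (simp add: u dir_deriv_smooth smooth_near_add)
qed

lemma tangent_vector_mult:
  assumes "u \<in> tangent_space A p" "smooth_near A p f" "smooth_near A p h"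
  shows "u (\<lambda>q. f q * h q) = f p * u h + u f * h p"
  using assms(1)
proof (rule tangent_vector_cases)
  fix U c w
  assume c: "(U, c) \<in> A" "p \<in> U" and u: "u = dir_deriv A (U, c) p w"
  note has_derivative_mult[OF smooth_near_has_derivative[OF c assms(2)]
      smooth_near_has_derivative[OF c assms(3)]]
  from frechet_derivativeI[OF this] show ?thesis
    using assms c by (simp add: u dir_deriv_smooth smooth_near_mult)
qed

lemma zero_in_tangent_space: "0 \<in> tangent_space A p"
  using subspace_0[OF subspace_tangent_space[OF smooth_manifold_axioms]] .

lemma tangent_space_add: "u \<in> tangent_space A p \<Longrightarrow> v \<in> tangent_space A p \<Longrightarrow> u + v \<in> tangent_space A p"
  using subspace_add[OF subspace_tangent_space[OF smooth_manifold_axioms]] .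

lemma tangent_space_scale: "u \<in> tangent_space A p \<Longrightarrow> r *\<^sub>R u \<in> tangent_space A p"
  using subspace_scale[OF subspace_tangent_space[OF smooth_manifold_axioms]] .

lemma tangent_space_sum:
  "(\<And>i. i \<in> I \<Longrightarrow> u i \<in> tangent_space A p) \<Longrightarrow> (\<Sum>i\<in>I. u i) \<in> tangent_space A p"
  using subspace_sum[OF subspace_tangent_space[OF smooth_manifold_axioms]] .

lemma tangent_space_span:
  assumes "(U, c) \<in> A" "p \<in> U"
  shows "tangent_space A p = span (dir_deriv A (U, c) p ` Basis)"
proof -
  have "tangent_space A p = dir_deriv A (U, c) p ` span Basis"
    by (simp add: tangent_space_eq_range[OF smooth_manifold_axioms assms])
  then show ?thesis
    using linear_span_image[OF linear_dir_deriv[OF smooth_manifold_axioms assms]] by simp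
qed

text \<open>Applied to the coordinate function \<open>q \<mapsto> c q \<bullet> b\<close>, the
  vector returns the component \<open>w \<bullet> b\<close>. This makes the coordinate fields
  independent at every point.\<close>

lemma inj_dir_deriv:
  assumes c: "(U, c) \<in> A" "p \<in> U"
  shows "inj (dir_deriv A (U, c) p)"
proof -
  have "w = 0" if w: "dir_deriv A (U, c) p w = 0" for w
  proof (rule euclidean_eqI)
    fix b :: 'e
    let ?f = "\<lambda>q. c q \<bullet> b"
    have op: "open (c ` U)"
      using chart_homeomorphism[OF c(1)] by simp
    have der: "((\<lambda>x::'e. x \<bullet> b) has_derivative (\<lambda>v. v \<bullet> b)) (at x)" for x
      by (intro derivative_intros)
    have "Ck_on k (c ` U) (\<lambda>x. x \<bullet> b)" for k
    proof (cases k)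
      case (Suc m)
      show ?thesis
        unfolding Suc by (rule Ck_on_SucI[OF op der Ck_on_const])
    qed (auto intro!: continuous_intros)
    then have "smooth_fun A U ?f"
      using smooth_fun_chart[OF c(1), of "\<lambda>x. x \<bullet> b" U] chart_open[OF c(1)]
      by (simp add: smooth_on_def)
    then have near: "smooth_near A p ?f"
      by (rule smooth_nearI[OF chart_open[OF c(1)] c(2)])
    have "((\<lambda>x. ?f (inv_into U c x)) has_derivative (\<lambda>v. v \<bullet> b)) (at (c p))"
      using c by (intro has_derivative_transform_within_open[OF der op]) auto
    then have "dir_deriv A (U, c) p w ?f = w \<bullet> b"
      using near by (simp add: dir_deriv_smooth frechet_derivativeI)
    then show "w \<bullet> b = 0 \<bullet> b"
      using w by simp
  qed
  then show ?thesis
    using linear_inj_iff_eq_0[OF linear_dir_deriv[OF smooth_manifold_axioms c]] by blast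
qed

section \<open>Algebra of smooth vector fields\<close>

lemma vector_fields_in_tangent_space: "X \<in> vector_fields A U \<Longrightarrow> p \<in> U \<Longrightarrow> X p \<in> tangent_space A p"
  unfolding vector_fields_def by blast

lemma vector_fields_smooth:
  "X \<in> vector_fields A U \<Longrightarrow> open W \<Longrightarrow> W \<subseteq> U \<Longrightarrow> smooth_fun A W f \<Longrightarrow> smooth_fun A W (\<lambda>p. X p f)"
  unfolding vector_fields_def by blast

lemma vector_fieldsI:
  assumes "\<And>p. p \<in> U \<Longrightarrow> X p \<in> tangent_space A p"
    and "\<And>W f. open W \<Longrightarrow> W \<subseteq> U \<Longrightarrow> smooth_fun A W f \<Longrightarrow> smooth_fun A W (\<lambda>p. X p f)"
  shows "X \<in> vector_fields A U"
  using assms unfolding vector_fields_def by blast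

lemma vector_fields_subset:
  assumes "X \<in> vector_fields A U" "U' \<subseteq> U"
  shows "X \<in> vector_fields A U'"
proof (rule vector_fieldsI)
  show "X p \<in> tangent_space A p" if "p \<in> U'" for p
    using assms that by (auto intro: vector_fields_in_tangent_space)
  show "smooth_fun A W (\<lambda>p. X p f)" if "open W" "W \<subseteq> U'" "smooth_fun A W f" for W f
    using vector_fields_smooth[OF assms(1) that(1) _ that(3)] that(2) assms(2) by simp
qed

lemma vector_fields_cong:
  assumes "X \<in> vector_fields A U" "\<And>p. p \<in> U \<Longrightarrow> X p = Y p"
  shows "Y \<in> vector_fields A U"
proof (rule vector_fieldsI)
  show "Y p \<in> tangent_space A p" if "p \<in> U" for p
    using that assms(2) vector_fields_in_tangent_space[OF assms(1)] by force
  show "smooth_fun A W (\<lambda>p. Y p f)" if "open W" "W \<subseteq> U" "smooth_fun A W f" for W f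
    using vector_fields_smooth[OF assms(1) that] that assms(2)
      smooth_fun_cong[of W "\<lambda>p. X p f" "\<lambda>p. Y p f"] by (metis subsetD)
qed

lemma vector_fields_zero: "(\<lambda>q. 0) \<in> vector_fields A U"
  by (auto intro!: vector_fieldsI simp: zero_in_tangent_space smooth_fun_const)

lemma vector_fields_add:
  assumes "X \<in> vector_fields A U" "Y \<in> vector_fields A U"
  shows "(\<lambda>q. X q + Y q) \<in> vector_fields A U"
  using assms
  by (intro vector_fieldsI)
    (auto simp: tangent_space_add vector_fields_in_tangent_space vector_fields_smooth
        smooth_fun_add)

lemma vector_fields_scale:
  assumes "X \<in> vector_fields A U" "smooth_fun A U f"
  shows "(\<lambda>q. f q *\<^sub>R X q) \<in> vector_fields A U"
proof (rule vector_fieldsI)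
  show "f p *\<^sub>R X p \<in> tangent_space A p" if "p \<in> U" for p
    using vector_fields_in_tangent_space[OF assms(1) that] by (rule tangent_space_scale)
  show "smooth_fun A W (\<lambda>p. (f p *\<^sub>R X p) h)" if "open W" "W \<subseteq> U" "smooth_fun A W h" for W h
    using that assms
    by (simp add: smooth_fun_mult smooth_fun_subset[of U f W] vector_fields_smooth[of X U W])
qed

lemma vector_fields_sum:
  assumes "\<And>i. i \<in> I \<Longrightarrow> X i \<in> vector_fields A U"
  shows "(\<lambda>q. \<Sum>i\<in>I. X i q) \<in> vector_fields A U"
  using assms
  by (induction I rule: infinite_finite_induct) (auto simp: vector_fields_zero vector_fields_add)

text \<open>In its own chart the field differentiates in the constant direction \<open>w\<close>.
  Smoothness of the result must be seen in every chart, hence the composition with a transition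
  map.\<close>

lemma coordinate_vector_field:
  assumes c: "(U, c) \<in> A"
  shows "(\<lambda>q. dir_deriv A (U, c) q w) \<in> vector_fields A U"
proof (rule vector_fieldsI)
  show "dir_deriv A (U, c) p w \<in> tangent_space A p" if "p \<in> U" for p
    using c that unfolding tangent_space_def by blast
  fix W f
  assume W: "open W" "W \<subseteq> U" "smooth_fun A W f"
  let ?h = "\<lambda>x. frechet_derivative (\<lambda>x. f (inv_into U c x)) (at x) w"
  have h: "smooth_on (c ` W) ?h"
    using smooth_on_directional_derivative[OF smooth_funD[OF W(3) c]] W(2)
    by (simp add: Int_absorb1)
  have "smooth_fun A W (\<lambda>q. ?h (c q))"
  proof (rule smooth_funI)
    fix V d
    assume d: "(V, d) \<in> A"
    have "smooth_on (d ` (V \<inter> W)) (\<lambda>x. c (inv_into V d x))"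
      using W(2) by (intro smooth_on_subset[OF charts_compatible[OF d c, unfolded comp_def]]) auto
    then show "smooth_on (d ` (V \<inter> W)) (\<lambda>x. ?h (c (inv_into V d x)))"
      using d W h
      by (intro smooth_on_compose[of _ "\<lambda>x. c (inv_into V d x)" "c ` W" ?h] chart_image_open) auto
  qed
  moreover have "?h (c q) = dir_deriv A (U, c) q w f" if "q \<in> W" for q
    using smooth_nearI[OF W(1) that W(3)] by (simp add: dir_deriv_smooth)
  ultimately show "smooth_fun A W (\<lambda>q. dir_deriv A (U, c) q w f)"
    using smooth_fun_cong[OF W(1), of "\<lambda>q. ?h (c q)"] by simp
qed

end

section \<open>Riemannian metrics and orthonormal frames\<close>

locale riemannian_manifold = smooth_manifold A
  for A :: "('a::{t2_space,second_countable_topology}, 'e::euclidean_space) chart set" +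
  fixes g :: "'a \<Rightarrow> 'a tvec \<Rightarrow> 'a tvec \<Rightarrow> real"
  assumes metric: "riemannian_metric A g"
begin

abbreviation T :: "'a \<Rightarrow> 'a tvec set" where "T \<equiv> tangent_space A"

lemma T_intros [simp, intro]:
  "0 \<in> T p" "u \<in> T p \<Longrightarrow> v \<in> T p \<Longrightarrow> u + v \<in> T p" "u \<in> T p \<Longrightarrow> r *\<^sub>R u \<in> T p"
  "u \<in> T p \<Longrightarrow> v \<in> T p \<Longrightarrow> u - v \<in> T p" "u \<in> T p \<Longrightarrow> - u \<in> T p"
  using subspace_tangent_space[OF smooth_manifold_axioms, of p]
  by (auto intro: subspace_add subspace_scale subspace_diff subspace_neg subspace_0)

lemma T_sum [simp, intro]: "(\<And>i. i \<in> I \<Longrightarrow> u i \<in> T p) \<Longrightarrow> (\<Sum>i\<in>I. u i) \<in> T p"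
  by (rule tangent_space_sum)

lemma g_combination:
  "u \<in> T p \<Longrightarrow> v \<in> T p \<Longrightarrow> w \<in> T p \<Longrightarrow> g p (a *\<^sub>R u + b *\<^sub>R v) w = a * g p u w + b * g p v w"
  using metric[unfolded riemannian_metric_def, THEN conjunct1] by simp

lemma g_sym: "u \<in> T p \<Longrightarrow> v \<in> T p \<Longrightarrow> g p u v = g p v u"
  using metric by (simp add: riemannian_metric_def)

lemma g_pos: "u \<in> T p \<Longrightarrow> u \<noteq> 0 \<Longrightarrow> g p u u > 0"
  using metric by (simp add: riemannian_metric_def)

lemma g_smooth: "open U \<Longrightarrow> X \<in> vector_fields A U \<Longrightarrow> Y \<in> vector_fields A U \<Longrightarrow>
    smooth_fun A U (\<lambda>p. g p (X p) (Y p))"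
  using metric by (simp add: riemannian_metric_def)

lemma g_left [simp]:
  "u \<in> T p \<Longrightarrow> v \<in> T p \<Longrightarrow> w \<in> T p \<Longrightarrow> g p (u + v) w = g p u w + g p v w"
  "u \<in> T p \<Longrightarrow> v \<in> T p \<Longrightarrow> w \<in> T p \<Longrightarrow> g p (u - v) w = g p u w - g p v w"
  "u \<in> T p \<Longrightarrow> w \<in> T p \<Longrightarrow> g p (- u) w = - g p u w"
  "u \<in> T p \<Longrightarrow> w \<in> T p \<Longrightarrow> g p (r *\<^sub>R u) w = r * g p u w"
  "w \<in> T p \<Longrightarrow> g p 0 w = 0"
  using g_combination[of u p v w 1 1] g_combination[of u p v w 1 "-1"]
    g_combination[of u p 0 w "-1" 0] g_combination[of u p 0 w r 0] g_combination[of 0 p 0 w 0 0]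
  by simp_all

lemma g_right [simp]:
  "u \<in> T p \<Longrightarrow> v \<in> T p \<Longrightarrow> w \<in> T p \<Longrightarrow> g p w (u + v) = g p w u + g p w v"
  "u \<in> T p \<Longrightarrow> v \<in> T p \<Longrightarrow> w \<in> T p \<Longrightarrow> g p w (u - v) = g p w u - g p w v"
  "u \<in> T p \<Longrightarrow> w \<in> T p \<Longrightarrow> g p w (- u) = - g p w u"
  "u \<in> T p \<Longrightarrow> w \<in> T p \<Longrightarrow> g p w (r *\<^sub>R u) = r * g p w u"
  "w \<in> T p \<Longrightarrow> g p w 0 = 0"
  by (simp_all add: g_sym[of w])

lemma g_sum_left:
  "(\<And>i. i \<in> I \<Longrightarrow> u i \<in> T p) \<Longrightarrow> w \<in> T p \<Longrightarrow> g p (\<Sum>i\<in>I. u i) w = (\<Sum>i\<in>I. g p (u i) w)"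
  by (induction I rule: infinite_finite_induct) auto

lemma g_sum_right:
  "(\<And>i. i \<in> I \<Longrightarrow> u i \<in> T p) \<Longrightarrow> w \<in> T p \<Longrightarrow> g p w (\<Sum>i\<in>I. u i) = (\<Sum>i\<in>I. g p w (u i))"
  by (induction I rule: infinite_finite_induct) auto

lemma g_nondegenerate:
  assumes "u \<in> T p" "v \<in> T p" "\<And>w. w \<in> T p \<Longrightarrow> g p u w = g p v w"
  shows "u = v"
proof -
  have "g p (u - v) (u - v) = 0"
    using assms by simp
  then show ?thesis
    using g_pos[of "u - v" p] assms(1,2) by fastforce
qed

section \<open>Orthonormal bases of a tangent space\<close>

definition orthonormal_basis :: "'a \<Rightarrow> (nat \<Rightarrow> 'a tvec) \<Rightarrow> bool"
  where "orthonormal_basis p b \<longleftrightarrow> (\<forall>i\<in>{1..DIM('e)}. b i \<in> T p) \<and>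
    (\<forall>i\<in>{1..DIM('e)}. \<forall>j\<in>{1..DIM('e)}. g p (b i) (b j) = (if i = j then 1 else 0))"

lemma orthonormal_basis_in_T: "orthonormal_basis p b \<Longrightarrow> i \<in> {1..DIM('e)} \<Longrightarrow> b i \<in> T p"
  unfolding orthonormal_basis_def by blast

lemma orthonormal_basis_g: "orthonormal_basis p b \<Longrightarrow> i \<in> {1..DIM('e)} \<Longrightarrow> j \<in> {1..DIM('e)} \<Longrightarrow>
    g p (b i) (b j) = (if i = j then 1 else 0)"
  unfolding orthonormal_basis_def by blast

text \<open>The vectors of \<open>T p\<close> orthogonal to \<open>u\<close> form a subspace
  containing the rest of \<open>S\<close>. If \<open>u\<close> were in the span of that rest, it
  would be orthogonal to itself.\<close>

lemma orthogonal_imp_independent: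
  assumes "S \<subseteq> T p" "0 \<notin> S" "\<And>u v. u \<in> S \<Longrightarrow> v \<in> S \<Longrightarrow> u \<noteq> v \<Longrightarrow> g p u v = 0"
  shows "independent S"
  unfolding dependent_def
proof
  assume "\<exists>u\<in>S. u \<in> span (S - {u})"
  then obtain u where u: "u \<in> S" "u \<in> span (S - {u})"
    by blast
  have "subspace {v \<in> T p. g p v u = 0}"
    using assms(1) u(1) by (auto intro!: subspaceI)
  moreover have "S - {u} \<subseteq> {v \<in> T p. g p v u = 0}"
    using assms u(1) by auto
  ultimately have "u \<in> {v \<in> T p. g p v u = 0}"
    using u(2) span_minimal by blast
  then show False
    using g_pos[of u p] u(1) assms(2) by force
qed

text \<open>A non-zero remainder \<open>w\<close> would be orthogonal to every \<open>b i\<close>.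
  Together they would be \<open>DIM('e) + 1\<close> independent vectors in a space spanned by at
  most \<open>DIM('e)\<close> coordinate vectors.\<close>

lemma orthonormal_expansion:
  assumes b: "orthonormal_basis p b" and u: "u \<in> T p"
  shows "u = (\<Sum>i = 1..DIM('e). g p u (b i) *\<^sub>R b i)"
proof (rule ccontr)
  define I where "I = {1..DIM('e)}"
  define w where "w = u - (\<Sum>i\<in>I. g p u (b i) *\<^sub>R b i)"
  have bT: "b i \<in> T p" if "i \<in> I" for i
    using orthonormal_basis_in_T[OF b] that by (simp add: I_def)
  have bb: "g p (b i) (b j) = (if i = j then 1 else 0)" if "i \<in> I" "j \<in> I" for i j
    using orthonormal_basis_g[OF b] that by (simp add: I_def)
  have w: "w \<in> T p"
    unfolding w_def using u bT by (intro T_intros T_sum) auto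
  assume "\<not> ?thesis"
  then have w0: "w \<noteq> 0"
    by (simp add: w_def I_def)
  have wb: "g p w (b j) = 0" if j: "j \<in> I" for j
  proof -
    have "g p (\<Sum>i\<in>I. g p u (b i) *\<^sub>R b i) (b j) = (\<Sum>i\<in>I. if i = j then g p u (b i) else 0)"
      using bT bb j by (subst g_sum_left) (auto intro!: sum.cong)
    also have "\<dots> = g p u (b j)"
      using j by (simp add: I_def)
    finally show ?thesis
      unfolding w_def using u bT j by (subst g_left(2)) auto
  qed
  have inj: "inj_on b I"
    by (rule inj_onI) (metis bb zero_neq_one)
  have b0: "b i \<noteq> 0" if "i \<in> I" for i
    using bb[of i i] that bT[of i] by auto
  have wnb: "w \<notin> b ` I"
    using wb bb by force
  have "independent (insert w (b ` I))"
  proof (rule orthogonal_imp_independent)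
    show "insert w (b ` I) \<subseteq> T p" "0 \<notin> insert w (b ` I)"
      using w w0 b0 bT by auto
    show "g p x y = 0" if "x \<in> insert w (b ` I)" "y \<in> insert w (b ` I)" "x \<noteq> y" for x y
      using that wb bb g_sym[OF w] bT by force
  qed
  moreover obtain U c where c: "(U, c) \<in> A" "p \<in> U"
    by (rule chart_around)
  ultimately have "card (insert w (b ` I)) \<le> card (dir_deriv A (U, c) p ` Basis)"
    using w bT by (intro independent_span_bound[THEN conjunct2])
      (auto simp: tangent_space_span[OF c, symmetric])
  also have "\<dots> \<le> DIM('e)"
    by (simp add: card_image_le)
  finally show False
    using wnb inj by (simp add: card_image I_def)
qed

lemma parseval:
  assumes "orthonormal_basis p b" "u \<in> T p" "v \<in> T p"
  shows "(\<Sum>i = 1..DIM('e). g p u (b i) * g p v (b i)) = g p u v"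
proof -
  have "g p u v = g p (\<Sum>i = 1..DIM('e). g p u (b i) *\<^sub>R b i) v"
    using orthonormal_expansion[OF assms(1,2)] by simp
  also have "\<dots> = (\<Sum>i = 1..DIM('e). g p u (b i) * g p (b i) v)"
    using assms orthonormal_basis_in_T[OF assms(1)] by (subst g_sum_left) auto
  finally show ?thesis
    using g_sym[OF assms(3)] orthonormal_basis_in_T[OF assms(1)] by simp
qed

lemma orthonormal_frame_basis:
  "orthonormal_frame A g U e \<Longrightarrow> p \<in> U \<Longrightarrow> orthonormal_basis p (\<lambda>a. e a p)"
  unfolding orthonormal_frame_def orthonormal_basis_def
  by (auto intro: vector_fields_in_tangent_space)

text \<open>The procedure runs at all points of \<open>U\<close> at once, so that its output is
  smooth. The span clause keeps the induction going: it shows that the next remainder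
  \<open>y\<close> vanishes nowhere.\<close>

lemma gram_schmidt:
  fixes k :: nat
  assumes U: "open U"
    and x: "\<And>a. a \<in> {1..k} \<Longrightarrow> x a \<in> vector_fields A U"
    and indep: "\<And>q a. q \<in> U \<Longrightarrow> a \<in> {1..k} \<Longrightarrow> x a q \<notin> span ((\<lambda>b. x b q) ` {1..<a})"
  shows "\<exists>e. \<forall>a\<in>{1..k}. e a \<in> vector_fields A U \<and>
    (\<forall>q\<in>U. e a q \<in> span ((\<lambda>b. x b q) ` {1..k}) \<and>
      (\<forall>b\<in>{1..k}. g q (e a q) (e b q) = (if a = b then 1 else 0)))"
  using x indep
proof (induction k)
  case (Suc k)
  have "\<exists>e. \<forall>a\<in>{1..k}. e a \<in> vector_fields A U \<and>
    (\<forall>q\<in>U. e a q \<in> span ((\<lambda>b. x b q) ` {1..k}) \<and>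
      (\<forall>b\<in>{1..k}. g q (e a q) (e b q) = (if a = b then 1 else 0)))"
    using Suc.prems by (intro Suc.IH) auto
  then obtain e where e': "\<forall>a\<in>{1..k}. e a \<in> vector_fields A U \<and>
    (\<forall>q\<in>U. e a q \<in> span ((\<lambda>b. x b q) ` {1..k}) \<and>
      (\<forall>b\<in>{1..k}. g q (e a q) (e b q) = (if a = b then 1 else 0)))" ..
  have e: "e a \<in> vector_fields A U" if "a \<in> {1..k}" for a
    using bspec[OF e' that] by simp
  have span: "e a q \<in> span ((\<lambda>b. x b q) ` {1..k})" if "a \<in> {1..k}" "q \<in> U" for a q
    using bspec[OF e' that(1)] that(2) by simp
  have on: "g q (e a q) (e b q) = (if a = b then 1 else 0)"
    if "a \<in> {1..k}" "b \<in> {1..k}" "q \<in> U" for a b q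
    using bspec[OF e' that(1)] that(2,3) by simp
  let ?x = "x (Suc k)"
  have xU: "?x \<in> vector_fields A U"
    using Suc.prems(1) by simp
  define y where "y q = ?x q + (\<Sum>a = 1..k. (- g q (?x q) (e a q)) *\<^sub>R e a q)" for q
  have y: "y \<in> vector_fields A U"
    unfolding y_def
  proof (intro vector_fields_add[OF xU] vector_fields_sum vector_fields_scale e)
    show "smooth_fun A U (\<lambda>q. - g q (?x q) (e a q))" if "a \<in> {1..k}" for a
      using smooth_fun_mult[OF U smooth_fun_const[of U "-1"] g_smooth[OF U xU e[OF that]]] by simp
  qed
  have yT: "y q \<in> T q" and eT: "a \<in> {1..k} \<Longrightarrow> e a q \<in> T q" and xT: "?x q \<in> T q" if "q \<in> U" for q a
    using that y e xU by (auto intro: vector_fields_in_tangent_space)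
  have span': "e a q \<in> span ((\<lambda>b. x b q) ` {1..Suc k})" if "a \<in> {1..k}" "q \<in> U" for a q
    using span[OF that] span_mono[of "(\<lambda>b. x b q) ` {1..k}" "(\<lambda>b. x b q) ` {1..Suc k}"] by force
  have yspan: "y q \<in> span ((\<lambda>b. x b q) ` {1..Suc k})" if "q \<in> U" for q
    unfolding y_def using span' that
    by (intro span_add[OF span_base] span_sum span_scale) auto
  have y0: "y q \<noteq> 0" if q: "q \<in> U" for q
  proof
    assume "y q = 0"
    then have "?x q = - (\<Sum>a = 1..k. (- g q (?x q) (e a q)) *\<^sub>R e a q)"
      unfolding y_def by (simp add: eq_neg_iff_add_eq_0)
    moreover have "\<dots> \<in> span ((\<lambda>b. x b q) ` {1..k})"
      using span q by (intro span_neg span_sum span_scale) auto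
    ultimately show False
      using Suc.prems(2)[OF q, of "Suc k"] by (simp add: atLeastLessThanSuc_atLeastAtMost)
  qed
  have ye: "g q (y q) (e b q) = 0" if b: "b \<in> {1..k}" and q: "q \<in> U" for b q
  proof -
    have "g q (\<Sum>a = 1..k. (- g q (?x q) (e a q)) *\<^sub>R e a q) (e b q)
        = (\<Sum>a = 1..k. g q ((- g q (?x q) (e a q)) *\<^sub>R e a q) (e b q))"
      using b q eT by (intro g_sum_left) auto
    also have "\<dots> = (\<Sum>a = 1..k. if a = b then - g q (?x q) (e a q) else 0)"
      using b q eT on by (intro sum.cong refl) auto
    also have "\<dots> = - g q (?x q) (e b q)"
      using b by simp
    finally show ?thesis
      unfolding y_def using b q eT xT by (subst g_left(1)) auto
  qed
  define f where "f q = g q (y q) (y q)" for q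
  have f0: "f q > 0" if "q \<in> U" for q
    using g_pos[OF yT[OF that] y0[OF that]] by (simp add: f_def)
  \<comment> \<open>\<open>f\<close> is the squared length of \<open>y\<close>; its power
    \<open>-1/2\<close> is smooth by \<open>smooth_fun_powr\<close> because \<open>f\<close> is
    positive on \<open>U\<close>.\<close>
  define z where "z q = (f q powr (-1/2)) *\<^sub>R y q" for q
  have z: "z \<in> vector_fields A U"
    unfolding z_def using f0 g_smooth[OF U y y]
    by (intro vector_fields_scale[OF y] smooth_fun_powr[OF U]) (auto simp: f_def)
  have zz: "g q (z q) (z q) = 1" if q: "q \<in> U" for q
  proof -
    have "g q (z q) (z q) = (f q powr (-1/2) * f q powr (-1/2)) * f q"
      using yT[OF q] by (simp add: z_def f_def)
    also have "\<dots> = 1"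
      using f0[OF q] by (simp add: powr_minus_divide flip: powr_add)
    finally show ?thesis .
  qed
  have ze: "g q (z q) (e b q) = 0" "g q (e b q) (z q) = 0" if "b \<in> {1..k}" "q \<in> U" for b q
    using that ye[OF that] yT eT[OF that(2,1)] g_sym[of "e b q" q "y q"] by (auto simp: z_def)
  have zspan: "z q \<in> span ((\<lambda>b. x b q) ` {1..Suc k})" if "q \<in> U" for q
    unfolding z_def by (rule span_scale[OF yspan[OF that]])
  show ?case
  proof (intro exI[of _ "e(Suc k := z)"] ballI conjI)
    fix a
    assume a: "a \<in> {1..Suc k}"
    then have a': "a \<noteq> Suc k \<Longrightarrow> a \<in> {1..k}"
      by auto
    show "(e(Suc k := z)) a \<in> vector_fields A U"
      using z e[OF a'] by simp
    fix q
    assume q: "q \<in> U"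
    show "(e(Suc k := z)) a q \<in> span ((\<lambda>b. x b q) ` {1..Suc k})"
      using zspan[OF q] span'[OF a' q] by simp
    fix b
    assume b: "b \<in> {1..Suc k}"
    then have b': "b \<noteq> Suc k \<Longrightarrow> b \<in> {1..k}"
      by auto
    show "g q ((e(Suc k := z)) a q) ((e(Suc k := z)) b q) = (if a = b then 1 else 0)"
      using zz[OF q] ze[OF a' q] ze[OF b' q] on[OF a' b' q] by auto
  qed
qed simp

text \<open>Coordinate fields are orthonormalised on a chart domain. Without a frame around
  \<open>p\<close> the condition in \<open>ricci\<close> would be vacuous and its \<open>THE\<close>
  would determine nothing.\<close>

lemma local_orthonormal_frame:
  obtains U e where "open U" "p \<in> U" "orthonormal_frame A g U e"
proof -
  obtain U c where c: "(U, c) \<in> A" "p \<in> U"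
    by (rule chart_around)
  \<comment> \<open>The enumeration starts at 1 to match the index set of
    \<open>orthonormal_frame\<close>.\<close>
  obtain h where h: "bij_betw h {1..DIM('e)} (Basis :: 'e set)"
    using ex_bij_betw_nat_finite_1[OF finite_Basis] by blast
  let ?x = "\<lambda>a q. dir_deriv A (U, c) q (h a)"
  have "?x a q \<notin> span ((\<lambda>b. ?x b q) ` {1..<a})" if q: "q \<in> U" and a: "a \<in> {1..DIM('e)}" for q a
  proof
    assume "?x a q \<in> span ((\<lambda>b. ?x b q) ` {1..<a})"
    moreover have "(\<lambda>b. ?x b q) ` {1..<a} = dir_deriv A (U, c) q ` (h ` {1..<a})"
      by (simp add: image_image)
    ultimately have "?x a q \<in> dir_deriv A (U, c) q ` span (h ` {1..<a})"
      using linear_span_image[OF linear_dir_deriv[OF smooth_manifold_axioms c(1) q]] by simp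
    then have "h a \<in> span (h ` {1..<a})"
      using inj_dir_deriv[OF c(1) q] by (auto dest: injD)
    moreover have "h ` {1..<a} \<subseteq> Basis - {h a}"
    proof (rule image_subsetI)
      fix b
      assume b: "b \<in> {1..<a}"
      have "b \<in> {1..DIM('e)}" "b \<noteq> a"
        using a b by simp_all
      then show "h b \<in> Basis - {h a}"
        using bij_betwE[OF h] inj_onD[OF bij_betw_imp_inj_on[OF h], of b a] a by blast
    qed
    ultimately have "h a \<in> span (Basis - {h a})"
      by (rule span_mono[THEN subsetD, rotated])
    moreover have "h a \<in> Basis"
      using bij_betwE[OF h] a by blast
    ultimately show False
      using independent_Basis unfolding dependent_def by blast
  qed
  then obtain e where "\<forall>a\<in>{1..DIM('e)}. e a \<in> vector_fields A U \<and>
    (\<forall>q\<in>U. e a q \<in> span ((\<lambda>b. ?x b q) ` {1..DIM('e)}) \<and>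
      (\<forall>b\<in>{1..DIM('e)}. g q (e a q) (e b q) = (if a = b then 1 else 0)))"
    using gram_schmidt[OF chart_open[OF c(1)], of "DIM('e)" ?x] coordinate_vector_field[OF c(1)]
    by blast
  then have "orthonormal_frame A g U e"
    unfolding orthonormal_frame_def by blast
  then show ?thesis
    using that chart_open[OF c(1)] c(2) by blast
qed

end

section \<open>Local sections, connections and curvature\<close>

lemma sum_fun_apply: "(\<Sum>i\<in>I. f i) x = (\<Sum>i\<in>I. f i x)"
  by (induction I rule: infinite_finite_induct) auto

text \<open>
  Sections over \<open>U\<close> are normalised to vanish outside \<open>U\<close>, so that identities between them are
  equalities of functions and can be substituted under connections and brackets.
\<close>

locale riemannian_sections = riemannian_manifold A g
  for A :: "('a::{t2_space,second_countable_topology}, 'e::euclidean_space) chart set" and g +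
  fixes Dg :: "'a vfield \<Rightarrow> 'a vfield \<Rightarrow> 'a vfield" and U :: "'a set"
  assumes open_U: "open U"
    and levi_civita: "levi_civita_connection A g Dg"
begin

definition Sec :: "'a vfield set"
  where "Sec = {X \<in> vector_fields A U. \<forall>q. q \<notin> U \<longrightarrow> X q = 0}"

definition cut :: "'a vfield \<Rightarrow> 'a vfield"
  where "cut X q = (if q \<in> U then X q else 0)"

definition smul :: "('a \<Rightarrow> real) \<Rightarrow> 'a vfield \<Rightarrow> 'a vfield"
  where "smul f X = (\<lambda>q. f q *\<^sub>R X q)"

definition act :: "'a vfield \<Rightarrow> ('a \<Rightarrow> real) \<Rightarrow> 'a \<Rightarrow> real"
  where "act X f = (\<lambda>q. X q f)"

definition met :: "'a vfield \<Rightarrow> 'a vfield \<Rightarrow> 'a \<Rightarrow> real"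
  where "met X Y = (\<lambda>q. g q (X q) (Y q))"

definition bracket :: "'a vfield \<Rightarrow> 'a vfield \<Rightarrow> 'a vfield"
  where "bracket X Y = cut (lie_bracket A X Y)"

text \<open>The connection is a parameter because the rules below serve both \<open>Dg\<close> and
  the characteristic connection.\<close>

definition nab :: "('a vfield \<Rightarrow> 'a vfield \<Rightarrow> 'a vfield) \<Rightarrow> 'a vfield \<Rightarrow> 'a vfield \<Rightarrow> 'a vfield"
  where "nab D X Y = cut (D X Y)"

abbreviation smooth :: "('a \<Rightarrow> real) \<Rightarrow> bool" where "smooth f \<equiv> smooth_fun A U f"

section \<open>Sections over \<open>U\<close>, their action on functions, and the metric\<close>

lemma SecI: "X \<in> vector_fields A U \<Longrightarrow> (\<And>q. q \<notin> U \<Longrightarrow> X q = 0) \<Longrightarrow> X \<in> Sec"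
  by (simp add: Sec_def)

lemma Sec_vector_field: "X \<in> Sec \<Longrightarrow> X \<in> vector_fields A U"
  by (simp add: Sec_def)

lemma Sec_outside: "X \<in> Sec \<Longrightarrow> q \<notin> U \<Longrightarrow> X q = 0"
  by (simp add: Sec_def)

lemma Sec_T [simp]: "X \<in> Sec \<Longrightarrow> X q \<in> T q"
  using Sec_outside[of X q] vector_fields_in_tangent_space[OF Sec_vector_field, of X q]
  by (cases "q \<in> U") auto

lemma cut_Sec: "X \<in> vector_fields A U \<Longrightarrow> cut X \<in> Sec"
  by (intro SecI vector_fields_cong[of X U "cut X"]) (simp_all add: cut_def)

lemma cut_id: "X \<in> Sec \<Longrightarrow> cut X = X"
  by (rule ext) (simp add: cut_def Sec_outside[of X])

lemma Sec_eqI: "X \<in> Sec \<Longrightarrow> Y \<in> Sec \<Longrightarrow> (\<And>q. q \<in> U \<Longrightarrow> X q = Y q) \<Longrightarrow> X = Y"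
  using Sec_outside by (metis ext)

lemma Sec_zero [simp]: "0 \<in> Sec"
  using vector_fields_zero by (auto simp: Sec_def zero_fun_def)

lemma Sec_add [simp]: "X \<in> Sec \<Longrightarrow> Y \<in> Sec \<Longrightarrow> X + Y \<in> Sec"
  using vector_fields_add[of X U Y] by (auto simp: Sec_def plus_fun_def)

lemma Sec_smul [simp]: "smooth f \<Longrightarrow> X \<in> Sec \<Longrightarrow> smul f X \<in> Sec"
  using vector_fields_scale[of X U f] by (auto simp: Sec_def smul_def)

lemma scaleR_eq_smul: "r *\<^sub>R X = smul (\<lambda>q. r) X"
  by (auto simp: smul_def)

lemma Sec_scaleR [simp]: "X \<in> Sec \<Longrightarrow> r *\<^sub>R X \<in> Sec"
  by (simp add: scaleR_eq_smul smooth_fun_const)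

lemma Sec_minus [simp]: "X \<in> Sec \<Longrightarrow> - X \<in> Sec"
  using Sec_scaleR[of X "-1"] by simp

lemma Sec_diff [simp]: "X \<in> Sec \<Longrightarrow> Y \<in> Sec \<Longrightarrow> X - Y \<in> Sec"
  using Sec_add[of X "- Y"] by simp

lemma Sec_sum [simp]: "(\<And>i. i \<in> I \<Longrightarrow> X i \<in> Sec) \<Longrightarrow> (\<Sum>i\<in>I. X i) \<in> Sec"
  by (induction I rule: infinite_finite_induct) auto

lemma smooth_add [simp]: "smooth f \<Longrightarrow> smooth h \<Longrightarrow> smooth (f + h)"
  using smooth_fun_add[OF open_U] by (simp add: plus_fun_def)

lemma smooth_mult [simp]: "smooth f \<Longrightarrow> smooth h \<Longrightarrow> smooth (f * h)"
  using smooth_fun_mult[OF open_U] by (simp add: times_fun_def)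

lemma smooth_const [simp]: "smooth (\<lambda>q. r)"
  by (rule smooth_fun_const)

lemma smooth_minus [simp]: "smooth f \<Longrightarrow> smooth (- f)"
  using smooth_mult[of "\<lambda>q. -1" f] by (simp add: times_fun_def fun_Compl_def)

lemma smooth_act [simp]: "X \<in> Sec \<Longrightarrow> smooth f \<Longrightarrow> smooth (act X f)"
  using vector_fields_smooth[OF Sec_vector_field open_U] by (simp add: act_def)

lemma smooth_met [simp]: "X \<in> Sec \<Longrightarrow> Y \<in> Sec \<Longrightarrow> smooth (met X Y)"
  using g_smooth[OF open_U] by (simp add: met_def Sec_vector_field)

lemma smooth_imp_near: "smooth f \<Longrightarrow> q \<in> U \<Longrightarrow> smooth_near A q f"
  using smooth_nearI[OF open_U] by blast

lemma act_add [simp]: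
  assumes "X \<in> Sec" "smooth f" "smooth h"
  shows "act X (f + h) = act X f + act X h"
proof
  fix q
  show "act X (f + h) q = (act X f + act X h) q"
    using assms tangent_vector_add[OF Sec_T[OF assms(1)] smooth_imp_near smooth_imp_near, of f q h]
    by (cases "q \<in> U") (auto simp: act_def Sec_outside[of X] plus_fun_def)
qed

lemma act_mult [simp]:
  assumes "X \<in> Sec" "smooth f" "smooth h"
  shows "act X (f * h) = act X f * h + f * act X h"
proof
  fix q
  show "act X (f * h) q = (act X f * h + f * act X h) q"
    using assms tangent_vector_mult[OF Sec_T[OF assms(1)] smooth_imp_near smooth_imp_near, of f q h]
    by (cases "q \<in> U") (auto simp: act_def Sec_outside[of X] times_fun_def)
qed

lemma act_const [simp]: "X \<in> Sec \<Longrightarrow> act X (\<lambda>q. r) = 0"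
  using tangent_vector_const[OF Sec_T] by (auto simp: act_def fun_eq_iff)

lemma act_zero [simp]: "X \<in> Sec \<Longrightarrow> act X 0 = 0"
  using act_const[of X 0] by (simp add: zero_fun_def)

lemma act_minus [simp]: "X \<in> Sec \<Longrightarrow> smooth f \<Longrightarrow> act X (- f) = - act X f"
  using act_add[of X f "- f"] by (simp add: eq_neg_iff_add_eq_0 add.commute)

lemma act_diff [simp]: "X \<in> Sec \<Longrightarrow> smooth f \<Longrightarrow> smooth h \<Longrightarrow> act X (f - h) = act X f - act X h"
  using act_add[of X f "- h"] by simp

lemma act_left [simp]:
  "act (X - Y) f = act X f - act Y f"
  "act (- X) f = - act X f" "act (smul h X) f = h * act X f" "act 0 f = 0"
  by (auto simp: act_def smul_def)

text \<open>The constants \<open>\<eta>\<^sub>i(\<xi>\<^sub>j)\<close> vanish outside \<open>U\<close>, so only constancy on \<open>U\<close> is available.\<close>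

lemma act_locally_const:
  assumes "X \<in> Sec" "\<And>q. q \<in> U \<Longrightarrow> f q = r"
  shows "act X f = 0"
proof
  fix q
  show "act X f q = 0 q"
  proof (cases "q \<in> U")
    case True
    have "X q f = X q (\<lambda>q. r)"
      by (rule tangent_vector_cong[OF Sec_T[OF assms(1)] open_U True assms(2)])
    then show ?thesis
      using tangent_vector_const[OF Sec_T[OF assms(1)], of q r] by (simp add: act_def)
  next
    case False
    then show ?thesis
      by (simp add: act_def Sec_outside[OF assms(1)])
  qed
qed

lemma smul_simps [simp]:
  "smul f (X + Y) = smul f X + smul f Y" "smul (f + h) X = smul f X + smul h X"
  "smul f (X - Y) = smul f X - smul f Y" "smul (f - h) X = smul f X - smul h X"
  "smul f (- X) = - smul f X" "smul (- f) X = - smul f X" "smul f 0 = 0" "smul 0 X = 0"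
  "smul f (smul h X) = smul (f * h) X"
  by (auto simp: smul_def fun_eq_iff scaleR_add_left algebra_simps)

lemma met_sym: "X \<in> Sec \<Longrightarrow> Y \<in> Sec \<Longrightarrow> met X Y = met Y X"
  by (auto simp: met_def g_sym)

lemma met_simps [simp]:
  "X \<in> Sec \<Longrightarrow> Y \<in> Sec \<Longrightarrow> Z \<in> Sec \<Longrightarrow> met (X + Y) Z = met X Z + met Y Z"
  "X \<in> Sec \<Longrightarrow> Y \<in> Sec \<Longrightarrow> Z \<in> Sec \<Longrightarrow> met (X - Y) Z = met X Z - met Y Z"
  "X \<in> Sec \<Longrightarrow> Z \<in> Sec \<Longrightarrow> met (- X) Z = - met X Z"
  "X \<in> Sec \<Longrightarrow> Z \<in> Sec \<Longrightarrow> met (smul f X) Z = f * met X Z"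
  "Z \<in> Sec \<Longrightarrow> met 0 Z = 0"
  "X \<in> Sec \<Longrightarrow> Y \<in> Sec \<Longrightarrow> Z \<in> Sec \<Longrightarrow> met Z (X + Y) = met Z X + met Z Y"
  "X \<in> Sec \<Longrightarrow> Y \<in> Sec \<Longrightarrow> Z \<in> Sec \<Longrightarrow> met Z (X - Y) = met Z X - met Z Y"
  "X \<in> Sec \<Longrightarrow> Z \<in> Sec \<Longrightarrow> met Z (- X) = - met Z X"
  "X \<in> Sec \<Longrightarrow> Z \<in> Sec \<Longrightarrow> met Z (smul f X) = f * met Z X"
  "Z \<in> Sec \<Longrightarrow> met Z 0 = 0"
  by (auto simp: met_def smul_def)

text \<open>Testing against \<open>X - Y\<close> itself makes its squared length vanish at every
  point.\<close>

lemma met_eqI: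
  assumes X: "X \<in> Sec" and Y: "Y \<in> Sec" and eq: "\<And>Z. Z \<in> Sec \<Longrightarrow> met X Z = met Y Z"
  shows "X = Y"
proof
  fix q
  have "met (X - Y) (X - Y) = 0"
    using X Y eq[of "X - Y"] met_simps(2)[OF X Y Sec_diff[OF X Y]] by simp
  then have "g q (X q - Y q) (X q - Y q) = 0"
    by (simp add: met_def fun_eq_iff)
  moreover have "X q - Y q \<in> T q"
    using X Y by auto
  ultimately show "X q = Y q"
    using g_pos[of "X q - Y q" q] by fastforce
qed

section \<open>Connections acting on sections\<close>

lemma affine_Dg [simp]: "affine_connection A Dg"
  using levi_civita unfolding levi_civita_connection_def by blast

lemma connection_closed:
  "affine_connection A D \<Longrightarrow> open V \<Longrightarrow> X \<in> vector_fields A V \<Longrightarrow> Y \<in> vector_fields A V \<Longrightarrow>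
    D X Y \<in> vector_fields A V"
  unfolding affine_connection_def by simp

lemma connection_add:
  assumes "affine_connection A D" "open V" "X \<in> vector_fields A V" "X' \<in> vector_fields A V"
    "Y \<in> vector_fields A V" "p \<in> V"
  shows "D (X + X') Y p = D X Y p + D X' Y p" "D Y (X + X') p = D Y X p + D Y X' p"
  using assms unfolding affine_connection_def by simp_all

lemma connection_scale:
  assumes "affine_connection A D" "open V" "X \<in> vector_fields A V" "Y \<in> vector_fields A V"
    "smooth_fun A V f" "p \<in> V"
  shows "D (\<lambda>q. f q *\<^sub>R X q) Y p = f p *\<^sub>R D X Y p"
    "D X (\<lambda>q. f q *\<^sub>R Y q) p = X p f *\<^sub>R Y p + f p *\<^sub>R D X Y p"
  using assms unfolding affine_connection_def by simp_all

text \<open>Locality is the Leibniz rule for the indicator function of \<open>V\<close>, which is smooth on \<open>V\<close>.\<close>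

lemma connection_local:
  assumes D: "affine_connection A D" and V: "open V" "p \<in> V"
    and X: "X \<in> vector_fields A V" "X' \<in> vector_fields A V" "\<And>q. q \<in> V \<Longrightarrow> X q = X' q"
    and Y: "Y \<in> vector_fields A V" "Y' \<in> vector_fields A V" "\<And>q. q \<in> V \<Longrightarrow> Y q = Y' q"
  shows "D X Y p = D X' Y' p"
proof -
  define f :: "'a \<Rightarrow> real" where "f q = (if q \<in> V then 1 else 0)" for q
  have f: "smooth_fun A V f"
    using smooth_fun_cong[OF V(1), of "\<lambda>q. 1" f] smooth_fun_const[of V 1] by (simp add: f_def)
  have fX: "(\<lambda>q. f q *\<^sub>R X q) = (\<lambda>q. f q *\<^sub>R X' q)" and fY: "(\<lambda>q. f q *\<^sub>R Y q) = (\<lambda>q. f q *\<^sub>R Y' q)"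
    using X(3) Y(3) by (auto simp: f_def fun_eq_iff)
  have "X' p f = X' p (\<lambda>q. 1)"
    by (rule tangent_vector_cong[OF vector_fields_in_tangent_space[OF X(2) V(2)] V]) (simp add:
        f_def)
  then have X'f: "X' p f = 0"
    using tangent_vector_const[OF vector_fields_in_tangent_space[OF X(2) V(2)], of 1] by simp
  have "D X Y p = D X' Y p"
    using connection_scale(1)[OF D V(1) X(1) Y(1) f V(2)] connection_scale(1)[OF D V(1) X(2)
        Y(1) f V(2)] fX V(2)
    by (simp add: f_def)
  also have "\<dots> = D X' Y' p"
    using connection_scale(2)[OF D V(1) X(2) Y(1) f V(2)] connection_scale(2)[OF D V(1) X(2)
        Y(2) f V(2)]
      fY V(2) X'f by (simp add: f_def)
  finally show ?thesis .
qed

lemma nab_Sec [simp]: "affine_connection A D \<Longrightarrow> X \<in> Sec \<Longrightarrow> Y \<in> Sec \<Longrightarrow> nab D X Y \<in> Sec"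
  unfolding nab_def using connection_closed[OF _ open_U, of D X Y]
  by (simp add: cut_Sec Sec_vector_field)

lemma nab_apply: "q \<in> U \<Longrightarrow> nab D X Y q = D X Y q"
  by (simp add: nab_def cut_def)

lemma nab_add_left [simp]:
  assumes "affine_connection A D" "X \<in> Sec" "Y \<in> Sec" "Z \<in> Sec"
  shows "nab D (X + Y) Z = nab D X Z + nab D Y Z"
proof (rule Sec_eqI)
  show "nab D (X + Y) Z \<in> Sec" "nab D X Z + nab D Y Z \<in> Sec"
    using assms by simp_all
  show "nab D (X + Y) Z q = (nab D X Z + nab D Y Z) q" if "q \<in> U" for q
    using connection_add(1)[OF assms(1) open_U assms(2-4)[THEN Sec_vector_field] that] that
    by (simp add: nab_apply fun_eq_iff)
qed

lemma nab_add_right [simp]: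
  assumes "affine_connection A D" "X \<in> Sec" "Y \<in> Sec" "Z \<in> Sec"
  shows "nab D Z (X + Y) = nab D Z X + nab D Z Y"
proof (rule Sec_eqI)
  show "nab D Z (X + Y) \<in> Sec" "nab D Z X + nab D Z Y \<in> Sec"
    using assms by simp_all
  show "nab D Z (X + Y) q = (nab D Z X + nab D Z Y) q" if "q \<in> U" for q
    using connection_add(2)[OF assms(1) open_U assms(2-4)[THEN Sec_vector_field] that] that
    by (simp add: nab_apply fun_eq_iff)
qed

lemma nab_smul_left [simp]:
  assumes "affine_connection A D" "X \<in> Sec" "Y \<in> Sec" "smooth f"
  shows "nab D (smul f X) Y = smul f (nab D X Y)"
proof (rule Sec_eqI)
  show "nab D (smul f X) Y \<in> Sec" "smul f (nab D X Y) \<in> Sec"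
    using assms by simp_all
  show "nab D (smul f X) Y q = (smul f (nab D X Y)) q" if "q \<in> U" for q
    using connection_scale(1)[OF assms(1) open_U assms(2,3)[THEN Sec_vector_field] assms(4)
        that] that
    by (simp add: nab_apply smul_def act_def fun_eq_iff)
qed

lemma nab_smul_right [simp]:
  assumes "affine_connection A D" "X \<in> Sec" "Y \<in> Sec" "smooth f"
  shows "nab D X (smul f Y) = smul (act X f) Y + smul f (nab D X Y)"
proof (rule Sec_eqI)
  show "nab D X (smul f Y) \<in> Sec" "smul (act X f) Y + smul f (nab D X Y) \<in> Sec"
    using assms by simp_all
  show "nab D X (smul f Y) q = (smul (act X f) Y + smul f (nab D X Y)) q" if "q \<in> U" for q
    using connection_scale(2)[OF assms(1) open_U assms(2,3)[THEN Sec_vector_field] assms(4)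
        that] that
    by (simp add: nab_apply smul_def act_def fun_eq_iff)
qed

lemma nab_zero [simp]:
  assumes "affine_connection A D" "X \<in> Sec"
  shows "nab D 0 X = 0" "nab D X 0 = 0"
  using nab_add_left[of D 0 0 X] nab_add_right[of D 0 0 X] assms by simp_all

lemma nab_diff [simp]:
  assumes "affine_connection A D" "X \<in> Sec" "Y \<in> Sec" "Z \<in> Sec"
  shows "nab D (X - Y) Z = nab D X Z - nab D Y Z" "nab D Z (X - Y) = nab D Z X - nab D Z Y"
  using nab_add_left[of D "X - Y" Y Z] nab_add_right[of D "X - Y" Y Z] assms by simp_all

lemma nab_minus [simp]:
  assumes "affine_connection A D" "X \<in> Sec" "Y \<in> Sec"
  shows "nab D (- X) Y = - nab D X Y" "nab D Y (- X) = - nab D Y X"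
  using nab_diff[of D 0 X Y] assms by simp_all

lemma nab_sum_right:
  assumes "affine_connection A D" "X \<in> Sec" "\<And>i. i \<in> I \<Longrightarrow> Y i \<in> Sec"
  shows "nab D X (\<Sum>i\<in>I. Y i) = (\<Sum>i\<in>I. nab D X (Y i))"
  using assms(3) by (induction I rule: infinite_finite_induct) (simp_all add: assms(1,2))

section \<open>Lie brackets of sections and the Jacobi identity\<close>

lemma bracket_eq:
  assumes "X \<in> Sec" "Y \<in> Sec"
  shows "bracket X Y = nab Dg X Y - nab Dg Y X"
proof
  fix q
  have "q \<in> U \<Longrightarrow> Dg X Y q - Dg Y X q = lie_bracket A X Y q"
    using levi_civita open_U assms unfolding levi_civita_connection_def by (simp add:
        Sec_vector_field)
  then show "bracket X Y q = (nab Dg X Y - nab Dg Y X) q"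
    by (simp add: bracket_def nab_def cut_def)
qed

lemma bracket_Sec [simp]: "X \<in> Sec \<Longrightarrow> Y \<in> Sec \<Longrightarrow> bracket X Y \<in> Sec"
  by (simp add: bracket_eq)

lemma act_met:
  assumes "X \<in> Sec" "Y \<in> Sec" "Z \<in> Sec"
  shows "act X (met Y Z) = met (nab Dg X Y) Z + met Y (nab Dg X Z)"
proof
  fix q
  have "q \<in> U \<Longrightarrow> X q (\<lambda>q. g q (Y q) (Z q)) = g q (Dg X Y q) (Z q) + g q (Y q) (Dg X Z q)"
    using levi_civita open_U assms unfolding levi_civita_connection_def by (simp add:
        Sec_vector_field)
  then show "act X (met Y Z) q = (met (nab Dg X Y) Z + met Y (nab Dg X Z)) q"
    using assms by (cases "q \<in> U") (auto simp: act_def met_def nab_def cut_def Sec_outside[of X])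
qed

lemma bracket_apply:
  "q \<in> U \<Longrightarrow> smooth_near A q f \<Longrightarrow> bracket X Y q f = X q (\<lambda>r. Y r f) - Y q (\<lambda>r. X r f)"
  by (simp add: bracket_def cut_def lie_bracket_def)

lemma act_bracket:
  assumes "X \<in> Sec" "Y \<in> Sec" "smooth f"
  shows "act (bracket X Y) f = act X (act Y f) - act Y (act X f)"
proof
  fix q
  show "act (bracket X Y) f q = (act X (act Y f) - act Y (act X f)) q"
    using assms bracket_apply[of q f X Y] smooth_imp_near[OF assms(3)]
    by (cases "q \<in> U") (simp_all add: act_def Sec_outside[of X] Sec_outside[of Y] Sec_outside[of
        "bracket X Y"])
qed

lemma smooth_near_Sec: "X \<in> Sec \<Longrightarrow> q \<in> U \<Longrightarrow> smooth_near A q f \<Longrightarrow> smooth_near A q (\<lambda>r. X r f)"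
proof -
  assume X: "X \<in> Sec" and q: "q \<in> U" and "smooth_near A q f"
  then obtain W where W: "open W" "q \<in> W" "smooth_fun A W f"
    unfolding smooth_near_def by blast
  have "smooth_fun A (U \<inter> W) (\<lambda>r. X r f)"
    using W open_U by (intro vector_fields_smooth[OF Sec_vector_field[OF X]]
        smooth_fun_subset[OF W(3)]) auto
  then show ?thesis
    using W open_U q by (intro smooth_nearI[of "U \<inter> W"]) auto
qed

lemma tangent_vector_diff:
  assumes "u \<in> T p" "smooth_near A p f" "smooth_near A p h"
  shows "u (\<lambda>q. f q - h q) = u f - u h"
proof -
  have m: "smooth_near A p (\<lambda>q. -1 * h q)"
    using smooth_near_mult[OF smooth_near_const assms(3), of "-1"] .
  have "u (\<lambda>q. -1 * h q) = - u h"
    using tangent_vector_mult[OF assms(1) smooth_near_const assms(3), of "-1"]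
      tangent_vector_const[OF assms(1)] by simp
  then show ?thesis
    using tangent_vector_add[OF assms(1,2) m] by simp
qed

text \<open>An identity between tangent vectors at \<open>q\<close> has to be tested on every
  function smooth near \<open>q\<close>, not only on those smooth on all of \<open>U\<close>. The
  inner bracket is expanded on \<open>U \<inter> W\<close>, where \<open>f\<close> is smooth and the
  default value in \<open>lie_bracket\<close> does not occur.\<close>

lemma bracket_bracket_apply:
  assumes X: "X \<in> Sec" and Y: "Y \<in> Sec" and Z: "Z \<in> Sec" and q: "q \<in> U" and f: "smooth_near A q f"
  shows "bracket X (bracket Y Z) q f = X q (\<lambda>r. Y r (\<lambda>s. Z s f)) - X q (\<lambda>r. Z r (\<lambda>s. Y s f))
    - Y q (\<lambda>r. Z r (\<lambda>s. X s f)) + Z q (\<lambda>r. Y r (\<lambda>s. X s f))"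
proof -
  obtain W where W: "open W" "q \<in> W" "smooth_fun A W f"
    using f unfolding smooth_near_def by blast
  have "X q (\<lambda>r. bracket Y Z r f) = X q (\<lambda>r. Y r (\<lambda>s. Z s f) - Z r (\<lambda>s. Y s f))"
  proof (rule tangent_vector_cong[OF Sec_T[OF X]])
    show "open (U \<inter> W)" "q \<in> U \<inter> W"
      using W open_U q by auto
    show "bracket Y Z r f = Y r (\<lambda>s. Z s f) - Z r (\<lambda>s. Y s f)" if "r \<in> U \<inter> W" for r
      using that W smooth_nearI[OF W(1) _ W(3), of r] by (simp add: bracket_apply)
  qed
  also have "\<dots> = X q (\<lambda>r. Y r (\<lambda>s. Z s f)) - X q (\<lambda>r. Z r (\<lambda>s. Y s f))"
    by (rule tangent_vector_diff[OF Sec_T[OF X] smooth_near_Sec[OF Y q smooth_near_Sec[OF Z q f]]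
          smooth_near_Sec[OF Z q smooth_near_Sec[OF Y q f]]])
  finally show ?thesis
    using bracket_apply[OF q f, of X "bracket Y Z"] bracket_apply[OF q smooth_near_Sec[OF X q
        f], of Y Z]
    by simp
qed

lemma jacobi:
  assumes "X \<in> Sec" "Y \<in> Sec" "Z \<in> Sec"
  shows "bracket X (bracket Y Z) + bracket Y (bracket Z X) + bracket Z (bracket X Y) = 0"
proof (rule Sec_eqI)
  fix q
  assume q: "q \<in> U"
  have "(bracket X (bracket Y Z) + bracket Y (bracket Z X) + bracket Z (bracket X Y)) q f = 0" for f
  proof (cases "smooth_near A q f")
    case True
    then show ?thesis
      using assms q by (simp add: bracket_bracket_apply)
  next
    case False
    have "V q f = 0" if "V \<in> Sec" for V
      by (rule tangent_vector_not_smooth[OF Sec_T[OF that] False])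
    from this[of "bracket X (bracket Y Z)"] this[of "bracket Y (bracket Z X)"]
      this[of "bracket Z (bracket X Y)"] show ?thesis
      using assms by simp
  qed
  then show "(bracket X (bracket Y Z) + bracket Y (bracket Z X) + bracket Z (bracket X Y)) q = 0 q"
    by (simp add: fun_eq_iff)
qed (use assms in simp_all)

lemma bracket_skew: "X \<in> Sec \<Longrightarrow> Y \<in> Sec \<Longrightarrow> bracket Y X = - bracket X Y"
  by (simp add: bracket_eq)

section \<open>Curvature as a tensor on sections\<close>

definition curv :: "('a vfield \<Rightarrow> 'a vfield \<Rightarrow> 'a vfield) \<Rightarrow> 'a vfield \<Rightarrow> 'a vfield \<Rightarrow> 'a vfield \<Rightarrow> 'a
    vfield"
  where "curv D X Y Z = nab D X (nab D Y Z) - nab D Y (nab D X Z) - nab D (bracket X Y) Z"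

definition tensorial :: "('a vfield \<Rightarrow> 'a vfield) \<Rightarrow> bool"
  where "tensorial F \<longleftrightarrow> (\<forall>X\<in>Sec. \<forall>Y\<in>Sec. F (X + Y) = F X + F Y) \<and>
    (\<forall>f. \<forall>X\<in>Sec. smooth f \<longrightarrow> F (smul f X) = smul f (F X))"

lemma curv_Sec [simp]:
  "affine_connection A D \<Longrightarrow> X \<in> Sec \<Longrightarrow> Y \<in> Sec \<Longrightarrow> Z \<in> Sec \<Longrightarrow> curv D X Y Z \<in> Sec"
  by (simp add: curv_def)

lemma curv_skew: "affine_connection A D \<Longrightarrow> X \<in> Sec \<Longrightarrow> Y \<in> Sec \<Longrightarrow> Z \<in> Sec \<Longrightarrow>
    curv D Y X Z = - curv D X Y Z"
  by (simp add: curv_def bracket_skew[of X Y])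

lemma bracket_smul:
  assumes "X \<in> Sec" "Y \<in> Sec" "smooth f"
  shows "bracket (smul f X) Y = smul f (bracket X Y) - smul (act Y f) X"
  using assms by (simp add: bracket_eq)

text \<open>The derivative \<open>Y f\<close> produced by the Leibniz rule cancels against the one
  in \<open>bracket (smul f X) Y\<close>.\<close>

lemma tensorial_curv1:
  assumes "affine_connection A D" "Y \<in> Sec" "Z \<in> Sec"
  shows "tensorial (\<lambda>X. curv D X Y Z)"
  unfolding tensorial_def
proof (intro conjI ballI allI impI)
  show "curv D (X + X') Y Z = curv D X Y Z + curv D X' Y Z" if "X \<in> Sec" "X' \<in> Sec" for X X'
    using assms that by (simp add: curv_def bracket_eq algebra_simps)
  show "curv D (smul f X) Y Z = smul f (curv D X Y Z)" if "X \<in> Sec" "smooth f" for f X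
    using assms that by (simp add: curv_def bracket_smul algebra_simps)
qed

lemma tensorial_curv2:
  assumes "affine_connection A D" "X \<in> Sec" "Z \<in> Sec"
  shows "tensorial (\<lambda>Y. curv D X Y Z)"
  using tensorial_curv1[OF assms] curv_skew[OF assms(1) _ assms(2,3)] assms
  by (simp add: tensorial_def)

lemma tensorial_curv3:
  assumes "affine_connection A D" "X \<in> Sec" "Y \<in> Sec"
  shows "tensorial (\<lambda>Z. curv D X Y Z)"
  unfolding tensorial_def
proof (intro conjI ballI allI impI)
  show "curv D X Y (Z + Z') = curv D X Y Z + curv D X Y Z'" if "Z \<in> Sec" "Z' \<in> Sec" for Z Z'
    using assms that by (simp add: curv_def algebra_simps)
  show "curv D X Y (smul f Z) = smul f (curv D X Y Z)" if "Z \<in> Sec" "smooth f" for f Z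
    using assms that by (simp add: curv_def act_bracket algebra_simps)
qed

definition frame :: "(nat \<Rightarrow> 'a vfield) \<Rightarrow> bool"
  where "frame e \<longleftrightarrow> (\<forall>a\<in>{1..DIM('e)}. e a \<in> Sec) \<and> (\<forall>q\<in>U. orthonormal_basis q (\<lambda>a. e a q))"

lemma frame_Sec: "frame e \<Longrightarrow> a \<in> {1..DIM('e)} \<Longrightarrow> e a \<in> Sec"
  unfolding frame_def by blast

lemma frame_basis: "frame e \<Longrightarrow> q \<in> U \<Longrightarrow> orthonormal_basis q (\<lambda>a. e a q)"
  unfolding frame_def by blast

lemma frame_expansion:
  assumes e: "frame e" and X: "X \<in> Sec"
  shows "X = (\<Sum>a = 1..DIM('e). smul (met X (e a)) (e a))"
proof (rule Sec_eqI)
  show "(\<Sum>a = 1..DIM('e). smul (met X (e a)) (e a)) \<in> Sec"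
    using X frame_Sec[OF e] by (intro Sec_sum) simp
  show "X q = (\<Sum>a = 1..DIM('e). smul (met X (e a)) (e a)) q" if "q \<in> U" for q
    using orthonormal_expansion[OF frame_basis[OF e that] Sec_T[OF X]]
    by (simp add: sum_fun_apply smul_def met_def)
qed (rule X)

lemma tensorial_sum:
  assumes "tensorial F" "\<And>i. i \<in> I \<Longrightarrow> X i \<in> Sec"
  shows "F (\<Sum>i\<in>I. X i) = (\<Sum>i\<in>I. F (X i))"
proof -
  have "F (0 + 0) = F 0 + F 0"
    using assms(1) Sec_zero unfolding tensorial_def by blast
  then have "F 0 = 0"
    by simp
  then show ?thesis
    using assms(2)
    by (induction I rule: infinite_finite_induct) (use assms(1) in \<open>auto simp: tensorial_def\<close>)
qed

text \<open>The coefficients in a frame over all of \<open>U\<close> are smooth functions and can be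
  pulled out of \<open>F\<close>. Hence the value at \<open>q\<close> depends on \<open>X\<close>
  only through \<open>X q\<close>.\<close>

lemma tensorial_expansion:
  assumes F: "tensorial F" and e: "frame e" and X: "X \<in> Sec"
  shows "F X q = (\<Sum>a = 1..DIM('e). g q (X q) (e a q) *\<^sub>R F (e a) q)"
proof -
  have "F X = F (\<Sum>a = 1..DIM('e). smul (met X (e a)) (e a))"
    using frame_expansion[OF e X] by simp
  also have "\<dots> = (\<Sum>a = 1..DIM('e). F (smul (met X (e a)) (e a)))"
    using frame_Sec[OF e] X by (intro tensorial_sum[OF F]) simp
  also have "\<dots> = (\<Sum>a = 1..DIM('e). smul (met X (e a)) (F (e a)))"
    using F frame_Sec[OF e] X by (intro sum.cong refl) (simp add: tensorial_def)
  finally show ?thesis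
    by (simp add: sum_fun_apply smul_def met_def)
qed

text \<open>Tensoriality expands both slots of \<open>e'\<close> in the frame \<open>e\<close>.
  Summing over the index of \<open>e'\<close> first contracts the coefficients, by Parseval, to
  \<open>g q (e c q) (e d q)\<close>, a Kronecker delta.\<close>

lemma curv_trace_independent:
  assumes D: "affine_connection A D" and e: "frame e" and e': "frame e'"
    and X: "X \<in> Sec" and X': "X' \<in> Sec" and q: "q \<in> U" and eq: "X q = X' q"
  shows "(\<Sum>a = 1..DIM('e). curv D X (e a) (e a) q) = (\<Sum>a = 1..DIM('e). curv D X' (e' a) (e' a) q)"
proof -
  let ?I = "{1..DIM('e)}"
  note eS = frame_Sec[OF e] and eS' = frame_Sec[OF e']
  have X_indep: "curv D X Y Z q = curv D X' Y Z q" if "Y \<in> Sec" "Z \<in> Sec" for Y Z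
    using tensorial_expansion[OF tensorial_curv1[OF D that] e X, of q]
      tensorial_expansion[OF tensorial_curv1[OF D that] e X', of q] eq by simp
  have *: "curv D X (e' b) (e' b) q = (\<Sum>c\<in>?I. \<Sum>d\<in>?I.
      (g q (e c q) (e' b q) * g q (e d q) (e' b q)) *\<^sub>R curv D X (e c) (e d) q)" if b: "b \<in> ?I"
          for b
  proof -
    have "curv D X (e' b) (e' b) q = (\<Sum>c\<in>?I. g q (e' b q) (e c q) *\<^sub>R curv D X (e c) (e' b) q)"
      using tensorial_expansion[OF tensorial_curv2[OF D X eS'[OF b]] e eS'[OF b]] .
    also have "\<dots> = (\<Sum>c\<in>?I. g q (e' b q) (e c q) *\<^sub>R
        (\<Sum>d\<in>?I. g q (e' b q) (e d q) *\<^sub>R curv D X (e c) (e d) q))"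
      using tensorial_expansion[OF tensorial_curv3[OF D X eS] e eS'[OF b]]
      by (intro sum.cong refl) simp
    also have "\<dots> = (\<Sum>c\<in>?I. \<Sum>d\<in>?I.
      (g q (e c q) (e' b q) * g q (e d q) (e' b q)) *\<^sub>R curv D X (e c) (e d) q)"
      using eS eS'[OF b] g_sym[OF Sec_T[OF eS'[OF b]] Sec_T[OF eS]]
      by (intro sum.cong refl) (simp add: scaleR_sum_right)
    finally show ?thesis .
  qed
  have "(\<Sum>b\<in>?I. curv D X (e' b) (e' b) q) = (\<Sum>b\<in>?I. \<Sum>c\<in>?I. \<Sum>d\<in>?I.
      (g q (e c q) (e' b q) * g q (e d q) (e' b q)) *\<^sub>R curv D X (e c) (e d) q)"
    using * by (intro sum.cong refl)
  also have "\<dots> = (\<Sum>c\<in>?I. \<Sum>b\<in>?I. \<Sum>d\<in>?I.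
      (g q (e c q) (e' b q) * g q (e d q) (e' b q)) *\<^sub>R curv D X (e c) (e d) q)"
    by (rule sum.swap)
  also have "\<dots> = (\<Sum>c\<in>?I. \<Sum>d\<in>?I. \<Sum>b\<in>?I.
      (g q (e c q) (e' b q) * g q (e d q) (e' b q)) *\<^sub>R curv D X (e c) (e d) q)"
    by (intro sum.cong refl sum.swap)
  also have "\<dots> = (\<Sum>c\<in>?I. \<Sum>d\<in>?I. g q (e c q) (e d q) *\<^sub>R curv D X (e c) (e d) q)"
    using parseval[OF frame_basis[OF e' q] Sec_T[OF eS] Sec_T[OF eS]]
    by (intro sum.cong refl) (simp flip: scaleR_sum_left)
  also have "\<dots> = (\<Sum>c\<in>?I. \<Sum>d\<in>?I. if c = d then curv D X (e c) (e d) q else 0)"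
    using orthonormal_basis_g[OF frame_basis[OF e q]] by (intro sum.cong refl) auto
  also have "\<dots> = (\<Sum>c\<in>?I. curv D X (e c) (e c) q)"
    by (intro sum.cong refl) simp
  finally show ?thesis
    using X_indep eS' by simp
qed

section \<open>From normalised sections back to arbitrary fields over \<open>U\<close>\<close>

lemma bracket_cut:
  assumes X: "X \<in> vector_fields A U" and Y: "Y \<in> vector_fields A U" and q: "q \<in> U"
  shows "bracket (cut X) (cut Y) q = lie_bracket A X Y q"
proof
  fix f
  have "X q (\<lambda>r. cut Y r f) = X q (\<lambda>r. Y r f)" "Y q (\<lambda>r. cut X r f) = Y q (\<lambda>r. X r f)"
    using tangent_vector_cong[OF vector_fields_in_tangent_space[OF X q] open_U q, of "\<lambda>r. cut Y
        r f"]
      tangent_vector_cong[OF vector_fields_in_tangent_space[OF Y q] open_U q, of "\<lambda>r. cut X r f"]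
    by (simp_all add: cut_def)
  then show "bracket (cut X) (cut Y) q f = lie_bracket A X Y q f"
    using q by (simp add: bracket_def cut_def[where q = q] lie_bracket_def)
qed

lemma nab_cut:
  assumes "affine_connection A D" "X \<in> vector_fields A U" "Y \<in> vector_fields A U" "q \<in> U"
  shows "nab D (cut X) (cut Y) q = D X Y q"
proof -
  have "D (cut X) (cut Y) q = D X Y q"
    using assms cut_Sec[THEN Sec_vector_field]
    by (intro connection_local[OF assms(1) open_U assms(4)]) (auto simp: cut_def)
  then show ?thesis
    using assms(4) by (simp add: nab_def cut_def[where q = q])
qed

lemma curv_cut:
  assumes D: "affine_connection A D" and X: "X \<in> vector_fields A U" and Y: "Y \<in> vector_fields A U"
    and Z: "Z \<in> vector_fields A U" and q: "q \<in> U"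
  shows "curv D (cut X) (cut Y) (cut Z) q = curvature A D X Y Z q"
proof -
  have 1: "nab D (cut X) (cut Y) = cut (D X Y)" if "X \<in> vector_fields A U" "Y \<in> vector_fields A
      U" for X Y
    using that D nab_cut[OF D that]
    by (intro Sec_eqI nab_Sec cut_Sec connection_closed[OF D open_U]) (auto simp: cut_def[of "D
        X Y"])
  have 2: "bracket (cut X) (cut Y) = cut (lie_bracket A X Y)"
    using bracket_cut[OF X Y] by (auto simp: bracket_def cut_def fun_eq_iff)
  have "cut (lie_bracket A X Y) \<in> Sec"
    unfolding 2[symmetric] using X Y by (simp add: cut_Sec)
  \<comment> \<open>On \<open>U\<close> the bracket agrees with its normalised version, which is a
    section by \<open>bracket_Sec\<close>.\<close>
  then have 3: "lie_bracket A X Y \<in> vector_fields A U"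
    by (intro vector_fields_cong[OF Sec_vector_field, of "cut (lie_bracket A X Y)"]) (simp_all
        add: cut_def)
  show ?thesis
    unfolding curv_def curvature_def 2 using X Y Z 3 q
    by (simp add: 1 connection_closed[OF D open_U] cut_def[where q = q])
qed

lemma frame_cut:
  assumes "orthonormal_frame A g V e" "U \<subseteq> V"
  shows "frame (\<lambda>a. cut (e a))"
  unfolding frame_def
proof (intro conjI ballI)
  show "cut (e a) \<in> Sec" if "a \<in> {1..DIM('e)}" for a
    using assms that vector_fields_subset[of "e a" V U]
    by (intro cut_Sec) (simp add: orthonormal_frame_def)
  show "orthonormal_basis q (\<lambda>a. cut (e a) q)" if "q \<in> U" for q
    using orthonormal_frame_basis[OF assms(1), of q] assms(2) that by (auto simp: cut_def)
qed

end

text \<open>This is where the \<open>THE\<close> in \<open>ricci\<close> becomes well defined.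
  Competing data live over another open set \<open>U'\<close>, so both traces are moved to
  \<open>U \<inter> U'\<close> through a second instance of the locale. They are compared there as
  vectors, and \<open>g\<close> is applied only afterwards.\<close>

lemma ricci_eq:
  fixes A :: "('a::{t2_space,second_countable_topology}, 'e::euclidean_space) chart set"
  assumes sec: "riemannian_sections A g Dg U" and D: "affine_connection A D"
    and p: "p \<in> U" and e: "riemannian_sections.frame A g U e"
    and X: "X \<in> riemannian_sections.Sec A U" and v: "v \<in> tangent_space A p"
  shows "ricci A g D p (X p) v =
    (\<Sum>a = 1..DIM('e). g p (riemannian_sections.curv A U D X (e a) (e a) p) v)"
proof -
  interpret riemannian_sections A g Dg U by fact
  let ?I = "{1..DIM('e)}"
  let ?r = "\<Sum>a\<in>?I. g p (curv D X (e a) (e a) p) v"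
  have eS: "e a \<in> Sec" if "a \<in> ?I" for a
    using frame_Sec[OF e that] .
  have r_eq: "?r = (\<Sum>a\<in>?I. g p (curvature A D X' (e' a) (e' a) p) v)"
    if U': "open U'" "p \<in> U'" and e': "orthonormal_frame A g U' e'" and X': "X' \<in> vector_fields
        A U'"
      and eq: "X' p = X p" for U' e' X'
  proof -
    interpret W: riemannian_sections A g Dg "U \<inter> U'"
      using open_U U'(1) levi_civita by unfold_locales auto
    have e'W: "e' a \<in> vector_fields A (U \<inter> U')" if "a \<in> ?I" for a
      using e' that by (auto simp: orthonormal_frame_def intro: vector_fields_subset)
    have X'W: "X' \<in> vector_fields A (U \<inter> U')"
      using X' by (rule vector_fields_subset) auto
    have eW: "e a \<in> vector_fields A (U \<inter> U')" if "a \<in> ?I" for a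
      using Sec_vector_field[OF eS[OF that]] by (rule vector_fields_subset) auto
    have XW: "X \<in> vector_fields A (U \<inter> U')"
      using Sec_vector_field[OF X] by (rule vector_fields_subset) auto
    have pW: "p \<in> U \<inter> U'"
      using p U' by simp
    have on: "orthonormal_frame A g U e"
      unfolding orthonormal_frame_def
      using Sec_vector_field[OF eS] orthonormal_basis_g[OF frame_basis[OF e]] by blast
    have "(\<Sum>a\<in>?I. curv D X (e a) (e a) p) = (\<Sum>a\<in>?I. curvature A D X (e a) (e a) p)"
      using eS X p cut_id
      by (intro sum.cong refl) (metis D Sec_vector_field curv_cut)
    also have "\<dots> = (\<Sum>a\<in>?I. W.curv D (W.cut X) (W.cut (e a)) (W.cut (e a)) p)"
      using W.curv_cut[OF D XW eW eW pW] by simp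
    also have "\<dots> = (\<Sum>a\<in>?I. W.curv D (W.cut X') (W.cut (e' a)) (W.cut (e' a)) p)"
      using pW eq
      by (intro W.curv_trace_independent[OF D W.frame_cut[OF on] W.frame_cut[OF e']] W.cut_Sec
          XW X'W)
        (simp_all add: W.cut_def)
    also have "\<dots> = (\<Sum>a\<in>?I. curvature A D X' (e' a) (e' a) p)"
      using W.curv_cut[OF D X'W e'W e'W pW] by simp
    finally have sums: "(\<Sum>a\<in>?I. curv D X (e a) (e a) p) = (\<Sum>a\<in>?I. curvature A D X' (e' a) (e' a)
        p)" .
    have cT: "curvature A D X' (e' a) (e' a) p \<in> tangent_space A p" if "a \<in> ?I" for a
      using W.curv_cut[OF D X'W e'W[OF that] e'W[OF that] pW, symmetric]
        W.cut_Sec[OF X'W] W.cut_Sec[OF e'W[OF that]] D by simp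
    have "?r = g p (\<Sum>a\<in>?I. curv D X (e a) (e a) p) v"
      using eS X D v by (intro g_sum_left[symmetric]) simp_all
    also have "\<dots> = (\<Sum>a\<in>?I. g p (curvature A D X' (e' a) (e' a) p) v)"
      unfolding sums using cT v by (rule g_sum_left)
    finally show ?thesis .
  qed
  show ?thesis
    unfolding ricci_def
  proof (rule the_equality)
    show "\<forall>U' e' X'. open U' \<and> p \<in> U' \<and> orthonormal_frame A g U' e' \<and> X' \<in> vector_fields A U' \<and>
        X' p = X p \<longrightarrow>
        ?r = (\<Sum>a\<in>?I. g p (curvature A D X' (e' a) (e' a) p) v)"
      using r_eq by blast
    fix r
    assume "\<forall>U' e' X'. open U' \<and> p \<in> U' \<and> orthonormal_frame A g U' e' \<and> X' \<in> vector_fields A U'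
        \<and> X' p = X p \<longrightarrow>
        r = (\<Sum>a\<in>?I. g p (curvature A D X' (e' a) (e' a) p) v)"
    moreover have "orthonormal_frame A g U e"
      unfolding orthonormal_frame_def
      using Sec_vector_field[OF eS] orthonormal_basis_g[OF frame_basis[OF e]] by blast
    ultimately have "r = (\<Sum>a\<in>?I. g p (curvature A D X (e a) (e a) p) v)"
      using open_U p Sec_vector_field[OF X] by blast
    also have "\<dots> = ?r"
      using eS X p cut_id by (intro sum.cong refl) (metis D Sec_vector_field curv_cut)
    finally show "r = ?r" .
  qed
qed

context riemannian_sections
begin

section \<open>Symmetries of the curvature\<close>

definition metric_connection :: "('a vfield \<Rightarrow> 'a vfield \<Rightarrow> 'a vfield) \<Rightarrow> bool"
  where "metric_connection D \<longleftrightarrow> (\<forall>X\<in>Sec. \<forall>Y\<in>Sec. \<forall>Z\<in>Sec.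
    act X (met Y Z) = met (nab D X Y) Z + met Y (nab D X Z))"

lemma metric_connection_Dg: "metric_connection Dg"
  by (simp add: metric_connection_def act_met)

text \<open>Evaluate \<open>act_bracket\<close> on the function \<open>met Z V\<close>. On expanding
  by metric compatibility the mixed first-order terms cancel.\<close>

lemma curv_metric_skew:
  assumes D: "affine_connection A D" "metric_connection D"
    and XYZV: "X \<in> Sec" "Y \<in> Sec" "Z \<in> Sec" "V \<in> Sec"
  shows "met (curv D X Y Z) V = - met Z (curv D X Y V)"
proof -
  have m: "act X (met Y Z) = met (nab D X Y) Z + met Y (nab D X Z)"
    if "X \<in> Sec" "Y \<in> Sec" "Z \<in> Sec" for X Y Z
    using D(2) that unfolding metric_connection_def by blast
  have "act (bracket X Y) (met Z V) = act X (act Y (met Z V)) - act Y (act X (met Z V))"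
    using XYZV by (intro act_bracket) simp_all
  then have "met (nab D (bracket X Y) Z) V + met Z (nab D (bracket X Y) V) =
      met (nab D X (nab D Y Z)) V + met Z (nab D X (nab D Y V))
      - met (nab D Y (nab D X Z)) V - met Z (nab D Y (nab D X V))"
    using D(1) XYZV by (simp add: m algebra_simps)
  then show ?thesis
    using D(1) XYZV by (simp add: curv_def algebra_simps)
qed

text \<open>Torsion-freeness turns differences of derivatives into brackets, and the cyclic sum
  becomes the Jacobi identity.\<close>

lemma bianchi:
  assumes "X \<in> Sec" "Y \<in> Sec" "Z \<in> Sec"
  shows "curv Dg X Y Z + curv Dg Y Z X + curv Dg Z X Y = 0"
proof -
  have br: "bracket X (bracket Y Z) = nab Dg X (nab Dg Y Z) - nab Dg X (nab Dg Z Y) - nab Dg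
      (bracket Y Z) X"
    if "X \<in> Sec" "Y \<in> Sec" "Z \<in> Sec" for X Y Z
    using that by (simp add: bracket_eq[of X "bracket Y Z"]) (simp add: bracket_eq)
  then show ?thesis
    using jacobi[OF assms] assms by (simp add: br curv_def algebra_simps)
qed

text \<open>The octahedron argument: four Bianchi identities, each with a different field in the
  last slot, are combined by means of the two skew symmetries.\<close>

lemma curv_pair_symmetric:
  assumes "X \<in> Sec" "Y \<in> Sec" "Z \<in> Sec" "V \<in> Sec"
  shows "met (curv Dg X Y Z) V = met (curv Dg Z V X) Y"
proof
  fix q
  define R where "R X Y Z V = met (curv Dg X Y Z) V q" for X Y Z V
  have 1: "R Y X Z V = - R X Y Z V" if "X \<in> Sec" "Y \<in> Sec" "Z \<in> Sec" "V \<in> Sec" for X Y Z V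
    using that curv_skew[of Dg X Y Z] by (simp add: R_def)
  have 2: "R X Y V Z = - R X Y Z V" if "X \<in> Sec" "Y \<in> Sec" "Z \<in> Sec" "V \<in> Sec" for X Y Z V
    using that curv_metric_skew[OF affine_Dg metric_connection_Dg that] met_sym[of Z "curv Dg X
        Y V"]
    by (simp add: R_def)
  have 3: "R X Y Z V + R Y Z X V + R Z X Y V = 0" if "X \<in> Sec" "Y \<in> Sec" "Z \<in> Sec" "V \<in> Sec" for
      X Y Z V
  proof -
    have "met (curv Dg X Y Z + curv Dg Y Z X + curv Dg Z X Y) V = 0"
      using bianchi that by simp
    then have "met (curv Dg X Y Z) V + met (curv Dg Y Z X) V + met (curv Dg Z X Y) V = 0"
      using that by simp
    then show ?thesis
      by (simp add: R_def fun_eq_iff)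
  qed
  have "R X Y Z V = R Z V X Y"
    using 3[of X Y Z V] 3[of Y Z V X] 3[of Z V X Y] 3[of V X Y Z]
      1[of Z X Y V] 1[of X V Z Y] 1[of Y V Z X] 1[of X V Y Z]
      2[of Y Z X V] 2[of Z V X Y] 2[of V Y X Z] 2[of X V Y Z] 2[of X Z Y V] 2[of X Y Z V] 1[of Y
          V X Z] assms
    by simp
  then show "met (curv Dg X Y Z) V q = met (curv Dg Z V X) Y q"
    by (simp add: R_def)
qed

text \<open>Pair symmetry followed by the two skew symmetries. The identity holds before summation
  over a frame, so it carries over to \<open>D\<close> term by term.\<close>

lemma ricci_summand_symmetric:
  assumes "X \<in> Sec" "Y \<in> Sec" "Z \<in> Sec"
  shows "met (curv Dg X Z Z) Y = met (curv Dg Y Z Z) X"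
proof -
  have "met (curv Dg X Z Z) Y = - met (curv Dg Y Z X) Z"
    using assms curv_pair_symmetric[of X Z Z Y] curv_skew[of Dg Y Z X] by simp
  also have "\<dots> = met (curv Dg Y Z Z) X"
    using curv_metric_skew[OF affine_Dg metric_connection_Dg assms(2,3,1,3)]
      met_sym[of X "curv Dg Y Z Z"] assms by simp
  finally show ?thesis .
qed

text \<open>Constant coefficients in the frame extend a tangent vector over all of
  \<open>U\<close>.\<close>

lemma Sec_through:
  assumes e: "frame e" and p: "p \<in> U" and u: "u \<in> T p"
  obtains X where "X \<in> Sec" "X p = u"
proof
  show "(\<Sum>a = 1..DIM('e). g p u (e a p) *\<^sub>R e a) \<in> Sec"
    using frame_Sec[OF e] by (intro Sec_sum Sec_scaleR) simp
  show "(\<Sum>a = 1..DIM('e). g p u (e a p) *\<^sub>R e a) p = u"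
    using orthonormal_expansion[OF frame_basis[OF e p] u] by (simp add: sum_fun_apply)
qed

end

lemma ricci_endomorphism_eq:
  fixes A :: "('a::{t2_space,second_countable_topology}, 'e::euclidean_space) chart set"
  assumes "riemannian_manifold A g" "w \<in> tangent_space A p"
    and "\<And>v. v \<in> tangent_space A p \<Longrightarrow> g p w v = ricci A g D p u v"
  shows "ricci_endomorphism A g D p u = w"
proof -
  interpret riemannian_manifold A g by fact
  show ?thesis
    unfolding ricci_endomorphism_def
    using assms(2,3) by (intro the_equality) (auto intro!: g_nondegenerate)
qed

section \<open>The characteristic connection of an $\mathcal{S}$-manifold\<close>

locale S_sections = S_manifold A n s \<phi> \<xi> \<eta> g + riemannian_sections A g Dg U
  for A :: "('a::{t2_space,second_countable_topology}, 'e::euclidean_space) chart set"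
    and n s \<phi> \<xi> \<eta> g Dg U
begin

section \<open>Pointwise algebra of the structure tensors\<close>

abbreviation I :: "nat set" where "I \<equiv> {1..s}"

lemma phi_T [simp]: "u \<in> T p \<Longrightarrow> \<phi> p u \<in> T p"
  using phi_endomorphism unfolding tangent_endomorphism_def by simp

lemma phi_combination:
  "u \<in> T p \<Longrightarrow> v \<in> T p \<Longrightarrow> \<phi> p (a *\<^sub>R u + b *\<^sub>R v) = a *\<^sub>R \<phi> p u + b *\<^sub>R \<phi> p v"
  using phi_endomorphism unfolding tangent_endomorphism_def by simp

lemma phi_linear [simp]:
  "u \<in> T p \<Longrightarrow> v \<in> T p \<Longrightarrow> \<phi> p (u + v) = \<phi> p u + \<phi> p v"
  "u \<in> T p \<Longrightarrow> \<phi> p (r *\<^sub>R u) = r *\<^sub>R \<phi> p u"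
  "\<phi> p 0 = 0"
  using phi_combination[of u p v 1 1] phi_combination[of u p u r 0] phi_combination[of 0 p 0 0 0]
  by simp_all

lemma xi_T [simp]: "i \<in> I \<Longrightarrow> \<xi> i p \<in> T p"
  using xi_vector_field vector_fields_in_tangent_space by blast

lemma phi_xi [simp]: "i \<in> I \<Longrightarrow> \<phi> p (\<xi> i p) = 0"
  using phi_kernel[of p] span_base[of "\<xi> i p" "(\<lambda>i. \<xi> i p) ` I"] by blast

text \<open>Since \<open>\<phi>\<close> kills \<open>\<xi> i\<close>, metric compatibility leaves
  only the sum of products, from which duality selects \<open>\<eta> i\<close>.\<close>

lemma g_xi:
  assumes i: "i \<in> I" and u: "u \<in> T p"
  shows "g p (\<xi> i p) u = \<eta> i p u"
proof -
  have "g p (\<xi> i p) u = (\<Sum>k\<in>I. \<eta> k p (\<xi> i p) * \<eta> k p u)"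
    using metric_phi[OF xi_T[OF i] u] i u by simp
  also have "\<dots> = (\<Sum>k\<in>I. if k = i then \<eta> k p u else 0)"
    using i by (intro sum.cong) (auto simp: eta_xi)
  finally show ?thesis
    using i by simp
qed

text \<open>Compatibility for \<open>u\<close> and \<open>\<phi> p v\<close> has no vertical
  correction. Moreover \<open>\<phi>\<^sup>2 v\<close> differs from \<open>- v\<close> by a vertical
  vector, which is orthogonal to \<open>\<phi> p u\<close>.\<close>

lemma g_phi_skew:
  assumes u: "u \<in> T p" and v: "v \<in> T p"
  shows "g p (\<phi> p u) v = - g p u (\<phi> p v)"
proof -
  have "g p (\<phi> p u) (\<phi> p (\<phi> p v)) = g p u (\<phi> p v)"
    using metric_phi[OF u phi_T[OF v]] v by (simp add: eta_phi)
  moreover have "g p (\<phi> p u) (\<phi> p (\<phi> p v)) = - g p (\<phi> p u) v"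
  proof -
    have "g p (\<phi> p u) (\<Sum>i\<in>I. \<eta> i p v *\<^sub>R \<xi> i p) = (\<Sum>i\<in>I. \<eta> i p v * g p (\<xi> i p) (\<phi> p u))"
      using u by (subst g_sum_right) (auto simp: g_sym)
    also have "\<dots> = 0"
      using u by (simp add: g_xi eta_phi)
    finally show ?thesis
      unfolding phi_phi[OF v] using u v by (subst g_right(1)) auto
  qed
  ultimately show ?thesis
    by simp
qed

section \<open>The structure tensors acting on sections\<close>

definition ph :: "'a vfield \<Rightarrow> 'a vfield"
  where "ph X = (\<lambda>q. \<phi> q (X q))"

definition xi :: "nat \<Rightarrow> 'a vfield"
  where "xi i = cut (\<xi> i)"

text \<open>The projection onto the vertical part. Its coefficients are metric products instead of
  values of \<open>\<eta> i\<close>, so that metric compatibility differentiates them, as in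
  \<open>nab_D_ver\<close>.\<close>

definition ver :: "'a vfield \<Rightarrow> 'a vfield"
  where "ver X = (\<Sum>i\<in>I. smul (met (xi i) X) (xi i))"

definition F :: "'a vfield \<Rightarrow> 'a vfield \<Rightarrow> 'a \<Rightarrow> real"
  where "F X Y = met X (ph Y)"

lemma ph_Sec [simp]: "X \<in> Sec \<Longrightarrow> ph X \<in> Sec"
  using phi_endomorphism open_U Sec_outside[of X]
  unfolding tangent_endomorphism_def by (auto simp: Sec_def ph_def)

lemma xi_Sec [simp]: "i \<in> I \<Longrightarrow> xi i \<in> Sec"
  unfolding xi_def by (intro cut_Sec vector_fields_subset[OF xi_vector_field]) auto

lemma xi_apply: "q \<in> U \<Longrightarrow> xi i q = \<xi> i q"
  by (simp add: xi_def cut_def)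

lemma ver_Sec [simp]: "X \<in> Sec \<Longrightarrow> ver X \<in> Sec"
  unfolding ver_def by (intro Sec_sum) simp

lemma ph_linear [simp]:
  "X \<in> Sec \<Longrightarrow> Y \<in> Sec \<Longrightarrow> ph (X + Y) = ph X + ph Y"
  "X \<in> Sec \<Longrightarrow> ph (smul f X) = smul f (ph X)"
  by (rule ext; simp only: ph_def smul_def plus_fun_apply phi_linear Sec_T)+

lemma ph_zero [simp]: "ph 0 = 0"
  by (rule ext) (simp only: ph_def zero_fun_apply phi_linear(3))

lemma ph_diff [simp]: "X \<in> Sec \<Longrightarrow> Y \<in> Sec \<Longrightarrow> ph (X - Y) = ph X - ph Y"
  using ph_linear(1)[of "X - Y" Y] by simp

lemma ph_minus [simp]: "X \<in> Sec \<Longrightarrow> ph (- X) = - ph X"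
  using ph_diff[of 0 X] by simp

lemma ph_xi [simp]:
  assumes "i \<in> I"
  shows "ph (xi i) = 0"
proof (rule Sec_eqI)
  show "ph (xi i) q = 0 q" if "q \<in> U" for q
    using that assms by (simp only: ph_def xi_apply phi_xi zero_fun_apply)
qed (use assms in simp_all)

lemma met_xi_xi: "i \<in> I \<Longrightarrow> j \<in> I \<Longrightarrow> q \<in> U \<Longrightarrow> met (xi i) (xi j) q = (if i = j then 1 else 0)"
  by (simp add: met_def xi_apply g_xi eta_xi)

lemma met_xi_ph [simp]:
  assumes "i \<in> I" "X \<in> Sec"
  shows "met (xi i) (ph X) = 0"
proof
  fix q
  show "met (xi i) (ph X) q = 0 q"
  proof (cases "q \<in> U")
    case True
    then show ?thesis
      using assms Sec_T[OF assms(2), of q] by (simp add: met_def ph_def xi_apply g_xi eta_phi)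
  next
    case False
    then show ?thesis
      using Sec_outside[OF xi_Sec[OF assms(1)] False] Sec_T[OF ph_Sec[OF assms(2)], of q]
      by (simp add: met_def)
  qed
qed

lemma met_xi_apply: "i \<in> I \<Longrightarrow> X \<in> Sec \<Longrightarrow> q \<in> U \<Longrightarrow> met (xi i) X q = \<eta> i q (X q)"
  using Sec_T[of X q] by (simp add: met_def xi_apply g_xi)

lemma ver_apply: "X \<in> Sec \<Longrightarrow> q \<in> U \<Longrightarrow> ver X q = (\<Sum>i\<in>I. \<eta> i q (X q) *\<^sub>R \<xi> i q)"
  unfolding ver_def sum_fun_apply[of _ _ q] by (intro sum.cong refl) (simp add: smul_def
      xi_apply met_xi_apply)

lemma ph_ph:
  assumes "X \<in> Sec"
  shows "ph (ph X) = ver X - X"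
proof (rule Sec_eqI)
  show "ph (ph X) q = (ver X - X) q" if q: "q \<in> U" for q
    using phi_phi[OF Sec_T[OF assms], of q] ver_apply[OF assms q] by (simp add: ph_def fun_eq_iff)
qed (use assms in simp_all)

lemma F_skew:
  assumes "X \<in> Sec" "Y \<in> Sec"
  shows "met (ph X) Y = - F X Y"
  using g_phi_skew[OF Sec_T[OF assms(1)] Sec_T[OF assms(2)]] by (simp add: met_def ph_def F_def
      fun_eq_iff)

lemma smooth_F [simp]: "X \<in> Sec \<Longrightarrow> Y \<in> Sec \<Longrightarrow> smooth (F X Y)"
  by (simp add: F_def)

lemma F_swap: "X \<in> Sec \<Longrightarrow> Y \<in> Sec \<Longrightarrow> F Y X = - F X Y"
  using F_skew[of X Y] met_sym[of "ph X" Y] by (simp add: F_def)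

lemma met_ph_ph:
  assumes "X \<in> Sec" "Y \<in> Sec"
  shows "met (ph X) (ph Y) = met X Y - (\<Sum>i\<in>I. met (xi i) X * met (xi i) Y)"
proof
  fix q
  show "met (ph X) (ph Y) q = (met X Y - (\<Sum>i\<in>I. met (xi i) X * met (xi i) Y)) q"
  proof (cases "q \<in> U")
    case True
    then show ?thesis
      using metric_phi[OF Sec_T[OF assms(1)] Sec_T[OF assms(2)], of q] assms
      by (simp add: sum_fun_apply met_xi_apply) (simp add: met_def ph_def)
  next
    case False
    have "met V W q = 0" if "V \<in> Sec" "W \<in> Sec" for V W
      using Sec_outside[OF that(1) False] Sec_T[OF that(2), of q] by (simp add: met_def)
    then show ?thesis
      using assms by (simp add: sum_fun_apply)
  qed
qed

lemma two_F:
  assumes "X \<in> Sec" "Y \<in> Sec" "i \<in> I"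
  shows "2 * F X Y = act X (met (xi i) Y) - act Y (met (xi i) X) - met (xi i) (bracket X Y)"
proof
  fix q
  show "(2 * F X Y) q = (act X (met (xi i) Y) - act Y (met (xi i) X) - met (xi i) (bracket X Y)) q"
  proof (cases "q \<in> U")
    case True
    have a: "V q (\<lambda>q. \<eta> i q (W q)) = act V (met (xi i) W) q" if "V \<in> Sec" "W \<in> Sec" for V W
      unfolding act_def using that assms(3)
      by (intro tangent_vector_cong[OF Sec_T[OF that(1)] open_U True]) (simp add: met_xi_apply)
    have "\<eta> i q (lie_bracket A X Y q) = met (xi i) (bracket X Y) q"
      using met_xi_apply[OF assms(3) bracket_Sec[OF assms(1,2)] True] True by (simp add:
          bracket_def cut_def)
    then show ?thesis
      using fundamental_form_eq[OF open_U Sec_vector_field[OF assms(1)] Sec_vector_field[OF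
          assms(2)] assms(3) True]
      by (simp add: exterior_deriv_def fundamental_form_def a assms F_def met_def ph_def)
  next
    case False
    have "met V W q = 0" if "V \<in> Sec" "W \<in> Sec" for V W
      using Sec_outside[OF that(1) False] Sec_T[OF that(2), of q] by (simp add: met_def)
    then show ?thesis
      using assms False Sec_outside[OF assms(1) False] Sec_outside[OF assms(2) False] by (simp
          add: act_def F_def)
  qed
qed

text \<open>Every \<open>d\<eta>\<^sub>i\<close> equals \<open>2F\<close>, so the sum in the
  normality condition collapses to \<open>2F \<otimes> xb\<close>. The torsion, too, sees the Reeb
  fields only through this sum.\<close>

definition xb :: "'a vfield" where "xb = (\<Sum>i\<in>I. xi i)"

lemma nijenhuis_Sec:
  assumes "X \<in> Sec" "Y \<in> Sec"
  shows "bracket (ph X) (ph Y) + ph (ph (bracket X Y)) - ph (bracket X (ph Y)) - ph (bracket (ph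
      X) Y)
    + smul (2 * F X Y) xb = 0"
proof (rule Sec_eqI)
  have xb: "xb \<in> Sec"
    unfolding xb_def by (rule Sec_sum) simp
  have "smooth (2 * F X Y)"
    unfolding mult_2 using assms by (intro smooth_add smooth_F)
  then show "bracket (ph X) (ph Y) + ph (ph (bracket X Y)) - ph (bracket X (ph Y)) - ph (bracket
      (ph X) Y)
    + smul (2 * F X Y) xb \<in> Sec"
    using assms xb by simp
  fix q
  assume q: "q \<in> U"
  have b: "bracket V W q = lie_bracket A V W q" for V W
    using q by (simp add: bracket_def cut_def)
  have "(\<Sum>i\<in>I. exterior_deriv A (\<eta> i) X Y q *\<^sub>R \<xi> i q) = (\<Sum>i\<in>I. (2 * F X Y) q *\<^sub>R \<xi> i q)"
    using fundamental_form_eq[OF open_U Sec_vector_field[OF assms(1)] Sec_vector_field[OF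
        assms(2)] _ q]
    by (intro sum.cong refl) (simp add: fundamental_form_def F_def met_def ph_def)
  also have "\<dots> = smul (2 * F X Y) xb q"
    using q by (simp add: smul_def xb_def sum_fun_apply xi_apply scaleR_sum_right)
  finally show "(bracket (ph X) (ph Y) + ph (ph (bracket X Y)) - ph (bracket X (ph Y)) - ph
      (bracket (ph X) Y)
    + smul (2 * F X Y) xb) q = 0 q"
    using normality[OF open_U Sec_vector_field[OF assms(1)] Sec_vector_field[OF assms(2)] q]
    by (simp only: nijenhuis_def plus_fun_apply fun_diff_def ph_def b zero_fun_apply) 
qed simp

lemma smooth_sum [simp]: "(\<And>i. i \<in> J \<Longrightarrow> smooth (f i)) \<Longrightarrow> smooth (\<Sum>i\<in>J. f i)"
  using smooth_fun_sum[OF open_U, of J f] by (simp add: sum_fun_apply[abs_def] cong: sum.cong)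

lemma act_sum:
  assumes X: "X \<in> Sec" and f: "\<And>i. i \<in> J \<Longrightarrow> smooth (f i)"
  shows "act X (\<Sum>i\<in>J. f i) = (\<Sum>i\<in>J. act X (f i))"
  using f
proof (induction J rule: infinite_finite_induct)
  case (insert i J)
  have "act X (f i + (\<Sum>i\<in>J. f i)) = act X (f i) + act X (\<Sum>i\<in>J. f i)"
    using insert.prems by (intro act_add X smooth_sum) auto
  moreover have "act X (\<Sum>i\<in>J. f i) = (\<Sum>i\<in>J. act X (f i))"
    using insert.prems by (intro insert.IH) auto
  ultimately show ?case
    by (simp only: sum.insert[OF insert.hyps])
qed (use X in simp_all)

lemma act_met_xi_xi: "X \<in> Sec \<Longrightarrow> i \<in> I \<Longrightarrow> j \<in> I \<Longrightarrow> act X (met (xi i) (xi j)) = 0"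
  by (intro act_locally_const[where r = "if i = j then 1 else 0"]) (simp_all add: met_xi_xi)

lemma F_xi [simp]: "i \<in> I \<Longrightarrow> X \<in> Sec \<Longrightarrow> F (xi i) X = 0" "i \<in> I \<Longrightarrow> X \<in> Sec \<Longrightarrow> F X (xi i) = 0"
  by (simp_all add: F_def)

lemma F_linear [simp]:
  "X \<in> Sec \<Longrightarrow> Y \<in> Sec \<Longrightarrow> Z \<in> Sec \<Longrightarrow> F (X + Y) Z = F X Z + F Y Z"
  "X \<in> Sec \<Longrightarrow> Y \<in> Sec \<Longrightarrow> Z \<in> Sec \<Longrightarrow> F (X - Y) Z = F X Z - F Y Z"
  "X \<in> Sec \<Longrightarrow> Z \<in> Sec \<Longrightarrow> F (- X) Z = - F X Z"
  "X \<in> Sec \<Longrightarrow> Y \<in> Sec \<Longrightarrow> Z \<in> Sec \<Longrightarrow> F Z (X + Y) = F Z X + F Z Y"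
  "X \<in> Sec \<Longrightarrow> Y \<in> Sec \<Longrightarrow> Z \<in> Sec \<Longrightarrow> F Z (X - Y) = F Z X - F Z Y"
  "X \<in> Sec \<Longrightarrow> Z \<in> Sec \<Longrightarrow> F Z (- X) = - F Z X"
  by (simp_all add: F_def)

lemma one_in_I: "1 \<in> I"
  using s_pos by simp

text \<open>\<open>dF = 0\<close> because \<open>2F = d\<eta>\<^sub>1\<close> is exact.\<close>

lemma F_closed:
  assumes XYZ: "X \<in> Sec" "Y \<in> Sec" "Z \<in> Sec"
  shows "act X (F Y Z) + act Y (F Z X) + act Z (F X Y)
    - F (bracket X Y) Z - F (bracket Y Z) X - F (bracket Z X) Y = 0" (is "?L = 0")
proof -
  let ?h = "met (xi 1)"
  have h: "smooth (?h V)" if "V \<in> Sec" for V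
    using that one_in_I by simp
  have act2: "2 * act V f = act V (2 * f)" if "V \<in> Sec" "smooth f" for V f
    unfolding mult_2 by (rule act_add[OF that(1,2,2), symmetric])
  have F2: "2 * F V W = act V (?h W) - act W (?h V) - ?h (bracket V W)" if "V \<in> Sec" "W \<in> Sec"
      for V W
    using two_F[OF that one_in_I] .
  have F3: "2 * F (bracket V W) Z = act V (act W (?h Z)) - act W (act V (?h Z)) - act Z (?h
      (bracket V W))
      - ?h (bracket (bracket V W) Z)" if "V \<in> Sec" "W \<in> Sec" "Z \<in> Sec" for V W Z
    using that h by (simp add: F2 act_bracket)
  have "?h (bracket X (bracket Y Z) + bracket Y (bracket Z X) + bracket Z (bracket X Y)) = 0"
    using jacobi[OF XYZ] one_in_I by simp
  then have J: "?h (bracket X (bracket Y Z)) + ?h (bracket Y (bracket Z X)) + ?h (bracket Z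
      (bracket X Y)) = 0"
    using XYZ one_in_I by simp
  \<comment> \<open>After doubling, each \<open>F\<close> can be replaced by \<open>two_F\<close>.
    The second derivatives then cancel in pairs and the nested brackets add up to the Jacobi sum
    \<open>J\<close>.\<close>
  have "2 * ?L = act X (2 * F Y Z) + act Y (2 * F Z X) + act Z (2 * F X Y)
    - 2 * F (bracket X Y) Z - 2 * F (bracket Y Z) X - 2 * F (bracket Z X) Y"
    using XYZ by (simp add: act2[symmetric] algebra_simps)
  also have "\<dots> = 0"
    using XYZ h J one_in_I bracket_skew[of X "bracket Y Z"] bracket_skew[of Y "bracket Z X"]
      bracket_skew[of Z "bracket X Y"]
    by (simp add: F2[of X Y] F2[of Y Z] F2[of Z X] F3 algebra_simps)
  finally have two: "2 * ?L = 0" .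
  show ?thesis
  proof
    fix q
    show "?L q = 0 q"
      using fun_cong[OF two, of q] by simp
  qed
qed

subsection \<open>The Reeb fields are Killing\<close>

text \<open>The Lie derivative of \<open>\<eta> j\<close> along \<open>\<xi> i\<close> is zero:
  \<open>2F\<close>, which is the exterior derivative of \<open>\<eta> j\<close>, vanishes on
  \<open>\<xi> i\<close>, and \<open>\<eta> j\<close> is constant on \<open>\<xi> i\<close>.\<close>

lemma act_xi_met_xi:
  assumes "i \<in> I" "j \<in> I" "X \<in> Sec"
  shows "act (xi i) (met (xi j) X) = met (xi j) (bracket (xi i) X)"
  using two_F[of "xi i" X j] assms by (simp add: act_met_xi_xi)

lemma ver_eq_0: "(\<And>i. i \<in> I \<Longrightarrow> met (xi i) X = 0) \<Longrightarrow> ver X = 0"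
  by (simp add: ver_def)

text \<open>By \<open>ph_ph\<close> a section in the kernel of \<open>ph\<close> equals its vertical
  projection.\<close>

lemma eq_0I:
  assumes "X \<in> Sec" "ph X = 0" "\<And>i. i \<in> I \<Longrightarrow> met (xi i) X = 0"
  shows "X = 0"
  using ph_ph[OF assms(1)] assms(2) ver_eq_0[OF assms(3)] by simp

text \<open>Normality with \<open>xi i\<close> in the first slot shows only that \<open>ph\<close>
  kills the difference of the two sides. The Reeb components of the difference vanish separately, by
  \<open>act_xi_met_xi\<close>. In other words, the Lie derivative of \<open>\<phi>\<close> along
  \<open>\<xi> i\<close> is zero.\<close>

lemma bracket_xi_ph:
  assumes i: "i \<in> I" and X: "X \<in> Sec"
  shows "bracket (xi i) (ph X) = ph (bracket (xi i) X)"
proof -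
  let ?W = "bracket (xi i) (ph X) - ph (bracket (xi i) X)"
  have W: "?W \<in> Sec"
    using assms by simp
  have "bracket (xi i) 0 = 0"
    using assms by (simp add: bracket_eq)
  then have "ph ?W = 0"
    using nijenhuis_Sec[OF xi_Sec[OF i] X] assms by (simp add: bracket_eq) 
  moreover have "met (xi j) ?W = 0" if j: "j \<in> I" for j
    using act_xi_met_xi[OF i j, of "ph X"] assms j by simp
  ultimately show ?thesis
    using eq_0I[OF W] by simp
qed

text \<open>Cartan's formula: the exterior derivative of \<open>F\<close> and its contraction with
  \<open>xi i\<close> both vanish.\<close>

lemma lie_xi_F:
  assumes i: "i \<in> I" and Y: "Y \<in> Sec" and Z: "Z \<in> Sec"
  shows "act (xi i) (F Y Z) = F (bracket (xi i) Y) Z + F Y (bracket (xi i) Z)"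
  using F_closed[OF xi_Sec[OF i] Y Z] assms bracket_skew[of "xi i" Z] F_swap[of "bracket (xi i)
      Z" Y]
  by (simp add: algebra_simps)

text \<open>The metric is rebuilt from tensors already known to be invariant along
  \<open>xi i\<close>: \<open>g(Y, Z) = F(\<phi>Y, Z) + \<Sum>\<^sub>j \<eta>\<^sub>j(Y)
  \<eta>\<^sub>j(Z)\<close>.\<close>

lemma xi_killing:
  assumes i: "i \<in> I" and Y: "Y \<in> Sec" and Z: "Z \<in> Sec"
  shows "act (xi i) (met Y Z) = met (bracket (xi i) Y) Z + met Y (bracket (xi i) Z)"
proof -
  let ?S = "\<lambda>Y Z. \<Sum>j\<in>I. met (xi j) Y * met (xi j) Z"
  have "smooth (?S Y Z)"
    using Y Z by (intro smooth_sum smooth_mult smooth_met xi_Sec) simp_all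
  note act_S = this act_sum[OF xi_Sec[OF i], of I "\<lambda>j. met (xi j) Y * met (xi j) Z"]
  have "act (xi i) (met Y Z) = act (xi i) (F (ph Y) Z + ?S Y Z)"
    using met_ph_ph[OF Y Z] by (simp add: F_def)
  also have "\<dots> = act (xi i) (F (ph Y) Z) + (\<Sum>j\<in>I. act (xi i) (met (xi j) Y * met (xi j) Z))"
    using act_S i Y Z act_add[OF xi_Sec[OF i] smooth_F[OF ph_Sec[OF Y] Z], of "?S Y Z"] by simp
  also have "act (xi i) (F (ph Y) Z) = met (ph (bracket (xi i) Y)) (ph Z) + met (ph Y) (ph
      (bracket (xi i) Z))"
    using lie_xi_F[OF i ph_Sec[OF Y] Z] assms by (simp add: bracket_xi_ph F_def)
  also have "(\<Sum>j\<in>I. act (xi i) (met (xi j) Y * met (xi j) Z)) =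
      ?S (bracket (xi i) Y) Z + ?S Y (bracket (xi i) Z)"
    using i Y Z by (simp add: act_xi_met_xi sum.distrib)
  finally show ?thesis
    using i Y Z by (simp only: met_ph_ph[OF bracket_Sec[OF xi_Sec[OF i] Y] Z] met_ph_ph[OF Y
        bracket_Sec[OF xi_Sec[OF i] Z]])
      (simp add: fun_eq_iff)
qed

text \<open>For a Killing field the form \<open>g(\<nabla>\<^sup>g\<^sub>Y \<xi>\<^sub>i, Z)\<close>
  is skew in \<open>Y\<close> and \<open>Z\<close>, so \<open>d\<eta>\<^sub>i\<close> is twice this
  form. As \<open>d\<eta>\<^sub>i = 2F\<close>, the form is
  \<open>F(Y, Z) = - g(\<phi>Y, Z)\<close>.\<close>

lemma Dg_xi:
  assumes i: "i \<in> I" and Y: "Y \<in> Sec"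
  shows "nab Dg Y (xi i) = - ph Y"
proof (rule met_eqI)
  fix Z
  assume Z: "Z \<in> Sec"
  have 1: "met (nab Dg Y (xi i)) Z + met Y (nab Dg Z (xi i)) = 0"
    using xi_killing[OF assms Z] act_met[OF xi_Sec[OF i] Y Z] assms Z
    by (simp add: bracket_eq algebra_simps)
  have 2: "met Y (nab Dg Z (xi i)) = met (nab Dg Z (xi i)) Y"
    using assms Z by (intro met_sym) simp_all
  have 3: "2 * F Y Z = met (nab Dg Y (xi i)) Z - met (nab Dg Z (xi i)) Y"
    using two_F[OF Y Z i] assms Z act_met[OF Y xi_Sec[OF i] Z] act_met[OF Z xi_Sec[OF i] Y]
    by (simp add: bracket_eq algebra_simps)
  have "F Y Z = met (nab Dg Y (xi i)) Z"
  proof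
    fix q
    show "F Y Z q = met (nab Dg Y (xi i)) Z q"
      using fun_cong[OF 1, of q] fun_cong[OF 2, of q] fun_cong[OF 3, of q] by simp
  qed
  then show "met (nab Dg Y (xi i)) Z = met (- ph Y) Z"
    using F_skew[OF Y Z] Y Z by simp
qed (use assms in simp_all)

subsection \<open>The characteristic connection\<close>

lemma xb_Sec [simp]: "xb \<in> Sec"
  unfolding xb_def by (rule Sec_sum) simp

lemma met_xb: "X \<in> Sec \<Longrightarrow> met xb X = (\<Sum>i\<in>I. met (xi i) X)"
proof
  fix q
  assume X: "X \<in> Sec"
  show "met xb X q = (\<Sum>i\<in>I. met (xi i) X) q"
    unfolding met_def xb_def sum_fun_apply[of _ _ q] sum_fun_apply[of "\<lambda>i q. g q (xi i q) (X q)"]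
    by (rule g_sum_left[OF Sec_T[OF xi_Sec] Sec_T[OF X]])
qed

lemma ph_sum: "(\<And>i. i \<in> J \<Longrightarrow> X i \<in> Sec) \<Longrightarrow> ph (\<Sum>i\<in>J. X i) = (\<Sum>i\<in>J. ph (X i))"
  by (induction J rule: infinite_finite_induct) simp_all

lemma ph_xb [simp]: "ph xb = 0"
  unfolding xb_def by (subst ph_sum) simp_all

lemma met_xb_ph [simp]: "X \<in> Sec \<Longrightarrow> met xb (ph X) = 0"
  by (simp add: met_xb)

lemma met_ph_xb [simp]: "X \<in> Sec \<Longrightarrow> met (ph X) xb = 0"
  using met_sym[of "ph X" xb] by simp

lemma F_xb [simp]: "X \<in> Sec \<Longrightarrow> F xb X = 0"
  by (simp add: F_def)

lemma met_xb_xi: "i \<in> I \<Longrightarrow> q \<in> U \<Longrightarrow> met xb (xi i) q = 1"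
  by (simp add: met_xb sum_fun_apply met_xi_xi)

lemma met_xb_xb: "q \<in> U \<Longrightarrow> met xb xb q = real s"
proof -
  assume q: "q \<in> U"
  have "met xb xb q = (\<Sum>i\<in>I. met xb (xi i) q)"
    using met_xb[OF xb_Sec] met_sym[OF xb_Sec xi_Sec] by (simp add: sum_fun_apply)
  then show ?thesis
    using q by (simp add: met_xb_xi)
qed

text \<open>Half of the torsion \<open>T\<close>, so that \<open>D = Dg + tor\<close> on
  sections.\<close>

definition tor :: "'a vfield \<Rightarrow> 'a vfield \<Rightarrow> 'a vfield"
  where "tor X Y = smul (F X Y) xb - smul (met xb X) (ph Y) + smul (met xb Y) (ph X)"

lemma tor_Sec [simp]: "X \<in> Sec \<Longrightarrow> Y \<in> Sec \<Longrightarrow> tor X Y \<in> Sec"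
  by (simp add: tor_def)

lemma tor_linear [simp]:
  "X \<in> Sec \<Longrightarrow> Y \<in> Sec \<Longrightarrow> Z \<in> Sec \<Longrightarrow> tor (X + Y) Z = tor X Z + tor Y Z"
  "X \<in> Sec \<Longrightarrow> Y \<in> Sec \<Longrightarrow> Z \<in> Sec \<Longrightarrow> tor Z (X + Y) = tor Z X + tor Z Y"
  "X \<in> Sec \<Longrightarrow> Y \<in> Sec \<Longrightarrow> Z \<in> Sec \<Longrightarrow> tor (X - Y) Z = tor X Z - tor Y Z"
  "X \<in> Sec \<Longrightarrow> Y \<in> Sec \<Longrightarrow> Z \<in> Sec \<Longrightarrow> tor Z (X - Y) = tor Z X - tor Z Y"
  by (simp_all add: tor_def algebra_simps)

lemma tor_skew: "X \<in> Sec \<Longrightarrow> Y \<in> Sec \<Longrightarrow> tor Y X = - tor X Y"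
  by (simp add: tor_def F_swap[of X Y])

text \<open>The cyclic form makes the total skew-symmetry visible: this is the wedge product of
  \<open>F\<close> with the 1-form dual to \<open>xb\<close>.\<close>

lemma met_tor:
  assumes "X \<in> Sec" "Y \<in> Sec" "Z \<in> Sec"
  shows "met (tor X Y) Z = F X Y * met xb Z + F Y Z * met xb X + F Z X * met xb Y"
  using assms by (simp add: tor_def F_skew F_swap[of X Z] fun_eq_iff)

lemma met_tor_skew: "X \<in> Sec \<Longrightarrow> Y \<in> Sec \<Longrightarrow> Z \<in> Sec \<Longrightarrow> met Y (tor X Z) = - met (tor X Y) Z"
  using met_sym[of Y "tor X Z"] F_swap[of X Y] F_swap[of Y Z] F_swap[of X Z]
  by (simp add: met_tor fun_eq_iff)

abbreviation D :: "'a vfield \<Rightarrow> 'a vfield \<Rightarrow> 'a vfield"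
  where "D \<equiv> characteristic_connection s \<phi> \<xi> \<eta> g Dg"

lemma half_torsion_apply:
  assumes u: "u \<in> T p" and v: "v \<in> T p"
  shows "(1/2) *\<^sub>R characteristic_torsion s \<phi> \<xi> \<eta> g p u v =
    g p u (\<phi> p v) *\<^sub>R (\<Sum>i\<in>I. \<xi> i p) - g p (\<Sum>i\<in>I. \<xi> i p) u *\<^sub>R \<phi> p v + g p (\<Sum>i\<in>I. \<xi> i p) v *\<^sub>R \<phi> p u"
proof -
  have g: "g p (\<Sum>i\<in>I. \<xi> i p) w = (\<Sum>i\<in>I. \<eta> i p w)" if "w \<in> T p" for w
    using that by (subst g_sum_left) (simp_all add: g_xi)
  show ?thesis
    unfolding characteristic_torsion_def fundamental_form_def g[OF u] g[OF v]
    by (simp add: sum.distrib sum_subtractf scaleR_sum_left scaleR_sum_right)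
qed

lemma D_apply:
  assumes "X \<in> Sec" "Y \<in> Sec" "q \<in> U"
  shows "D X Y q = Dg X Y q + tor X Y q"
proof -
  have xb: "xb q = (\<Sum>i\<in>I. \<xi> i q)"
    unfolding xb_def sum_fun_apply[of _ _ q] using assms(3) by (intro sum.cong refl) (simp only:
        xi_apply)
  have "tor X Y q = F X Y q *\<^sub>R xb q - met xb X q *\<^sub>R ph Y q + met xb Y q *\<^sub>R ph X q"
    by (simp only: tor_def smul_def plus_fun_apply fun_diff_def)
  then show ?thesis
    unfolding characteristic_connection_def half_torsion_apply[OF Sec_T[OF assms(1)] Sec_T[OF
        assms(2)]]
    by (simp only: F_def met_def ph_def xb)
qed

text \<open>The axioms range over every open set and over fields that need not vanish outside it.
  Additivity and the Leibniz rule are checked pointwise from the bilinearity of \<open>h\<close>,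
  the difference of \<open>D\<close> and \<open>Dg\<close>; smoothness comes from sections over the
  given set.\<close>

lemma affine_D [simp]: "affine_connection A D"
proof -
  define h where "h p u v = g p u (\<phi> p v) *\<^sub>R (\<Sum>i\<in>I. \<xi> i p) - g p (\<Sum>i\<in>I. \<xi> i p) u *\<^sub>R \<phi> p v
    + g p (\<Sum>i\<in>I. \<xi> i p) v *\<^sub>R \<phi> p u" for p u v
  have Dh: "D X Y p = Dg X Y p + h p (X p) (Y p)" if "X p \<in> T p" "Y p \<in> T p" for X Y p
    unfolding characteristic_connection_def h_def half_torsion_apply[OF that] ..
  have xbT: "(\<Sum>i\<in>I. \<xi> i p) \<in> T p" for p
    by (intro T_sum xi_T)
  have h_add: "h p (u + u') v = h p u v + h p u' v" "h p v (u + u') = h p v u + h p v u'"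
    if "u \<in> T p" "u' \<in> T p" "v \<in> T p" for p u u' v
    using that xbT[of p] by (simp_all add: h_def scaleR_left_distrib scaleR_right_distrib del:
        fun_eq_iff)
  have h_scale: "h p (r *\<^sub>R u) v = r *\<^sub>R h p u v" "h p v (r *\<^sub>R u) = r *\<^sub>R h p v u"
    if "u \<in> T p" "v \<in> T p" for p u v r
    using that xbT[of p] by (simp_all add: h_def scaleR_right_distrib scaleR_right_diff_distrib
        mult_ac)
  have "D X Y \<in> vector_fields A V" if V: "open V" and X: "X \<in> vector_fields A V" and Y: "Y \<in>
      vector_fields A V" for V X Y
  proof -
    \<comment> \<open>\<open>V\<close> is unrelated to \<open>U\<close>, so a new instance of the
      locale provides \<open>tor\<close> as a section over \<open>V\<close>.\<close>
    interpret W: S_sections A n s \<phi> \<xi> \<eta> g Dg V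
      using V levi_civita by unfold_locales
    have XY: "W.cut X \<in> W.Sec" "W.cut Y \<in> W.Sec"
      using X Y W.cut_Sec by blast+
    have "D X Y q = D (W.cut X) (W.cut Y) q" if q: "q \<in> V" for q
    proof -
      have "Dg X Y q = Dg (W.cut X) (W.cut Y) q"
        by (rule connection_local[OF affine_Dg V q X W.Sec_vector_field[OF XY(1)] _ Y
            W.Sec_vector_field[OF XY(2)]])
          (simp_all add: W.cut_def)
      then show ?thesis
        using q by (simp add: characteristic_connection_def W.cut_def[where q = q])
    qed
    then have "(\<lambda>q. Dg (W.cut X) (W.cut Y) q + W.tor (W.cut X) (W.cut Y) q) q = D X Y q" if "q \<in>
        V" for q
      using W.D_apply[OF XY that] that by simp
    moreover have "(\<lambda>q. Dg (W.cut X) (W.cut Y) q + W.tor (W.cut X) (W.cut Y) q) \<in> vector_fields A V"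
      using XY by (intro vector_fields_add connection_closed[OF affine_Dg V] W.Sec_vector_field
          W.tor_Sec)
    ultimately show ?thesis
      using vector_fields_cong by blast
  qed
  moreover have "D (X + X') Y p = D X Y p + D X' Y p \<and> D Y (X + X') p = D Y X p + D Y X' p"
    if V: "open V" and X: "X \<in> vector_fields A V" and X': "X' \<in> vector_fields A V"
      and Y: "Y \<in> vector_fields A V" and p: "p \<in> V" for V X X' Y p
  proof -
    note T = vector_fields_in_tangent_space[OF X p] vector_fields_in_tangent_space[OF X' p]
      vector_fields_in_tangent_space[OF Y p]
    have "(X + X') p \<in> T p"
      using T by simp
    then have "D (X + X') Y p = Dg (X + X') Y p + h p (X p + X' p) (Y p)"
      "D Y (X + X') p = Dg Y (X + X') p + h p (Y p) (X p + X' p)"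
      using Dh[of "X + X'" p Y] Dh[of Y p "X + X'"] T by (simp_all only: plus_fun_apply)
    then show ?thesis
      unfolding connection_add[OF affine_Dg V X X' Y p] h_add[OF T] Dh[of X p Y, OF T(1,3)]
          Dh[of X' p Y, OF T(2,3)]
        Dh[of Y p X, OF T(3,1)] Dh[of Y p X', OF T(3,2)]
      by (simp only: add_ac)
  qed
  moreover have "D (\<lambda>q. f q *\<^sub>R X q) Y p = f p *\<^sub>R D X Y p \<and>
      D X (\<lambda>q. f q *\<^sub>R Y q) p = X p f *\<^sub>R Y p + f p *\<^sub>R D X Y p"
    if V: "open V" and f: "smooth_fun A V f" and X: "X \<in> vector_fields A V"
      and Y: "Y \<in> vector_fields A V" and p: "p \<in> V" for V f X Y p
  proof -
    note T = vector_fields_in_tangent_space[OF X p] vector_fields_in_tangent_space[OF Y p]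
    have "D (\<lambda>q. f q *\<^sub>R X q) Y p = Dg (\<lambda>q. f q *\<^sub>R X q) Y p + h p (f p *\<^sub>R X p) (Y p)"
      "D X (\<lambda>q. f q *\<^sub>R Y q) p = Dg X (\<lambda>q. f q *\<^sub>R Y q) p + h p (X p) (f p *\<^sub>R Y p)"
      using T by (intro Dh; simp)+
    then show ?thesis
      unfolding connection_scale[OF affine_Dg V X Y f p] h_scale[OF T] h_scale[OF T(2,1)] Dh[of
          X p Y, OF T]
      by (simp only: scaleR_right_distrib add_ac simp_thms)
  qed
  ultimately show ?thesis
    unfolding affine_connection_def by simp
qed

lemma nab_D:
  assumes "X \<in> Sec" "Y \<in> Sec"
  shows "nab D X Y = nab Dg X Y + tor X Y"
proof (rule Sec_eqI)
  show "nab D X Y q = (nab Dg X Y + tor X Y) q" if "q \<in> U" for q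
    using D_apply[OF assms that] that by (simp add: nab_apply fun_eq_iff)
qed (use assms in simp_all)

text \<open>Since \<open>g(xb, \<xi>\<^sub>i) = 1\<close>, the term \<open>tor X (xi i)\<close> is
  \<open>ph X\<close> and cancels the value from \<open>Dg_xi\<close>. The product is 1 only on
  \<open>U\<close>, hence the comparison at points of \<open>U\<close>.\<close>

lemma nab_D_xi [simp]:
  assumes i: "i \<in> I" and X: "X \<in> Sec"
  shows "nab D X (xi i) = 0"
proof (rule Sec_eqI)
  show "nab D X (xi i) q = 0 q" if "q \<in> U" for q
    using assms met_xb_xi[OF i that] by (simp add: nab_D Dg_xi tor_def smul_def fun_eq_iff)
qed (use assms in simp_all)

lemma nab_D_xb [simp]: "X \<in> Sec \<Longrightarrow> nab D X xb = 0"
  unfolding xb_def by (subst nab_sum_right) simp_all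

lemma metric_connection_D: "metric_connection D"
  unfolding metric_connection_def
proof (intro ballI)
  fix X Y Z
  assume XYZ: "X \<in> Sec" "Y \<in> Sec" "Z \<in> Sec"
  then show "act X (met Y Z) = met (nab D X Y) Z + met Y (nab D X Z)"
    using met_tor_skew[OF XYZ] by (simp add: nab_D act_met)
qed

lemma act_met_D:
  "X \<in> Sec \<Longrightarrow> Y \<in> Sec \<Longrightarrow> Z \<in> Sec \<Longrightarrow> act X (met Y Z) = met (nab D X Y) Z + met Y (nab D X Z)"
  using metric_connection_D unfolding metric_connection_def by blast

text \<open>\<open>Dg\<close> is torsion-free, so the torsion of \<open>D\<close> is twice
  \<open>tor\<close>, kept here as two subtractions.\<close>

lemma bracket_D:
  assumes "X \<in> Sec" "Y \<in> Sec"
  shows "bracket X Y = nab D X Y - nab D Y X - tor X Y - tor X Y"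
  using assms tor_skew[OF assms] by (simp add: nab_D bracket_eq)

subsection \<open>The structure tensors are parallel\<close>

text \<open>The simplifier rewrites \<open>X + X\<close> to \<open>2 * X\<close> in the function ring, hence these rules.\<close>

lemma two_times [simp]:
  "X \<in> Sec \<Longrightarrow> 2 * X \<in> Sec" "X \<in> Sec \<Longrightarrow> ph (2 * X) = 2 * ph X"
  "X \<in> Sec \<Longrightarrow> Z \<in> Sec \<Longrightarrow> F (2 * X) Z = 2 * F X Z"
  "X \<in> Sec \<Longrightarrow> Z \<in> Sec \<Longrightarrow> tor (2 * X) Z = 2 * tor X Z"
  unfolding mult_2 by (rule Sec_add ph_linear(1) F_linear(1) tor_linear(1); assumption)+

text \<open>The covariant derivative \<open>(\<nabla>\<^sub>X \<phi>) Z\<close>.\<close>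

definition nph :: "'a vfield \<Rightarrow> 'a vfield \<Rightarrow> 'a vfield"
  where "nph X Z = nab D X (ph Z) - ph (nab D X Z)"

lemma nph_Sec [simp]: "X \<in> Sec \<Longrightarrow> Z \<in> Sec \<Longrightarrow> nph X Z \<in> Sec"
  by (simp add: nph_def)

lemma nab_D_ph: "nab D X (ph Z) = nph X Z + ph (nab D X Z)"
  by (simp add: nph_def)

text \<open>Differentiate the skew-adjointness of \<open>\<phi>\<close> with the metric connection
  \<open>D\<close>.\<close>

lemma nph_skew:
  assumes "X \<in> Sec" "Y \<in> Sec" "Z \<in> Sec"
  shows "met Z (nph X Y) = - met Y (nph X Z)"
proof
  fix q
  have "act X (met (ph Y) Z) = - act X (met Y (ph Z))"
    using F_skew[of Y Z] assms by (simp add: F_def)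
  then have "met (nab D X (ph Y)) Z + met (ph Y) (nab D X Z)
      = - (met (nab D X Y) (ph Z) + met Y (nab D X (ph Z)))"
    using assms by (simp add: act_met_D)
  then have "met (nph X Y) Z + met (ph (nab D X Y)) Z + met (ph Y) (nab D X Z)
      = - (met (nab D X Y) (ph Z) + met Y (nph X Z) + met Y (ph (nab D X Z)))"
    using assms by (simp add: nab_D_ph add.assoc)
  from fun_cong[OF this, of q] show "met Z (nph X Y) q = (- met Y (nph X Z)) q"
    using assms met_sym[of Z "nph X Y"] F_skew[of "nab D X Y" Z] F_skew[of Y "nab D X Z"]
    by (simp add: F_def)
qed

lemma nab_D_ver:
  assumes X: "X \<in> Sec" and Z: "Z \<in> Sec"
  shows "nab D X (ver Z) = ver (nab D X Z)"
proof -
  have "nab D X (ver Z) = (\<Sum>i\<in>I. nab D X (smul (met (xi i) Z) (xi i)))"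
    unfolding ver_def using assms by (intro nab_sum_right) simp_all
  also have "\<dots> = ver (nab D X Z)"
    unfolding ver_def using assms by (intro sum.cong refl) (simp add: act_met_D)
  finally show ?thesis .
qed

text \<open>Differentiate \<open>ph_ph\<close>: the identity and the vertical projection are both
  parallel.\<close>

lemma nph_ph:
  assumes X: "X \<in> Sec" and Z: "Z \<in> Sec"
  shows "nph X (ph Z) = - ph (nph X Z)"
  unfolding nph_def using assms
  by (simp add: ph_ph nab_D_ver)

lemma nph_xi: "i \<in> I \<Longrightarrow> X \<in> Sec \<Longrightarrow> nph X (xi i) = 0"
  by (simp add: nph_def)

text \<open>In \<open>F (tor X Y) Z\<close> the \<open>xb\<close> part drops out. The rest consists
  of factors \<open>met xb\<close> times values of the symmetric form
  \<open>g(\<phi>Y, \<phi>Z)\<close>, with signs that cancel pairwise in the cyclic sum.\<close>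

lemma tor_F_cyclic:
  assumes "X \<in> Sec" "Y \<in> Sec" "Z \<in> Sec"
  shows "F (tor X Y) Z + F (tor Y Z) X + F (tor Z X) Y = 0"
proof -
  have *: "F (tor X Y) Z = - met xb X * met (ph Y) (ph Z) + met xb Y * met (ph X) (ph Z)"
    if "X \<in> Sec" "Y \<in> Sec" "Z \<in> Sec" for X Y Z
    using that by (simp add: F_def tor_def)
  show ?thesis
    using assms met_sym[of "ph X" "ph Y"] met_sym[of "ph X" "ph Z"] met_sym[of "ph Y" "ph Z"]
    by (simp add: *)
qed

text \<open>This is \<open>dF = 0\<close> with the brackets expressed through \<open>D\<close>. The
  torsion goes by \<open>tor_F_cyclic\<close>, terms that differentiate an argument cancel, and only
  derivatives of \<open>\<phi>\<close> survive.\<close>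

lemma nph_cyclic:
  assumes X: "X \<in> Sec" and Y: "Y \<in> Sec" and Z: "Z \<in> Sec"
  shows "met Y (nph X Z) q + met Z (nph Y X) q + met X (nph Z Y) q = 0"
proof -
  have actF: "act X (F Y Z) = F (nab D X Y) Z + met Y (nph X Z) + F Y (nab D X Z)"
    if "X \<in> Sec" "Y \<in> Sec" "Z \<in> Sec" for X Y Z
    using that by (simp add: F_def act_met_D nab_D_ph)
  have Fbr: "F (bracket X Y) Z = F (nab D X Y) Z - F (nab D Y X) Z - F (tor X Y) Z - F (tor X Y) Z"
    if "X \<in> Sec" "Y \<in> Sec" "Z \<in> Sec" for X Y Z
    using that by (simp add: bracket_D)
  show ?thesis
    using fun_cong[OF F_closed[OF X Y Z], of q] fun_cong[OF tor_F_cyclic[OF X Y Z], of q] X Y Z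
      F_swap[of "nab D X Y" Z] F_swap[of "nab D X Z" Y] F_swap[of "nab D Y X" Z] F_swap[of "nab
          D Y Z" X]
      F_swap[of "nab D Z X" Y] F_swap[of "nab D Z Y" X]
    by (simp add: actF Fbr)
qed

text \<open>The torsion terms cancel from the normality condition, which leaves a Kaehler-type identity.\<close>

lemma nph_nijenhuis:
  assumes X: "X \<in> Sec" and Y: "Y \<in> Sec"
  shows "nph (ph X) Y - nph (ph Y) X + ph (nph Y X) - ph (nph X Y) = 0"
proof -
  \<comment> \<open>Doubled by \<open>bracket_D\<close>, this cancels the term
    \<open>smul (2 * F X Y) xb\<close> of normality; fact \<open>2\<close> cancels the torsion of
    the other three brackets.\<close>
  have 1: "tor (ph X) (ph Y) = smul (F X Y) xb"
  proof -
    have "met (xi i) X * met (xi i) (ph Y) = 0" if "i \<in> I" for i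
      using that Y by simp
    then have "F (ph X) (ph Y) = F X Y"
      using met_ph_ph[OF X ph_Sec[OF Y]] by (simp add: F_def)
    then show ?thesis
      using assms by (simp add: tor_def)
  qed
  have 2: "ph (ph (tor X Y)) = ph (tor X (ph Y)) + ph (tor (ph X) Y)"
    using assms by (simp add: tor_def)
  have 3: "smul (2 * F X Y) xb = smul (F X Y) xb + smul (F X Y) xb"
    by (simp add: smul_def fun_eq_iff)
  show ?thesis
    using nijenhuis_Sec[OF X Y] X Y unfolding 3
    by (simp add: bracket_D nab_D_ph 1 2 algebra_simps)
qed

text \<open>The Kaehler argument for \<open>B(X, Y, Z) = g(Y, (\<nabla>\<^sub>X \<phi>) Z)\<close>
  gives \<open>nph X (ph Y) = 0\<close>. By \<open>nph_ph\<close> then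
  \<open>ph (nph X Y) = 0\<close>, and the Reeb components vanish by \<open>nph_skew\<close> and
  \<open>nph_xi\<close>.\<close>

lemma nph_zero:
  assumes X: "X \<in> Sec" and Y: "Y \<in> Sec"
  shows "nph X Y = 0"
proof -
  define B where "B X Y Z q = met Y (nph X Z) q" for X Y Z q
  have skew: "B X Z Y q = - B X Y Z q" if "X \<in> Sec" "Y \<in> Sec" "Z \<in> Sec" for X Y Z q
    using nph_skew[OF that] by (simp add: B_def)
  have cyc: "B X Y Z q + B Y Z X q + B Z X Y q = 0" if "X \<in> Sec" "Y \<in> Sec" "Z \<in> Sec" for X Y Z q
    using nph_cyclic[OF that] by (simp add: B_def)
  have shift: "B X (ph Y) Z q = B X Y (ph Z) q" if "X \<in> Sec" "Y \<in> Sec" "Z \<in> Sec" for X Y Z q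
    using that F_skew[of Y "nph X Z"] by (simp add: B_def nph_ph F_def)
  have nij: "B (ph X) W Y q - B (ph Y) W X q - B Y (ph W) X q + B X (ph W) Y q = 0"
    if "X \<in> Sec" "Y \<in> Sec" "W \<in> Sec" for X Y W q
  proof -
    have "met W (nph (ph X) Y - nph (ph Y) X + ph (nph Y X) - ph (nph X Y)) = 0"
      using nph_nijenhuis[OF that(1,2)] that by simp
    then have "met W (nph (ph X) Y) - met W (nph (ph Y) X) + met W (ph (nph Y X)) - met W (ph
        (nph X Y)) = 0"
      using that by simp
    from fun_cong[OF this, of q] show ?thesis
      using that F_skew[of W "nph Y X"] F_skew[of W "nph X Y"] by (simp add: B_def F_def)
  qed
  \<comment> \<open>Two instances of \<open>cyc\<close> remove \<open>ph\<close> from the direction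
    of differentiation in \<open>nij\<close>. After \<open>shift\<close> and \<open>skew\<close>
    everything cancels except \<open>2 * B W V (ph Y) q\<close>.\<close>
  have B_ph: "B W V (ph Y) q = 0" if V: "V \<in> Sec" and Y: "Y \<in> Sec" and W: "W \<in> Sec" for V Y W q
    using nij[OF V Y W, of q] cyc[OF ph_Sec[OF V] W Y, of q] cyc[OF ph_Sec[OF Y] W V, of q]
      shift[OF Y V W, of q] skew[OF Y V ph_Sec[OF W], of q] shift[OF Y W V, of q]
      shift[OF V Y W, of q] skew[OF V Y ph_Sec[OF W], of q] shift[OF V W Y, of q]
      skew[OF Y W ph_Sec[OF V], of q] skew[OF V W ph_Sec[OF Y], of q]
      shift[OF W Y V, of q] skew[OF W V ph_Sec[OF Y], of q] skew[OF W Y ph_Sec[OF V], of q]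
      shift[OF W V Y, of q]
    by linarith
  have "nph X (ph Y) = 0"
  proof (rule met_eqI)
    fix Z
    assume Z: "Z \<in> Sec"
    then show "met (nph X (ph Y)) Z = met 0 Z"
      using B_ph[OF Z Y X] met_sym[of Z "nph X (ph Y)"] X Y by (simp add: B_def fun_eq_iff)
  qed (use X Y in simp_all)
  then have "ph (nph X Y) = 0"
    using nph_ph[OF X Y] by simp
  moreover have "met (xi i) (nph X Y) = 0" if "i \<in> I" for i
    using nph_skew[OF X Y xi_Sec[OF that]] nph_xi[OF that X] Y by simp
  ultimately show ?thesis
    using eq_0I[of "nph X Y"] X Y by simp
qed

lemma nab_D_parallel_ph: "X \<in> Sec \<Longrightarrow> Y \<in> Sec \<Longrightarrow> nab D X (ph Y) = ph (nab D X Y)"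
  by (simp add: nab_D_ph nph_zero)

lemma nab_D_tor:
  assumes "X \<in> Sec" "Y \<in> Sec" "Z \<in> Sec"
  shows "nab D X (tor Y Z) = tor (nab D X Y) Z + tor Y (nab D X Z)"
  using assms by (simp add: tor_def F_def act_met_D nab_D_parallel_ph algebra_simps)

subsection \<open>Curvature and Ricci tensor\<close>

text \<open>Substitute \<open>Dg = D - tor\<close>. By \<open>nab_D_tor\<close> no derivative of
  \<open>tor\<close> remains, and the doubled summand is the torsion of \<open>D\<close> hidden in
  \<open>bracket X Y\<close>.\<close>

lemma curv_D:
  assumes "X \<in> Sec" "Y \<in> Sec" "Z \<in> Sec"
  shows "curv D X Y Z = curv Dg X Y Z + tor (tor X Y) Z + tor (tor X Y) Z
    - tor X (tor Y Z) + tor Y (tor X Z)"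
proof -
  have Dg: "nab Dg X Y = nab D X Y - tor X Y" if "X \<in> Sec" "Y \<in> Sec" for X Y
    using that by (simp add: nab_D)
  have br: "tor (bracket X Y) Z = tor (nab D X Y) Z - tor (nab D Y X) Z - tor (tor X Y) Z - tor
      (tor X Y) Z"
    using assms by (simp add: bracket_D)
  show ?thesis
    using assms by (simp add: curv_def Dg nab_D_tor br algebra_simps)
qed

text \<open>For equal last arguments \<open>tor Y Y\<close> is zero, and one of the two copies of
  \<open>tor (tor X Y) Y\<close> in \<open>curv_D\<close> cancels against
  \<open>tor Y (tor X Y)\<close>. Total skew-symmetry moves the outer \<open>tor\<close> of the
  remaining copy across the metric.\<close>

lemma ricci_summand_D:
  assumes "X \<in> Sec" "Y \<in> Sec" "V \<in> Sec"
  shows "met (curv D X Y Y) V = met (curv Dg X Y Y) V - met (tor X Y) (tor V Y)"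
proof -
  have yy: "tor Y Y = 0"
    using tor_skew[OF assms(2,2)] by (simp add: fun_eq_iff)
  have "tor X 0 = 0"
    using tor_linear(2)[of 0 0 X] assms by simp
  moreover have "tor Y (tor X Y) = - tor (tor X Y) Y"
    using assms by (intro tor_skew) simp_all
  ultimately have "curv D X Y Y = curv Dg X Y Y + tor (tor X Y) Y"
    using curv_D[OF assms(1,2,2)] yy by simp
  moreover have "met (tor (tor X Y) Y) V = - met (tor X Y) (tor V Y)"
  proof -
    let ?P = "tor X Y"
    have "met (tor ?P Y) V = - met (tor Y ?P) V"
      using assms tor_skew[of Y ?P] by simp
    also have "\<dots> = met ?P (tor Y V)"
      using met_tor_skew[of Y ?P V] assms by simp
    also have "\<dots> = - met ?P (tor V Y)"
      using assms tor_skew[of V Y] by simp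
    finally show ?thesis .
  qed
  ultimately show ?thesis
    using assms by simp
qed

text \<open>Terms with \<open>met xb X\<close> vanish since \<open>X\<close> is horizontal at
  \<open>q\<close>. By Parseval the remaining sums are \<open>s g(\<phi>X, \<phi>V)\<close>,
  \<open>g(\<phi>X, \<phi>V) g(xb, xb)\<close> and a multiple of
  \<open>g(xb, \<phi>\<^sup>2 X) = 0\<close>; each of the first two is
  \<open>s g(X, V)\<close>.\<close>

lemma tor_trace:
  assumes e: "frame e" and q: "q \<in> U" and X: "X \<in> Sec" and V: "V \<in> Sec"
    and hor: "\<And>i. i \<in> I \<Longrightarrow> \<eta> i q (X q) = 0"
  shows "(\<Sum>a = 1..DIM('e). met (tor X (e a)) (tor V (e a)) q) = 2 * real s * met X V q"
proof -
  let ?J = "{1..DIM('e)}"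
  note eS = frame_Sec[OF e]
  have hX: "met xb X q = 0"
    using hor X q by (simp add: met_xb sum_fun_apply met_xi_apply)
  have phXV: "met (ph X) (ph V) q = met X V q"
    using hor X V q by (simp add: met_ph_ph sum_fun_apply met_xi_apply)
  have summand: "met (tor X Y) (tor V Y) q =
      real s * (met (ph X) Y q * met (ph V) Y q) + met (ph X) (ph V) q * (met xb Y q * met xb Y q)
      + met xb V q * (met xb Y q * met (ph (ph X)) Y q)" if Y: "Y \<in> Sec" for Y
  proof -
    have "met (tor X Y) (tor V Y) q = F X Y q * F V Y q * met xb xb q
       + met xb X q * met xb V q * met (ph Y) (ph Y) q - met xb X q * met xb Y q * met (ph Y)
           (ph V) q
       - met xb Y q * met xb V q * met (ph X) (ph Y) q + met xb Y q * met xb Y q * met (ph X)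
           (ph V) q"
      using X Y V by (simp add: tor_def algebra_simps)
    then show ?thesis
      using q F_skew[OF X Y] F_skew[OF V Y] F_skew[OF ph_Sec[OF X] Y]
      by (simp add: hX met_xb_xb F_def)
  qed
  have pars: "(\<Sum>a\<in>?J. met P (e a) q * met Q (e a) q) = met P Q q" if "P \<in> Sec" "Q \<in> Sec" for P Q
    using parseval[OF frame_basis[OF e q] Sec_T[OF that(1)] Sec_T[OF that(2)]] by (simp add:
        met_def)
  have "(\<Sum>a\<in>?J. met (tor X (e a)) (tor V (e a)) q) =
      real s * (\<Sum>a\<in>?J. met (ph X) (e a) q * met (ph V) (e a) q)
      + met (ph X) (ph V) q * (\<Sum>a\<in>?J. met xb (e a) q * met xb (e a) q)
      + met xb V q * (\<Sum>a\<in>?J. met xb (e a) q * met (ph (ph X)) (e a) q)"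
    using eS by (simp add: summand sum.distrib sum_distrib_left)
  also have "\<dots> = 2 * real s * met X V q"
    unfolding pars[OF ph_Sec[OF X] ph_Sec[OF V]] pars[OF xb_Sec xb_Sec] pars[OF xb_Sec ph_Sec[OF
        ph_Sec[OF X]]]
    using X q by (simp add: phXV met_xb_xb)
  finally show ?thesis .
qed

text \<open>The curvature kills the parallel field \<open>xi i\<close>, and metric skewness moves
  that field to the other slot.\<close>

lemma curv_D_xi:
  assumes "i \<in> I" "X \<in> Sec" "Y \<in> Sec" "Z \<in> Sec"
  shows "met (curv D X Y Z) (xi i) = 0"
proof -
  have "curv D X Y (xi i) = 0"
    using assms by (simp add: curv_def)
  then show ?thesis
    using curv_metric_skew[OF affine_D metric_connection_D assms(2-4) xi_Sec[OF assms(1)]] assms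
        by simp
qed

lemma ricci_summand_D_symmetric:
  assumes "X \<in> Sec" "Y \<in> Sec" "Z \<in> Sec"
  shows "met (curv D X Z Z) Y = met (curv D Y Z Z) X"
  using assms ricci_summand_symmetric[OF assms] met_sym[of "tor X Z" "tor Y Z"]
  by (simp add: ricci_summand_D)

lemma ricci_Sec:
  assumes e: "frame e" and p: "p \<in> U" and X: "X \<in> Sec" and Y: "Y \<in> Sec" and E:
      "affine_connection A E"
  shows "ricci A g E p (X p) (Y p) = (\<Sum>a = 1..DIM('e). met (curv E X (e a) (e a)) Y p)"
  using ricci_eq[OF riemannian_sections_axioms E p e X Sec_T[OF Y]] by (simp add: met_def)

text \<open>The second argument ranges over all tangent vectors, because the Ricci endomorphism is
  determined by its products with all of them.\<close>

lemma ricci_D_horizontal: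
  assumes e: "frame e" and p: "p \<in> U" and u: "u \<in> horizontal A \<phi> p" and v: "v \<in> T p"
  shows "ricci A g D p u v = ricci A g Dg p u v - 2 * real s * g p u v"
proof -
  have uT: "u \<in> T p" and hor: "\<eta> i p u = 0" if "i \<in> I" for i
    using u that by (auto simp: horizontal_def eta_phi)
  obtain X where X: "X \<in> Sec" "X p = u"
    using Sec_through[OF e p uT[OF one_in_I]] .
  obtain Y where Y: "Y \<in> Sec" "Y p = v"
    using Sec_through[OF e p v] .
  have "ricci A g D p u v = (\<Sum>a = 1..DIM('e). met (curv Dg X (e a) (e a)) Y p - met (tor X (e
      a)) (tor Y (e a)) p)"
    using ricci_Sec[OF e p X(1) Y(1) affine_D] X Y frame_Sec[OF e] by (simp add: ricci_summand_D)
  also have "\<dots> = ricci A g Dg p u v - 2 * real s * met X Y p"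
    using ricci_Sec[OF e p X(1) Y(1) affine_Dg] tor_trace[OF e p X(1) Y(1)] X(2) Y(2) hor
    by (simp add: sum_subtractf)
  finally show ?thesis
    using X Y by (simp add: met_def)
qed

lemma ricci_D_xi_right:
  assumes e: "frame e" and p: "p \<in> U" and i: "i \<in> I" and u: "u \<in> T p"
  shows "ricci A g D p u (\<xi> i p) = 0"
proof -
  obtain X where X: "X \<in> Sec" "X p = u"
    using Sec_through[OF e p u] .
  show ?thesis
    using ricci_Sec[OF e p X(1) xi_Sec[OF i] affine_D] X frame_Sec[OF e] curv_D_xi[OF i] 
    by (simp add: xi_apply[OF p])
qed

text \<open>\<open>curv_D_xi\<close> controls the second argument of the Ricci tensor. Symmetry of
  the summands transfers this to the first argument, and linearity passes from the Reeb fields to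
  their span.\<close>

lemma ricci_D_vertical_left:
  assumes e: "frame e" and p: "p \<in> U" and u: "u \<in> vertical A \<phi> p" and v: "v \<in> T p"
  shows "ricci A g D p u v = 0"
proof -
  have uT: "u \<in> T p" and "\<phi> p u = 0"
    using u by (auto simp: vertical_def)
  then have u_eq: "u = (\<Sum>i\<in>I. \<eta> i p u *\<^sub>R \<xi> i p)"
    using phi_phi[OF uT] by (simp add: eq_neg_iff_add_eq_0 neg_eq_iff_add_eq_0)
  obtain Y where Y: "Y \<in> Sec" "Y p = v"
    using Sec_through[OF e p v] .
  define X where "X = (\<Sum>i\<in>I. \<eta> i p u *\<^sub>R xi i)"
  have X: "X \<in> Sec"
    unfolding X_def by (intro Sec_sum Sec_scaleR xi_Sec)
  have "X p = (\<Sum>i\<in>I. \<eta> i p u *\<^sub>R \<xi> i p)"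
    unfolding X_def sum_fun_apply[of _ _ p] by (intro sum.cong refl) (simp only:
        scaleR_fun_apply xi_apply[OF p])
  then have Xp: "X p = u"
    using u_eq by simp
  have "met W X p = 0" if W: "W \<in> Sec" "\<And>i. i \<in> I \<Longrightarrow> met W (xi i) = 0" for W
  proof -
    have "met W X p = (\<Sum>i\<in>I. g p (W p) (\<eta> i p u *\<^sub>R \<xi> i p))"
      unfolding met_def Xp by (subst u_eq, rule g_sum_right) (simp_all add: W)
    also have "\<dots> = (\<Sum>i\<in>I. \<eta> i p u * met W (xi i) p)"
      using W(1) by (intro sum.cong refl) (simp add: met_def xi_apply[OF p])
    finally show ?thesis
      using W by simp
  qed
  then have "met (curv D Y (e a) (e a)) X p = 0" if "a \<in> {1..DIM('e)}" for a
    using frame_Sec[OF e that] Y curv_D_xi by simp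
  then show ?thesis
    using ricci_Sec[OF e p X Y(1) affine_D] Xp Y ricci_summand_D_symmetric[OF X Y(1)]
        frame_Sec[OF e]
    by simp
qed

text \<open>The vector-valued trace of the curvature is a witness for the \<open>THE\<close> in
  \<open>ricci_endomorphism\<close>.\<close>

lemma ricci_endomorphism_Dg:
  assumes e: "frame e" and p: "p \<in> U" and u: "u \<in> T p"
  shows "ricci_endomorphism A g Dg p u \<in> T p \<and>
    (\<forall>v\<in>T p. g p (ricci_endomorphism A g Dg p u) v = ricci A g Dg p u v)"
proof -
  obtain X where X: "X \<in> Sec" "X p = u"
    using Sec_through[OF e p u] .
  let ?w = "\<Sum>a = 1..DIM('e). curv Dg X (e a) (e a) p"
  have eT: "curv Dg X (e a) (e a) p \<in> T p" if "a \<in> {1..DIM('e)}" for a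
    using frame_Sec[OF e that] X by simp
  have w: "?w \<in> T p"
    using eT by (rule T_sum)
  have wv: "g p ?w v = ricci A g Dg p u v" if v: "v \<in> T p" for v
  proof -
    have "g p ?w v = (\<Sum>a = 1..DIM('e). g p (curv Dg X (e a) (e a) p) v)"
      using eT v by (rule g_sum_left)
    then show ?thesis
      using ricci_eq[OF riemannian_sections_axioms affine_Dg p e X(1) v] X(2) by simp
  qed
  have "ricci_endomorphism A g Dg p u = ?w"
    using riemannian_manifold_axioms w wv by (rule ricci_endomorphism_eq)
  then show ?thesis
    using w wv by simp
qed

end

theorem proposition3p9:
  fixes A :: "('a::{t2_space,second_countable_topology}, 'e::euclidean_space) chart set"
    and n s :: nat
    and \<phi> :: "'a \<Rightarrow> 'a tvec \<Rightarrow> 'a tvec"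
    and \<xi> :: "nat \<Rightarrow> 'a vfield"
    and \<eta> :: "nat \<Rightarrow> 'a \<Rightarrow> 'a tvec \<Rightarrow> real"
    and g :: "'a \<Rightarrow> 'a tvec \<Rightarrow> 'a tvec \<Rightarrow> real"
    and Dg D :: "'a vfield \<Rightarrow> 'a vfield \<Rightarrow> 'a vfield"
  assumes "S_manifold A n s \<phi> \<xi> \<eta> g"
    and "levi_civita_connection A g Dg"
    and "D = characteristic_connection s \<phi> \<xi> \<eta> g Dg"
  shows "(\<forall>p. \<forall>u\<in>horizontal A \<phi> p. \<forall>v\<in>horizontal A \<phi> p.
           ricci A g D p u v = ricci A g Dg p u v - 2 * real s * g p u v)
       \<and> (\<forall>p. \<forall>u\<in>horizontal A \<phi> p. \<forall>i\<in>{1..s}. ricci A g D p u (\<xi> i p) = 0)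
       \<and> (\<forall>p. \<forall>i\<in>{1..s}. \<forall>j\<in>{1..s}. ricci A g D p (\<xi> i p) (\<xi> j p) = 0)
       \<and> (\<forall>p. \<forall>u\<in>horizontal A \<phi> p.
           ricci_endomorphism A g D p u = ricci_endomorphism A g Dg p u - (2 * real s) *\<^sub>R u)
       \<and> (\<forall>p. \<forall>u\<in>vertical A \<phi> p. ricci_endomorphism A g D p u = 0)"
proof -
  interpret S_manifold A n s \<phi> \<xi> \<eta> g by fact
  interpret R: riemannian_manifold A g
    using metric by unfold_locales
  have "(\<forall>u\<in>horizontal A \<phi> p. \<forall>v\<in>horizontal A \<phi> p.
           ricci A g D p u v = ricci A g Dg p u v - 2 * real s * g p u v)
       \<and> (\<forall>u\<in>horizontal A \<phi> p. \<forall>i\<in>{1..s}. ricci A g D p u (\<xi> i p) = 0)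
       \<and> (\<forall>i\<in>{1..s}. \<forall>j\<in>{1..s}. ricci A g D p (\<xi> i p) (\<xi> j p) = 0)
       \<and> (\<forall>u\<in>horizontal A \<phi> p.
           ricci_endomorphism A g D p u = ricci_endomorphism A g Dg p u - (2 * real s) *\<^sub>R u)
       \<and> (\<forall>u\<in>vertical A \<phi> p. ricci_endomorphism A g D p u = 0)" for p
  proof -
    obtain U e where U: "open U" "p \<in> U" "orthonormal_frame A g U e"
      by (rule R.local_orthonormal_frame)
    interpret L: S_sections A n s \<phi> \<xi> \<eta> g Dg U
      using U(1) assms(2) by unfold_locales
    note e = L.frame_cut[OF U(3) order.refl]
    have hor: "u \<in> tangent_space A p" if "u \<in> horizontal A \<phi> p" for u
      using that L.phi_T by (auto simp: horizontal_def)
    show ?thesis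
      unfolding assms(3)
    proof (intro conjI ballI)
      fix u
      assume u: "u \<in> horizontal A \<phi> p"
      show "ricci A g L.D p u v = ricci A g Dg p u v - 2 * real s * g p u v" if "v \<in> horizontal A \<phi> p" for v
        using L.ricci_D_horizontal[OF e U(2) u hor[OF that]] .
      show "ricci A g L.D p u (\<xi> i p) = 0" if "i \<in> {1..s}" for i
        using L.ricci_D_xi_right[OF e U(2) that hor[OF u]] .
      \<comment> \<open>The right-hand side has the required product with every tangent
        \<open>v\<close>, which settles existence and value of the endomorphism for \<open>D\<close>
        together.\<close>
      show "ricci_endomorphism A g L.D p u = ricci_endomorphism A g Dg p u - (2 * real s) *\<^sub>R u"
        using L.ricci_endomorphism_Dg[OF e U(2) hor[OF u]] hor[OF u] L.ricci_D_horizontal[OF e U(2) u]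
        by (intro ricci_endomorphism_eq[OF R.riemannian_manifold_axioms]) simp_all
    next
      show "ricci A g L.D p (\<xi> i p) (\<xi> j p) = 0" if "i \<in> {1..s}" "j \<in> {1..s}" for i j
        using L.ricci_D_xi_right[OF e U(2) that(2) L.xi_T[OF that(1)]] .
      show "ricci_endomorphism A g L.D p u = 0" if "u \<in> vertical A \<phi> p" for u
        using L.ricci_D_vertical_left[OF e U(2) that]
        by (intro ricci_endomorphism_eq[OF R.riemannian_manifold_axioms]) simp_all
    qed
  qed
  then show ?thesis
    by blast
qed

end
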